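(* Let $n,N\ge1$ be integers and $k_1,\dots,k_N$ positive integers with $\sum_{j=1}^{N}k_j\le n$. Write $K_j=\sum_{m=1}^{j}k_m$ (with $K_0=0$) and $\mathbb{R}^n=\mathbb{R}^{k_1}\times\mathbb{R}^{k_2}\times\cdots\times\mathbb{R}^{k_N}\times\mathbb{R}^{n-K_N}$, where the $j$-th factor carries the variables $x_{K_{j-1}+1},\dots,x_{K_j}$ and the last factor the variables $x_{K_N+1},\dots,x_n$. Let $$r_j=\sqrt{x_{K_{j-1}+1}^2+x_{K_{j-1}+2}^2+\cdots+x_{K_j}^2},\qquad 1\le j\le N.$$ Let $0<p,q\le\infty$, and for $1\le j\le N$ let $\overrightarrow{p_j}=((\overrightarrow{p_j})_1,\dots,(\overrightarrow{p_j})_{k_j})$ and $\overrightarrow{q_j}=((\overrightarrow{q_j})_1,\dots,(\overrightarrow{q_j})_{k_j})$ satisfy $1<(\overrightarrow{p_j})_\ell<\infty$ and $1\le(\overrightarrow{q_j})_\ell\le\infty$, and let $0<\alpha_j<\frac{k_j}{(\overrightarrow{p_j})_\ell}$, for all $1\le\ell\le k_j$. Then there is a constant $C$, independent of $f$, such that for all $f\in C_0^\infty(\mathbb{R}^n)$ $$\left\|\frac{f(x_1,\dots,x_n)}{\prod_{j=1}^{N}|r_j|^{\alpha_j}}\right\|_{L^{\overrightarrow{p_1},\overrightarrow{q_1}}(\mathbb{R}^{k_1})\cdots L^{\overrightarrow{p_N},\overrightarrow{q_N}}(\mathbb{R}^{k_N})L^{p,q}(\mathbb{R}^{n-K_N})}\le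 C\left\|\Lambda_{x_1,\dots,x_{K_N}}^{\sum_{j=1}^{N}\alpha_j}f\right\|_{L^{\overrightarrow{p_1},\overrightarrow{q_1}}(\mathbb{R}^{k_1})\cdots L^{\overrightarrow{p_N},\overrightarrow{q_N}}(\mathbb{R}^{k_N})L^{p,q}(\mathbb{R}^{n-K_N})}.$$
   Context: Fourier transform: $\hat f(\xi)=(2\pi)^{-n/2}\int_{\mathbb{R}^n}f(x)e^{-i\xi\cdot x}\,dx$. For $\sigma\ge0$, $\Lambda^\sigma_{x_1,\dots,x_k}f$ is defined by $\widehat{\Lambda^\sigma_{x_1,\dots,x_k}f}(\xi)=\big(\sum_{m=1}^k|\xi_m|^2\big)^{\sigma/2}\hat f(\xi)$. Lorentz spaces: for a measurable $g$ on $\mathbb{R}^m$, let $g_*(\alpha)=|\{x:|g(x)|>\alpha\}|$ and $g^*(t)=\inf\{\alpha>0:g_*(\alpha)\le t\}$. For $p,q\in(0,\infty]$, $\|g\|_{L^{p,q}(\mathbb{R}^m)}=\left(\int_0^\infty(t^{1/p}g^*(t))^q\frac{dt}{t}\right)^{1/q}$ if $q<\infty$, and $\|g\|_{L^{p,\infty}(\mathbb{R}^m)}=\sup_{t>0}t^{1/p}g^*(t)$. In particular $L^{\infty,\infty}=L^\infty$ and $L^{\infty,q}=\{0\}$ for $0<q<\infty$. Mixed Lorentz norm in $k$ variables: for $\overrightarrow{p}=(p_1,\dots,p_k)$, $\overrightarrow{q}=(q_1,\dots,q_k)$, $$\|g\|_{L^{\overrightarrow{p},\overrightarrow{q}}(\mathbb{R}^k)}=\Big\|\cdots\big\|\,\|g\|_{L^{p_1,q_1}_{y_1}(\mathbb{R})}\big\|_{L^{p_2,q_2}_{y_2}(\mathbb{R})}\cdots\Big\|_{L^{p_k,q_k}_{y_k}(\mathbb{R})},$$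 the norm in the first variable being innermost. The norm $L^{\overrightarrow{p_1},\overrightarrow{q_1}}(\mathbb{R}^{k_1})\cdots L^{\overrightarrow{p_N},\overrightarrow{q_N}}(\mathbb{R}^{k_N})L^{p,q}(\mathbb{R}^{n-K_N})$ is the iterated norm obtained by taking first the $L^{\overrightarrow{p_1},\overrightarrow{q_1}}$ norm in the first block of variables, then the $L^{\overrightarrow{p_2},\overrightarrow{q_2}}$ norm in the second block, and so on, and finally the Lorentz norm $L^{p,q}$ in the remaining $n-K_N$ variables (this last step being omitted if $n=K_N$). Norms take values in $[0,\infty]$. *)

theory Defs
  imports "HOL-Analysis.Analysis"
begin

text \<open>
  The statement integrates successively over single coordinates of \<open>\<real>\<^sup>n\<close> and then over the remaining
  \<open>n - K\<^sub>N\<close> of them, so \<open>\<real>\<^sup>n\<close> is the set of real families with index set \<open>{1..n}\<close>,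
  extended by \<^const>\<open>undefined\<close>.  In the product topology of \<^typ>\<open>nat \<Rightarrow> real\<close> this set carries the
  usual topology of \<open>\<real>\<^sup>n\<close>.
\<close>

abbreviation Rn :: "nat \<Rightarrow> (nat \<Rightarrow> real) set" where
  "Rn n \<equiv> PiE {1..n} (\<lambda>_. UNIV)"

abbreviation leb :: "nat set \<Rightarrow> (nat \<Rightarrow> real) measure" where
  "leb I \<equiv> PiM I (\<lambda>_. lborel)"


section \<open>Test functions\<close>

definition partial_deriv ::
  "nat \<Rightarrow> ((nat \<Rightarrow> real) \<Rightarrow> complex) \<Rightarrow> (nat \<Rightarrow> real) \<Rightarrow> complex" where
  "partial_deriv i f x = vector_derivative (\<lambda>t. f (x(i := t))) (at (x i))"

definition smooth_Rn :: "nat \<Rightarrow> ((nat \<Rightarrow> real) \<Rightarrow> complex) \<Rightarrow> bool" where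
  "smooth_Rn n f \<longleftrightarrow>
     (\<forall>is. set is \<subseteq> {1..n} \<longrightarrow>
        continuous_on (Rn n) (foldr partial_deriv is f) \<and>
        (\<forall>i\<in>{1..n}. \<forall>x\<in>Rn n.
           (\<lambda>t. foldr partial_deriv is f (x(i := t))) differentiable (at (x i))))"

definition test_function :: "nat \<Rightarrow> ((nat \<Rightarrow> real) \<Rightarrow> complex) \<Rightarrow> bool" where
  "test_function n f \<longleftrightarrow> smooth_Rn n f \<and> compact (closure {x \<in> Rn n. f x \<noteq> 0})"


section \<open>Fourier transform and the operators \<open>\<Lambda>\<close>\<close>

definition fourier ::
  "nat \<Rightarrow> ((nat \<Rightarrow> real) \<Rightarrow> complex) \<Rightarrow> (nat \<Rightarrow> real) \<Rightarrow> complex" where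
  "fourier n f \<xi> = complex_of_real ((2 * pi) powr (- (real n / 2))) *
     (LINT x|leb {1..n}. f x * exp (- (\<i> * complex_of_real (\<Sum>i=1..n. \<xi> i * x i))))"

definition inv_fourier ::
  "nat \<Rightarrow> ((nat \<Rightarrow> real) \<Rightarrow> complex) \<Rightarrow> (nat \<Rightarrow> real) \<Rightarrow> complex" where
  "inv_fourier n g x = complex_of_real ((2 * pi) powr (- (real n / 2))) *
     (LINT \<xi>|leb {1..n}. g \<xi> * exp (\<i> * complex_of_real (\<Sum>i=1..n. \<xi> i * x i)))"

text \<open>
  \<open>Lambda_op n k \<sigma> f\<close> is \<open>\<Lambda>\<^sup>\<sigma> f\<close> with respect to the first \<open>k\<close> of the \<open>n\<close> variables, i.e. the function
  with Fourier transform \<open>(\<xi>\<^sub>1\<^sup>2 + \<dots> + \<xi>\<^sub>k\<^sup>2) powr (\<sigma>/2) * fourier n f \<xi>\<close>.  For a test function \<open>f\<close> and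
  \<open>\<sigma> \<ge> 0\<close> this product is integrable, so the inverse transform is an absolutely convergent integral.
\<close>

definition Lambda_op ::
  "nat \<Rightarrow> nat \<Rightarrow> real \<Rightarrow> ((nat \<Rightarrow> real) \<Rightarrow> complex) \<Rightarrow> (nat \<Rightarrow> real) \<Rightarrow> complex" where
  "Lambda_op n k \<sigma> f =
     inv_fourier n (\<lambda>\<xi>. complex_of_real ((\<Sum>m=1..k. (\<xi> m)\<^sup>2) powr (\<sigma> / 2)) * fourier n f \<xi>)"


section \<open>Lorentz norms\<close>

definition distribution_fun :: "'a measure \<Rightarrow> ('a \<Rightarrow> ennreal) \<Rightarrow> ennreal \<Rightarrow> ennreal" where
  "distribution_fun M g \<alpha> = emeasure M {x \<in> space M. g x > \<alpha>}"

definition rearrangement :: "'a measure \<Rightarrow> ('a \<Rightarrow> ennreal) \<Rightarrow> real \<Rightarrow> ennreal" where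
  "rearrangement M g t = Inf {\<alpha>. 0 < \<alpha> \<and> distribution_fun M g \<alpha> \<le> ennreal t}"

text \<open>Powers with a positive exponent on \<open>[0,\<infinity>]\<close>.\<close>

definition ennpowr :: "ennreal \<Rightarrow> real \<Rightarrow> ennreal" where
  "ennpowr x a = (if x = \<infinity> then \<infinity> else ennreal (enn2real x powr a))"

text \<open>For \<open>p = \<infinity>\<close> the exponent \<open>1 / p\<close> is \<^term>\<open>enn2real (inverse \<infinity>) = 0\<close>.\<close>

definition lorentz_norm :: "'a measure \<Rightarrow> ennreal \<Rightarrow> ennreal \<Rightarrow> ('a \<Rightarrow> ennreal) \<Rightarrow> ennreal" where
  "lorentz_norm M p q g =
     (let w = (\<lambda>t. ennreal (t powr enn2real (inverse p)) * rearrangement M g t) in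
      if q = \<infinity> then (SUP t\<in>{0<..}. w t)
      else ennpowr
             (\<integral>\<^sup>+ t\<in>{0<..}. ennpowr (w t) (enn2real q) * ennreal (1 / t) \<partial>lborel)
             (1 / enn2real q))"

text \<open>
  Mixed norm in the variables \<open>x\<^bsub>s+1\<^esub>, \<dots>, x\<^bsub>s+k\<^esub>\<close>, with \<open>x\<^bsub>s+1\<^esub>\<close> innermost; the result is a
  function of the other variables.
\<close>

fun mixed_lorentz_norm ::
  "nat \<Rightarrow> nat \<Rightarrow> (nat \<Rightarrow> ennreal) \<Rightarrow> (nat \<Rightarrow> ennreal) \<Rightarrow> ((nat \<Rightarrow> real) \<Rightarrow> ennreal) \<Rightarrow>
   (nat \<Rightarrow> real) \<Rightarrow> ennreal" where
  "mixed_lorentz_norm s 0 p q g x = g x"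
| "mixed_lorentz_norm s (Suc k) p q g x =
     lorentz_norm lborel (p (Suc k)) (q (Suc k))
       (\<lambda>t. mixed_lorentz_norm s k p q g (x(s + Suc k := t)))"

definition block_end :: "(nat \<Rightarrow> nat) \<Rightarrow> nat \<Rightarrow> nat" where
  "block_end k j = (\<Sum>m=1..j. k m)"

fun blocks_lorentz_norm ::
  "(nat \<Rightarrow> nat) \<Rightarrow> nat \<Rightarrow> (nat \<Rightarrow> nat \<Rightarrow> ennreal) \<Rightarrow> (nat \<Rightarrow> nat \<Rightarrow> ennreal) \<Rightarrow>
   ((nat \<Rightarrow> real) \<Rightarrow> ennreal) \<Rightarrow> (nat \<Rightarrow> real) \<Rightarrow> ennreal" where
  "blocks_lorentz_norm k 0 P Q g x = g x"
| "blocks_lorentz_norm k (Suc j) P Q g x =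
     mixed_lorentz_norm (block_end k j) (k (Suc j)) (P (Suc j)) (Q (Suc j))
       (blocks_lorentz_norm k j P Q g) x"

text \<open>
  The full iterated norm of a complex function on \<open>\<real>\<^sup>n\<close>.  If the blocks exhaust all variables, there
  is nothing left to integrate over, and \<open>\<lambda>_. undefined\<close> is the only element of \<open>\<real>\<^sup>0\<close>.
\<close>

definition iterated_lorentz_norm ::
  "nat \<Rightarrow> nat \<Rightarrow> (nat \<Rightarrow> nat) \<Rightarrow> (nat \<Rightarrow> nat \<Rightarrow> ennreal) \<Rightarrow> (nat \<Rightarrow> nat \<Rightarrow> ennreal) \<Rightarrow>
   ennreal \<Rightarrow> ennreal \<Rightarrow> ((nat \<Rightarrow> real) \<Rightarrow> complex) \<Rightarrow> ennreal" where
  "iterated_lorentz_norm n N k P Q p q g =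
     (let h = blocks_lorentz_norm k N P Q (\<lambda>x. ennreal (cmod (g x))) in
      if block_end k N = n then h (\<lambda>_. undefined)
      else lorentz_norm (leb {block_end k N + 1..n}) p q h)"

definition block_radius :: "(nat \<Rightarrow> nat) \<Rightarrow> nat \<Rightarrow> (nat \<Rightarrow> real) \<Rightarrow> real" where
  "block_radius k j x = sqrt (\<Sum>i = block_end k (j - 1) + 1..block_end k j. (x i)\<^sup>2)"

end

theory Submission
  imports Defs "HOL-Probability.Probability"
begin

text \<open>
  Let \<open>K\<close> be the number of variables in the \<open>N\<close> blocks, \<open>\<sigma> = \<alpha>\<^sub>1 + \<dots> + \<alpha>\<^sub>N\<close> and \<open>g = \<Lambda>\<^sup>\<sigma> f\<close>, so that
  \<open>0 < \<sigma> < K\<close>.  The inequality says that \<open>f\<close>, a Riesz potential of \<open>g\<close> in the first \<open>K\<close> variables,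
  stays under control after division by the radii.  The proof turns the weighted potential into an
  average of dilates of \<open>g\<close>.

  Since \<open>f\<close> has Fourier transform \<open>\<bar>\<xi>\<bar>\<^bsup>-\<sigma>\<^esup>\<close> times that of \<open>g\<close>, writing the power as a superposition of
  the Gaussians \<open>exp (- t \<bar>\<xi>\<bar>\<^sup>2)\<close> gives \<open>\<bar>f(x)\<bar> \<le> C \<integral> \<bar>y\<bar>\<^bsup>\<sigma>-K\<^esup> \<bar>g(x - y)\<bar> dy\<close>, where \<open>y\<close> runs over \<open>\<real>\<^sup>K\<close>
  (lemma \<open>riesz_potential_bound\<close>).

  Spread the exponents evenly: put \<open>a\<^sub>i = \<alpha>\<^sub>j / k\<^sub>j\<close> when \<open>x\<^sub>i\<close> belongs to block \<open>j\<close>.  The hypothesis on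
  \<open>\<alpha>\<^sub>j\<close> says precisely that \<open>0 < a\<^sub>i < 1 / p\<^sub>i\<close>, where \<open>p\<^sub>i\<close> is the first exponent attached to \<open>x\<^sub>i\<close>.  A
  Euclidean norm dominates the modulus of each coordinate, hence \<open>\<bar>y\<bar>\<^bsup>\<sigma>-K\<^esup>\<close> is at most the product of the
  \<open>\<bar>y\<^sub>i\<bar>\<^bsup>a\<^sub>i-1\<^esup>\<close>, and the product of the \<open>r\<^sub>j\<^bsup>-\<alpha>\<^sub>j\<^esup>\<close> is at most the product of the \<open>\<bar>x\<^sub>i\<bar>\<^bsup>-a\<^sub>i\<^esup>\<close>.
  Substituting \<open>y\<^sub>i = x\<^sub>i (1 - u\<^sub>i)\<close>, all powers of \<open>x\<close> cancel, and the weighted function is bounded by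
  the integral over \<open>u\<close> of \<open>\<Prod>\<^sub>i \<bar>1 - u\<^sub>i\<bar>\<^bsup>a\<^sub>i-1\<^esup> \<bar>g(u\<^sub>1x\<^sub>1, \<dots>, u\<^sub>Kx\<^sub>K, x\<^sub>K\<^sub>+\<^sub>1, \<dots>, x\<^sub>n)\<bar>\<close>
  (lemma \<open>dilation_integral_bound\<close>).

  The iterated norm over the blocks satisfies Minkowski's integral inequality up to a constant,
  because all its exponents satisfy \<open>p > 1\<close> and \<open>q \<ge> 1\<close>, and replacing \<open>x\<^sub>i\<close> by \<open>u\<^sub>ix\<^sub>i\<close> multiplies it by
  \<open>\<Prod>\<^sub>i \<bar>u\<^sub>i\<bar>\<^bsup>-1/p\<^sub>i\<^esup>\<close>.  The constant that results is a product of the one-dimensional integrals of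
  \<open>\<bar>1 - u\<bar>\<^bsup>a-1\<^esup> \<bar>u\<bar>\<^bsup>-1/p\<^esup>\<close>, which are finite because \<open>0 < a < 1 / p < 1\<close> (lemma
  \<open>norm_operator_hardy\<close>).  This bound holds for every value of the remaining variables, so the
  outermost norm enters only through monotonicity and homogeneity; that is why its exponents can be
  arbitrary.

  Minkowski's inequality for one Lorentz norm (lemma \<open>lorentz_minkowski\<close>) rests on an estimate for
  rearrangements: \<open>g = \<integral> F\<^sub>u du\<close> satisfies \<open>g\<^sup>*(t) \<le> \<integral>\<integral>\<^sub>0\<^sup>1 F\<^sub>u\<^sup>*(st) ds du\<close>.  This is linear in the
  rearrangements, and the \<open>L\<^sup>q\<close> inequality in \<open>t\<close> does the rest.
\<close>

section \<open>Rearrangements\<close>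

lemma ennpowr_ennreal: "x \<ge> 0 \<Longrightarrow> ennpowr (ennreal x) a = ennreal (x powr a)"
  by (simp add: ennpowr_def)

lemma ennpowr_mono:
  assumes "a \<ge> 0" "x \<le> y" shows "ennpowr x a \<le> ennpowr y a"
proof (cases "y = \<infinity>")
  case False
  then have "x \<noteq> \<infinity>" using assms(2) by (auto simp: top_unique)
  then show ?thesis using False assms
    by (auto simp: ennpowr_def intro!: ennreal_leI powr_mono2 enn2real_mono simp: top.not_eq_extremum)
qed (simp add: ennpowr_def)

lemma ennpowr_mult: "ennpowr (x * y) a = ennpowr x a * ennpowr y a"
  by (cases x; cases y)
    (auto simp: ennpowr_def ennreal_mult_top ennreal_top_mult ennreal_mult' [symmetric] powr_mult
      ennreal_mult_eq_top_iff)

lemma ennpowr_inverse: "a \<noteq> 0 \<Longrightarrow> ennpowr (ennpowr x a) (1 / a) = x"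
  by (cases x) (auto simp: ennpowr_def powr_powr)

lemma measurable_ennpowr [measurable]:
  assumes "f \<in> borel_measurable M" shows "(\<lambda>x. ennpowr (f x) a) \<in> borel_measurable M"
  using assms unfolding ennpowr_def by measurable

lemma distribution_fun_antimono:
  assumes "g \<in> borel_measurable M" "\<alpha> \<le> \<beta>"
  shows "distribution_fun M g \<beta> \<le> distribution_fun M g \<alpha>"
  unfolding distribution_fun_def using assms by (intro emeasure_mono) auto

lemma rearrangement_less_iff:
  "rearrangement M g t < \<beta> \<longleftrightarrow> (\<exists>\<alpha>. 0 < \<alpha> \<and> \<alpha> < \<beta> \<and> distribution_fun M g \<alpha> \<le> ennreal t)"
  unfolding rearrangement_def Inf_less_iff by auto

lemma rearrangement_antimono: "s \<le> t \<Longrightarrow> rearrangement M g t \<le> rearrangement M g s"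
  unfolding rearrangement_def by (intro Inf_superset_mono) (auto intro: order_trans ennreal_leI)

text \<open>
  An exceptional null set is allowed because the pointwise estimates used below fail on the
  coordinate hyperplanes.
\<close>

lemma rearrangement_mono_AE:
  assumes "AE x in M. g x \<le> h x" and [measurable]: "h \<in> borel_measurable M"
  shows "rearrangement M g t \<le> rearrangement M h t"
proof -
  have "distribution_fun M g \<alpha> \<le> distribution_fun M h \<alpha>" for \<alpha>
    unfolding distribution_fun_def using assms(1) by (intro emeasure_mono_AE) auto
  then show ?thesis
    unfolding rearrangement_def by (intro Inf_superset_mono) (auto intro: order_trans)
qed

lemma ennreal_mult_inverse_cancel: "c > 0 \<Longrightarrow> ennreal (1 / c) * (ennreal c * x) = x"
  by (simp add: mult.assoc[symmetric] ennreal_mult[symmetric])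

text \<open>
  Multiplication by \<open>c\<close> maps admissible levels of \<open>g\<close> to admissible levels of \<open>c g\<close>, which gives one
  inequality; the other one is the first for \<open>1 / c\<close>.
\<close>

lemma rearrangement_cmult:
  assumes "c > 0"
  shows "rearrangement M (\<lambda>x. ennreal c * g x) t = ennreal c * rearrangement M g t"
proof -
  have le: "ennreal (1 / c) * rearrangement M (\<lambda>x. ennreal c * g x) t \<le> rearrangement M g t"
    if c: "c > 0" for c and g :: "'a \<Rightarrow> ennreal"
    unfolding rearrangement_def[of M g]
  proof (rule Inf_greatest, clarsimp)
    fix \<alpha> assume \<alpha>: "0 < \<alpha>" "distribution_fun M g \<alpha> \<le> ennreal t"
    have "ennreal c * \<alpha> < ennreal c * g x \<longleftrightarrow> \<alpha> < g x" for x
      using c by (simp add: not_le[symmetric] ennreal_mult_le_mult_iff)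
    then have "rearrangement M (\<lambda>x. ennreal c * g x) t \<le> ennreal c * \<alpha>"
      unfolding rearrangement_def using \<alpha> c
      by (intro Inf_lower) (auto simp: distribution_fun_def ennreal_zero_less_mult_iff)
    then have "ennreal (1 / c) * rearrangement M (\<lambda>x. ennreal c * g x) t
        \<le> ennreal (1 / c) * (ennreal c * \<alpha>)"
      by (rule mult_left_mono) simp
    then show "ennreal (1 / c) * rearrangement M (\<lambda>x. ennreal c * g x) t \<le> \<alpha>"
      using c by (simp add: ennreal_mult_inverse_cancel)
  qed
  have cancel: "ennreal c * (ennreal (1 / c) * x) = x" for x
    using assms ennreal_mult_inverse_cancel[of "1 / c"] by simp
  have "ennreal c * rearrangement M g t \<le> rearrangement M (\<lambda>x. ennreal c * g x) t"
    using le[of "1 / c" "\<lambda>x. ennreal c * g x"] assms by (simp add: ennreal_mult_inverse_cancel)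
  moreover have "rearrangement M (\<lambda>x. ennreal c * g x) t \<le> ennreal c * rearrangement M g t"
    using mult_left_mono[OF le[OF assms, of g], of "ennreal c"] by (simp add: cancel)
  ultimately show ?thesis by (rule antisym[rotated])
qed

lemma rearrangement_dilate:
  assumes u: "u \<noteq> 0" and [measurable]: "h \<in> borel_measurable borel"
  shows "rearrangement lborel (\<lambda>x. h (u * x)) t = rearrangement lborel h (\<bar>u\<bar> * t)"
proof -
  have "distribution_fun lborel h \<alpha> = ennreal \<bar>u\<bar> * distribution_fun lborel (\<lambda>x. h (u * x)) \<alpha>" for \<alpha>
  proof -
    have "distribution_fun lborel h \<alpha> = (\<integral>\<^sup>+x. indicator {x. h x > \<alpha>} x \<partial>lborel)"
      by (simp add: distribution_fun_def)
    also have "\<dots> = ennreal \<bar>u\<bar> * (\<integral>\<^sup>+x. indicator {x. h x > \<alpha>} (0 + u * x) \<partial>lborel)"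
      using u by (intro nn_integral_real_affine) auto
    also have "(\<integral>\<^sup>+x. indicator {x. h x > \<alpha>} (0 + u * x) \<partial>lborel)
        = (\<integral>\<^sup>+x. indicator {x. h (u * x) > \<alpha>} x \<partial>lborel)"
      by (intro nn_integral_cong) (auto simp: indicator_def)
    finally show ?thesis by (simp add: distribution_fun_def)
  qed
  moreover have "ennreal \<bar>u\<bar> * x \<le> ennreal (\<bar>u\<bar> * t) \<longleftrightarrow> x \<le> ennreal t" for x
    using u by (simp add: ennreal_mult' ennreal_mult_le_mult_iff)
  ultimately show ?thesis
    unfolding rearrangement_def by simp
qed

text \<open>
  A distribution function is decreasing, so the condition \<open>F\<^sub>z\<^sup>*(s) < \<beta>\<close> is already witnessed by a
  rational level.  The set where it holds is therefore a countable union of sets defined by the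
  measurable functions \<open>z \<mapsto> \<bar>{F\<^sub>z > r}\<bar>\<close>.
\<close>

lemma measurable_rearrangement:
  assumes "sigma_finite_measure M" and F [measurable]: "F \<in> borel_measurable (Z \<Otimes>\<^sub>M M)"
  shows "(\<lambda>(z, s). rearrangement M (\<lambda>x. F (z, x)) s) \<in> borel_measurable (Z \<Otimes>\<^sub>M borel)"
proof (rule borel_measurableI_less)
  fix \<beta> :: ennreal
  interpret sigma_finite_measure M by fact
  have d [measurable]: "(\<lambda>z. distribution_fun M (\<lambda>x. F (z, x)) (ennreal r)) \<in> borel_measurable Z" for r
  proof -
    have "(\<lambda>z. emeasure M (Pair z -` {w \<in> space (Z \<Otimes>\<^sub>M M). F w > ennreal r})) \<in> borel_measurable Z"
      by (rule measurable_emeasure_Pair) measurable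
    also have "?this \<longleftrightarrow> ?thesis"
      unfolding distribution_fun_def
      by (intro measurable_cong arg_cong[where f="emeasure M"]) (auto simp: space_pair_measure)
    finally show ?thesis .
  qed
  have iff: "rearrangement M (\<lambda>x. F (z, x)) s < \<beta> \<longleftrightarrow>
      (\<exists>r\<in>{r\<in>\<rat>. 0 < r \<and> ennreal r < \<beta>}. distribution_fun M (\<lambda>x. F (z, x)) (ennreal r) \<le> ennreal s)"
    if z: "z \<in> space Z" for z s
  proof
    assume "rearrangement M (\<lambda>x. F (z, x)) s < \<beta>"
    then obtain \<alpha> where \<alpha>: "0 < \<alpha>" "\<alpha> < \<beta>" "distribution_fun M (\<lambda>x. F (z, x)) \<alpha> \<le> ennreal s"
      by (auto simp: rearrangement_less_iff)
    then obtain a where a: "\<alpha> = ennreal a" "0 < a" by (cases \<alpha>) auto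
    obtain b where b: "a < b" "ennreal b < \<beta>"
    proof (cases \<beta>)
      case (real r)
      then show ?thesis using a \<alpha> that[of "(a + r) / 2"] by (auto simp: ennreal_less_iff)
    qed (use that[of "a + 1"] in auto)
    obtain r where r: "r \<in> \<rat>" "a < r" "r < b" using Rats_dense_in_real[OF b(1)] by blast
    have "distribution_fun M (\<lambda>x. F (z, x)) (ennreal r) \<le> distribution_fun M (\<lambda>x. F (z, x)) \<alpha>"
      using a r z by (intro distribution_fun_antimono) (auto intro!: ennreal_leI)
    then show "\<exists>r\<in>{r\<in>\<rat>. 0 < r \<and> ennreal r < \<beta>}. distribution_fun M (\<lambda>x. F (z, x)) (ennreal r) \<le> ennreal s"
      using r a b \<alpha> by (intro bexI[of _ r]) (auto intro: le_less_trans[OF ennreal_leI[of r b]])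
  next
    assume "\<exists>r\<in>{r\<in>\<rat>. 0 < r \<and> ennreal r < \<beta>}. distribution_fun M (\<lambda>x. F (z, x)) (ennreal r) \<le> ennreal s"
    then obtain r where "0 < r" "ennreal r < \<beta>" "distribution_fun M (\<lambda>x. F (z, x)) (ennreal r) \<le> ennreal s"
      by auto
    then show "rearrangement M (\<lambda>x. F (z, x)) s < \<beta>"
      unfolding rearrangement_less_iff by (intro exI[of _ "ennreal r"]) simp
  qed
  have "{w \<in> space (Z \<Otimes>\<^sub>M borel). (case w of (z, s) \<Rightarrow> rearrangement M (\<lambda>x. F (z, x)) s) < \<beta>}
      = (\<Union>r\<in>{r\<in>\<rat>. 0 < r \<and> ennreal r < \<beta>}. {w \<in> space (Z \<Otimes>\<^sub>M borel).
          distribution_fun M (\<lambda>x. F (fst w, x)) (ennreal r) \<le> ennreal (snd w)})"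
    using iff by (auto simp: space_pair_measure)
  also have "\<dots> \<in> sets (Z \<Otimes>\<^sub>M borel)"
    by (intro sets.countable_UN'' countable_subset[OF _ countable_rat]) auto
  finally show "{w \<in> space (Z \<Otimes>\<^sub>M borel). (case w of (z, s) \<Rightarrow> rearrangement M (\<lambda>x. F (z, x)) s) < \<beta>}
      \<in> sets (Z \<Otimes>\<^sub>M borel)" .
qed

lemma measurable_rearrangement_snd:
  "rearrangement M g \<in> borel_measurable borel"
proof (rule borel_measurableI_less)
  fix \<beta> :: ennreal
  have "is_interval {s. rearrangement M g s < \<beta>}"
    by (auto simp: is_interval_1 intro: le_less_trans[OF rearrangement_antimono])
  then show "{x \<in> space borel. rearrangement M g x < \<beta>} \<in> sets borel"
    by (simp add: real_interval_borel_measurable)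
qed

lemma emeasure_lborel_Ioi: "emeasure lborel {0::real<..} = top"
proof -
  have "ennreal (real n) \<le> emeasure lborel {0::real<..}" for n
  proof -
    have "emeasure lborel {0<..<real n} \<le> emeasure lborel {0::real<..}"
      by (intro emeasure_mono) auto
    then show ?thesis by simp
  qed
  then show ?thesis
    by (metis ennreal_of_nat_eq_real_of_nat ennreal_SUP_of_nat_eq_top SUP_least top.extremum_unique)
qed

lemma nn_integral_below:
  "(\<integral>\<^sup>+r. indicator {r. 0 < r \<and> ennreal r < y} r \<partial>lborel) = y"
  "(\<integral>\<^sup>+r. indicator {r. 0 < r \<and> ennreal r \<le> y} r \<partial>lborel) = y"
proof -
  have "emeasure lborel {r. 0 < r \<and> ennreal r < y} = y \<and> emeasure lborel {r. 0 < r \<and> ennreal r \<le> y} = y"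
  proof (cases y)
    case (real c)
    then have "{r. 0 < r \<and> ennreal r < y} = {0<..<c}" "{r. 0 < r \<and> ennreal r \<le> y} = {0<..c}"
      by (auto simp: ennreal_less_iff)
    then show ?thesis using real by simp
  next
    case top
    then have "{r. 0 < r \<and> ennreal r < y} = {0<..}" "{r. 0 < r \<and> ennreal r \<le> y} = {0<..}" by auto
    then show ?thesis using top by (simp add: emeasure_lborel_Ioi)
  qed
  moreover have "{r. 0 < r \<and> ennreal r < y} \<in> sets lborel" "{r. 0 < r \<and> ennreal r \<le> y} \<in> sets lborel"
    by measurable
  ultimately show "(\<integral>\<^sup>+r. indicator {r. 0 < r \<and> ennreal r < y} r \<partial>lborel) = y"
    "(\<integral>\<^sup>+r. indicator {r. 0 < r \<and> ennreal r \<le> y} r \<partial>lborel) = y" by simp_all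
qed

text \<open>
  Both sides are integrals over levels \<open>r\<close> (layer cake).  The contribution of the level \<open>r\<close> to the left
  side is \<open>\<bar>E \<inter> {h > r}\<bar> \<le> min T \<bar>{h > r}\<bar>\<close>, and every \<open>s\<close> below this minimum satisfies \<open>h\<^sup>*(s) \<ge> r\<close>.
\<close>

lemma hardy_littlewood:
  assumes "sigma_finite_measure M" and h [measurable]: "h \<in> borel_measurable M"
    and E [measurable]: "E \<in> sets M" and T: "emeasure M E = ennreal T" "T \<ge> 0"
  shows "(\<integral>\<^sup>+x\<in>E. h x \<partial>M) \<le> (\<integral>\<^sup>+s\<in>{0<..<T}. rearrangement M h s \<partial>lborel)"
proof -
  interpret M: sigma_finite_measure M by fact
  interpret pair_sigma_finite M lborel ..
  note measurable_rearrangement_snd [measurable]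
  let ?I = "\<lambda>r y. indicator {r. 0 < r \<and> ennreal r < y} r :: ennreal"
  let ?J = "\<lambda>r y. indicator {r. 0 < r \<and> ennreal r \<le> y} r :: ennreal"
  have [measurable]: "(\<lambda>r. distribution_fun M h (ennreal r)) \<in> borel_measurable borel"
  proof (rule borel_measurableI_less)
    fix \<beta> :: ennreal
    have "is_interval {r. distribution_fun M h (ennreal r) < \<beta>}"
      unfolding is_interval_1 using distribution_fun_antimono[OF h, OF ennreal_leI]
        by (auto intro: le_less_trans)
    then show "{r \<in> space borel. distribution_fun M h (ennreal r) < \<beta>} \<in> sets borel"
      by (simp add: real_interval_borel_measurable)
  qed
  have "(\<integral>\<^sup>+x\<in>E. h x \<partial>M) = (\<integral>\<^sup>+x. (\<integral>\<^sup>+r. ?I r (h x) * indicator E x \<partial>lborel) \<partial>M)"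
    by (intro nn_integral_cong) (simp add: nn_integral_multc nn_integral_below)
  also have "\<dots> = (\<integral>\<^sup>+r. (\<integral>\<^sup>+x. ?I r (h x) * indicator E x \<partial>M) \<partial>lborel)"
    by (intro Fubini'[symmetric]) (simp add: indicator_def, measurable)
  also have "\<dots> \<le> (\<integral>\<^sup>+r. (\<integral>\<^sup>+s. indicator {0<..<T} s * ?J r (rearrangement M h s) \<partial>lborel) \<partial>lborel)"
  proof (intro nn_integral_mono)
    fix r :: real
    let ?S = "E \<inter> {x\<in>space M. ennreal r < h x}"
    show "(\<integral>\<^sup>+x. ?I r (h x) * indicator E x \<partial>M)
        \<le> (\<integral>\<^sup>+s. indicator {0<..<T} s * ?J r (rearrangement M h s) \<partial>lborel)"
    proof (cases "r > 0")
      case True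
      have set [measurable]: "?S \<in> sets M" by measurable
      have "(\<integral>\<^sup>+x. ?I r (h x) * indicator E x \<partial>M)
          = (\<integral>\<^sup>+x. indicator ?S x \<partial>M)"
        using True by (intro nn_integral_cong) (auto simp: indicator_def)
      also have "\<dots> = emeasure M ?S"
        using set by simp
      finally have eq: "(\<integral>\<^sup>+x. ?I r (h x) * indicator E x \<partial>M) = emeasure M ?S" .
      have 1: "emeasure M ?S \<le> ennreal T"
        unfolding T(1)[symmetric] by (intro emeasure_mono) auto
      have 2: "emeasure M ?S \<le> distribution_fun M h (ennreal r)"
        unfolding distribution_fun_def by (intro emeasure_mono) auto
      obtain m where m: "emeasure M ?S = ennreal m" "m \<ge> 0"
        using 1 by (cases "emeasure M ?S") (auto simp: top_unique)
      have "ennreal m = (\<integral>\<^sup>+s. indicator {0<..<m} s \<partial>lborel)" using m by simp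
      also have "\<dots> \<le> (\<integral>\<^sup>+s. indicator {0<..<T} s * ?J r (rearrangement M h s) \<partial>lborel)"
      proof (intro nn_integral_mono)
        fix s :: real
        have "s < T \<and> ennreal r \<le> rearrangement M h s" if s: "0 < s" "s < m"
        proof
          show "s < T" using s 1 m T by simp
          have sd: "ennreal s < distribution_fun M h (ennreal r)"
            using 2 s m by (metis ennreal_less_iff less_imp_le less_le_trans)
          show "ennreal r \<le> rearrangement M h s"
          proof (rule ccontr)
            assume "\<not> ?thesis"
            then obtain \<alpha> where "\<alpha> < ennreal r" "distribution_fun M h \<alpha> \<le> ennreal s"
              by (auto simp: not_le rearrangement_less_iff)
            then show False
              using sd order_trans[OF distribution_fun_antimono[OF h, of \<alpha> "ennreal r"]]
              by (meson leD less_imp_le)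
          qed
        qed
        then show "indicator {0<..<m} s \<le> indicator {0<..<T} s * ?J r (rearrangement M h s)"
          using True by (auto simp: indicator_def)
      qed
      finally show ?thesis by (simp add: eq m)
    qed (simp add: indicator_def)
  qed
  also have "\<dots> = (\<integral>\<^sup>+s. (\<integral>\<^sup>+r. indicator {0<..<T} s * ?J r (rearrangement M h s) \<partial>lborel) \<partial>lborel)"
    by (intro lborel_pair.Fubini') (simp add: indicator_def, measurable)
  also have "\<dots> = (\<integral>\<^sup>+s\<in>{0<..<T}. rearrangement M h s \<partial>lborel)"
    by (intro nn_integral_cong) (simp add: nn_integral_cmult nn_integral_below mult.commute)
  finally show ?thesis .
qed

text \<open>
  Write \<open>g\<close> for the integral of the \<open>F\<^sub>u\<close>.  If \<open>\<alpha> < g\<^sup>*(t)\<close>, then \<open>{g > \<alpha>}\<close> contains a set \<open>E\<close> of finite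
  measure \<open>T > t\<close>.  Integrating \<open>g\<close> over \<open>E\<close> and applying the Hardy-Littlewood inequality to each \<open>F\<^sub>u\<close>
  gives \<open>\<alpha> T \<le> \<integral>\<integral>\<^sub>0\<^sup>T F\<^sub>u\<^sup>*(s) ds du\<close>.  Rescaling \<open>s\<close> to the unit interval removes the factor \<open>T\<close>, and
  \<open>F\<^sub>u\<^sup>*(sT) \<le> F\<^sub>u\<^sup>*(st)\<close> because rearrangements decrease.
\<close>

lemma rearrangement_nn_integral_le:
  assumes "sigma_finite_measure U" "sigma_finite_measure M"
    and F [measurable]: "F \<in> borel_measurable (U \<Otimes>\<^sub>M M)" and t: "t > 0"
  shows "rearrangement M (\<lambda>x. \<integral>\<^sup>+u. F (u, x) \<partial>U) t
    \<le> (\<integral>\<^sup>+u. (\<integral>\<^sup>+s\<in>{0<..<1}. rearrangement M (\<lambda>x. F (u, x)) (s * t) \<partial>lborel) \<partial>U)" (is "?l \<le> ?r")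
proof (rule ccontr)
  interpret U: sigma_finite_measure U by fact
  interpret M: sigma_finite_measure M by fact
  interpret pair_sigma_finite U M ..
  let ?g = "\<lambda>x. \<integral>\<^sup>+u. F (u, x) \<partial>U"
  have [measurable]: "?g \<in> borel_measurable M" by measurable
  assume "\<not> ?l \<le> ?r"
  then obtain \<alpha> where \<alpha>: "?r < \<alpha>" "\<alpha> < ?l" using dense[of ?r ?l] unfolding not_le by blast
  have "0 < \<alpha>" using le_less_trans[OF zero_le \<alpha>(1)] .
  have "\<not> distribution_fun M ?g \<alpha> \<le> ennreal t"
  proof
    assume "distribution_fun M ?g \<alpha> \<le> ennreal t"
    then have "?l \<le> \<alpha>" unfolding rearrangement_def using \<open>0 < \<alpha>\<close> by (intro Inf_lower) auto
    then show False using \<alpha> by auto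
  qed
  then have big: "ennreal t < emeasure M {x \<in> space M. \<alpha> < ?g x}" by (simp add: distribution_fun_def)
  obtain A where A: "range A \<subseteq> sets M" "(\<Union>i. A i) = space M" "\<And>i::nat. emeasure M (A i) \<noteq> \<infinity>" "incseq A"
    using M.sigma_finite_incseq by blast
  have [measurable]: "A i \<in> sets M" for i using A by auto
  have "(SUP i. emeasure M (A i \<inter> {x \<in> space M. \<alpha> < ?g x})) = emeasure M (\<Union>i. A i \<inter> {x \<in> space M. \<alpha> < ?g x})"
    using A(4) by (intro SUP_emeasure_incseq) (auto simp: incseq_def)
  also have "(\<Union>i. A i \<inter> {x \<in> space M. \<alpha> < ?g x}) = {x \<in> space M. \<alpha> < ?g x}" using A(2) by auto
  finally have "ennreal t < (SUP i. emeasure M (A i \<inter> {x \<in> space M. \<alpha> < ?g x}))"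
    using big by simp
  then obtain i where i: "ennreal t < emeasure M (A i \<inter> {x \<in> space M. \<alpha> < ?g x})"
    unfolding less_SUP_iff by blast
  define E where "E = A i \<inter> {x \<in> space M. \<alpha> < ?g x}"
  have E [measurable]: "E \<in> sets M" unfolding E_def by measurable
  have "emeasure M E \<le> emeasure M (A i)" unfolding E_def by (intro emeasure_mono) auto
  then have "emeasure M E < \<infinity>" using A(3)[of i] by (simp add: less_top le_less_trans)
  then obtain T where T: "emeasure M E = ennreal T" "T \<ge> 0" by (cases "emeasure M E") auto
  \<comment> \<open>The Hardy-Littlewood inequality on \<open>E\<close> produces \<open>T\<close>, while the claim is about \<open>t\<close>.\<close>
  have tT: "t < T" using i t T unfolding E_def[symmetric] by (simp add: ennreal_less_iff)
  have "\<alpha> * ennreal T = (\<integral>\<^sup>+x. \<alpha> * indicator E x \<partial>M)"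
    using E T by (simp add: nn_integral_cmult_indicator)
  also have "\<dots> \<le> (\<integral>\<^sup>+x. (\<integral>\<^sup>+u. F (u, x) * indicator E x \<partial>U) \<partial>M)"
    by (intro nn_integral_mono) (auto simp: E_def indicator_def split: if_splits intro: less_imp_le)
  also have "\<dots> = (\<integral>\<^sup>+u. (\<integral>\<^sup>+x. F (u, x) * indicator E x \<partial>M) \<partial>U)"
    by (intro Fubini') measurable
  also have "\<dots> \<le> (\<integral>\<^sup>+u. ennreal T * (\<integral>\<^sup>+s\<in>{0<..<1}. rearrangement M (\<lambda>x. F (u, x)) (s * t) \<partial>lborel) \<partial>U)"
  proof (intro nn_integral_mono)
    fix u assume "u \<in> space U"
    then have [measurable]: "(\<lambda>x. F (u, x)) \<in> borel_measurable M" by measurable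
    let ?R = "rearrangement M (\<lambda>x. F (u, x))"
    note measurable_rearrangement_snd [measurable]
    have "(\<integral>\<^sup>+x\<in>E. F (u, x) \<partial>M) \<le> (\<integral>\<^sup>+s. ?R s * indicator {0<..<T} s \<partial>lborel)"
      using T by (intro hardy_littlewood) (auto intro: assms)
    also have "\<dots> = ennreal T * (\<integral>\<^sup>+s. ?R (0 + T * s) * indicator {0<..<T} (0 + T * s) \<partial>lborel)"
      using tT t by (subst nn_integral_real_affine[of _ T 0]) auto
    also have "\<dots> \<le> ennreal T * (\<integral>\<^sup>+s\<in>{0<..<1}. ?R (s * t) \<partial>lborel)"
      using tT t by (intro mult_left_mono nn_integral_mono)
        (auto simp: indicator_def mult.commute zero_less_mult_iff intro!: rearrangement_antimono mult_right_mono)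
    finally show "(\<integral>\<^sup>+x. F (u, x) * indicator E x \<partial>M) \<le> ennreal T * (\<integral>\<^sup>+s\<in>{0<..<1}. ?R (s * t) \<partial>lborel)" .
  qed
  also have "\<dots> = ennreal T * ?r"
  proof -
    have [measurable]: "(\<lambda>(u, s). rearrangement M (\<lambda>x. F (u, x)) s) \<in> borel_measurable (U \<Otimes>\<^sub>M borel)"
      using measurable_rearrangement[OF assms(2) F] .
    have [measurable]: "(\<lambda>w. rearrangement M (\<lambda>x. F (fst w, x)) (snd w * t)) \<in> borel_measurable (U \<Otimes>\<^sub>M lborel)"
      using measurable_compose[OF _ \<open>(\<lambda>(u, s). rearrangement M (\<lambda>x. F (u, x)) s) \<in> _\<close>, of "\<lambda>w. (fst w, snd w * t)"]
      by simp
    show ?thesis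
      by (intro nn_integral_cmult lborel.borel_measurable_nn_integral) simp
  qed
  finally have "ennreal T * \<alpha> \<le> ennreal T * ?r" by (simp add: mult.commute)
  then have "\<alpha> \<le> ?r" using tT t by (simp add: ennreal_mult_le_mult_iff)
  then show False using \<alpha> by auto
qed

section \<open>Lorentz norms and Minkowski's inequality\<close>

text \<open>
  The \<open>L\<^sup>q(dt/t)\<close> norm of \<open>t\<^sup>r \<phi>(t)\<close> on the half line.  The Lorentz norm is this functional, with
  \<open>r = 1 / p\<close>, applied to the rearrangement.
\<close>

definition weighted_Lq :: "real \<Rightarrow> ennreal \<Rightarrow> (real \<Rightarrow> ennreal) \<Rightarrow> ennreal" where
  "weighted_Lq r q \<phi> =
    (if q = \<infinity> then (SUP t\<in>{0<..}. ennreal (t powr r) * \<phi> t)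
     else ennpowr (\<integral>\<^sup>+t\<in>{0<..}. ennpowr (ennreal (t powr r) * \<phi> t) (enn2real q) * ennreal (1 / t) \<partial>lborel)
       (1 / enn2real q))"

lemma lorentz_norm_eq_weighted_Lq:
  "lorentz_norm M p q g = weighted_Lq (enn2real (inverse p)) q (rearrangement M g)"
  by (simp add: lorentz_norm_def weighted_Lq_def Let_def)

lemma weighted_Lq_mono:
  assumes "\<And>t. t > 0 \<Longrightarrow> \<phi> t \<le> \<psi> t" shows "weighted_Lq r q \<phi> \<le> weighted_Lq r q \<psi>"
proof (cases "q = \<infinity>")
  case True
  then show ?thesis unfolding weighted_Lq_def using assms by (auto intro!: SUP_subset_mono mult_left_mono)
next
  case False
  have "ennpowr (ennreal (t powr r) * \<phi> t) a * ennreal (1 / t) * indicator {0<..} t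
      \<le> ennpowr (ennreal (t powr r) * \<psi> t) a * ennreal (1 / t) * indicator {0<..} t" if "a \<ge> 0" for a t
    using assms[of t] that by (cases "t > 0") (auto intro!: ennpowr_mono mult_right_mono mult_left_mono)
  then show ?thesis unfolding weighted_Lq_def using False by (auto intro!: ennpowr_mono nn_integral_mono)
qed

lemma weighted_Lq_cmult:
  assumes c: "c \<ge> 0" and q: "q > 0" and [measurable]: "\<phi> \<in> borel_measurable borel"
  shows "weighted_Lq r q (\<lambda>t. ennreal c * \<phi> t) = ennreal c * weighted_Lq r q \<phi>"
proof (cases "q = \<infinity>")
  case True
  then show ?thesis by (simp add: weighted_Lq_def SUP_mult_left_ennreal mult.left_commute)
next
  case False
  then have q: "enn2real q > 0" using q by (simp add: enn2real_positive_iff less_top)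
  have "(\<integral>\<^sup>+t\<in>{0<..}. ennpowr (ennreal (t powr r) * (ennreal c * \<phi> t)) (enn2real q) * ennreal (1 / t) \<partial>lborel)
      = (\<integral>\<^sup>+t. ennpowr (ennreal c) (enn2real q) *
          (ennpowr (ennreal (t powr r) * \<phi> t) (enn2real q) * ennreal (1 / t) * indicator {0<..} t) \<partial>lborel)"
    by (intro nn_integral_cong) (simp add: ennpowr_mult mult_ac)
  also have "\<dots> = ennpowr (ennreal c) (enn2real q) *
      (\<integral>\<^sup>+t\<in>{0<..}. ennpowr (ennreal (t powr r) * \<phi> t) (enn2real q) * ennreal (1 / t) \<partial>lborel)"
    by (rule nn_integral_cmult) measurable
  finally show ?thesis using False q by (simp add: weighted_Lq_def ennpowr_mult ennpowr_inverse)
qed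

text \<open>
  The measure \<open>dt/t\<close> is invariant under dilations, so only the weight \<open>t\<^sup>r\<close> contributes.
\<close>

lemma weighted_Lq_dilate:
  assumes s: "s > 0" and q: "q > 0" and [measurable]: "\<phi> \<in> borel_measurable borel"
  shows "weighted_Lq r q (\<lambda>t. \<phi> (s * t)) = ennreal (s powr - r) * weighted_Lq r q \<phi>"
proof -
  have w: "ennreal ((s * t) powr r) * \<phi> (s * t) = ennreal (s powr r) * (ennreal (t powr r) * \<phi> (s * t))"
    if "t > 0" for t
    using s that by (simp add: powr_mult ennreal_mult mult.assoc)
  have "weighted_Lq r q \<phi> = weighted_Lq r q (\<lambda>t. ennreal (s powr r) * \<phi> (s * t))"
  proof (cases "q = \<infinity>")
    case True
    have "(SUP t\<in>{0<..}. ennreal (t powr r) * \<phi> t)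
        = (SUP t\<in>(\<lambda>t. s * t) ` {0<..}. ennreal (t powr r) * \<phi> t)"
    proof -
      have "(\<lambda>t. s * t) ` {0<..} = {0<..}"
        using s by (auto simp: image_iff intro!: bexI[of _ "x / s" for x])
      then show ?thesis by simp
    qed
    also have "\<dots> = (SUP t\<in>{0<..}. ennreal (t powr r) * (ennreal (s powr r) * \<phi> (s * t)))"
      unfolding image_image by (intro SUP_cong) (auto simp: w mult.left_commute)
    finally show ?thesis using True by (simp add: weighted_Lq_def)
  next
    case False
    let ?k = "\<lambda>t. ennpowr (ennreal (t powr r) * \<phi> t) (enn2real q) * ennreal (1 / t) * indicator {0<..} t"
    have "(\<integral>\<^sup>+t. ?k t \<partial>lborel) = ennreal \<bar>s\<bar> * (\<integral>\<^sup>+t. ?k (0 + s * t) \<partial>lborel)"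
      using s by (intro nn_integral_real_affine) auto
    also have "\<dots> = (\<integral>\<^sup>+t. ennreal \<bar>s\<bar> * ?k (0 + s * t) \<partial>lborel)"
      by (intro nn_integral_cmult[symmetric]) measurable
    also have "\<dots> = (\<integral>\<^sup>+t\<in>{0<..}. ennpowr (ennreal (t powr r) * (ennreal (s powr r) * \<phi> (s * t))) (enn2real q)
        * ennreal (1 / t) \<partial>lborel)"
    proof (intro nn_integral_cong)
      fix t :: real
      show "ennreal \<bar>s\<bar> * ?k (0 + s * t) = ennpowr (ennreal (t powr r) * (ennreal (s powr r) * \<phi> (s * t))) (enn2real q)
        * ennreal (1 / t) * indicator {0<..} t"
      proof (cases "t > 0")
        case True
        have "ennreal s * ennreal (1 / (s * t)) = ennreal (1 / t)"
          using s True by (simp add: ennreal_mult[symmetric])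
        then have "ennreal s * (x * ennreal (1 / (s * t))) = x * ennreal (1 / t)" for x
          by (metis mult.left_commute)
        then show ?thesis using s True
          by (simp add: w mult.left_commute[of "ennreal (t powr r)"] zero_less_mult_iff)
      qed (use s in \<open>simp add: zero_less_mult_iff\<close>)
    qed
    finally show ?thesis using False by (simp add: weighted_Lq_def)
  qed
  also have "\<dots> = ennreal (s powr r) * weighted_Lq r q (\<lambda>t. \<phi> (s * t))"
    using q by (intro weighted_Lq_cmult) auto
  finally show ?thesis
    using s by (simp add: mult.assoc[symmetric] ennreal_mult[symmetric] powr_minus)
qed

text \<open>
  Monotonicity of \<open>\<phi>\<close> matters for \<open>q = \<infinity>\<close>: approaching \<open>t\<close> by rationals from below shows that the
  supremum over \<open>t > 0\<close> is a supremum over the rationals.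
\<close>

lemma measurable_weighted_Lq:
  assumes q: "q > 0" and [measurable]: "(\<lambda>(z, t). \<phi> z t) \<in> borel_measurable (Z \<Otimes>\<^sub>M borel)"
    and anti: "\<And>z s t. z \<in> space Z \<Longrightarrow> s \<le> t \<Longrightarrow> \<phi> z t \<le> \<phi> z s" and r: "r \<ge> 0"
  shows "(\<lambda>z. weighted_Lq r q (\<phi> z)) \<in> borel_measurable Z"
proof (cases "q = \<infinity>")
  case True
  let ?R = "\<lambda>z. SUP t\<in>{0<..} \<inter> \<rat>. ennreal (t powr r) * \<phi> z t"
  have "weighted_Lq r q (\<phi> z) = ?R z" if z: "z \<in> space Z" for z
  proof -
    have "(SUP t\<in>{0<..}. ennreal (t powr r) * \<phi> z t) \<le> ?R z"
    proof (rule SUP_least)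
      fix t :: real assume t: "t \<in> {0<..}"
      obtain a where a: "\<And>n. a n \<in> \<rat>" "\<And>n. 0 < a n" "\<And>n. a n \<le> t" "a \<longlonglongrightarrow> t"
      proof -
        have "\<exists>b\<in>\<rat>. max 0 (t - 1 / real (Suc n)) < b \<and> b < t" for n
          using t by (intro Rats_dense_in_real) auto
        then obtain a where a: "\<And>n. a n \<in> \<rat>" "\<And>n. max 0 (t - 1 / real (Suc n)) < a n" "\<And>n. a n < t" by metis
        have "a \<longlonglongrightarrow> t"
        proof (rule tendsto_sandwich[of "\<lambda>n. t - 1 / real (Suc n)" _ _ "\<lambda>n. t"])
          show "(\<lambda>n. t - 1 / real (Suc n)) \<longlonglongrightarrow> t"
            using tendsto_diff[OF tendsto_const LIMSEQ_inverse_real_of_nat] by (simp add: inverse_eq_divide)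
        qed (use a in \<open>auto intro!: always_eventually less_imp_le simp: max_less_iff_conj\<close>)
        then show ?thesis using a that[of a] by (auto intro: less_imp_le)
      qed
      have "(\<lambda>n. ennreal (a n powr r) * \<phi> z t) \<longlonglongrightarrow> ennreal (t powr r) * \<phi> z t"
        using t a by (intro tendsto_mult_ennreal tendsto_ennrealI tendsto_powr tendsto_const) auto
      then show "ennreal (t powr r) * \<phi> z t \<le> ?R z"
      proof (rule LIMSEQ_le_const2)
        have "ennreal (a n powr r) * \<phi> z t \<le> ?R z" for n
          using a by (intro SUP_upper2[of "a n"] mult_left_mono anti z) auto
        then show "\<exists>N. \<forall>n\<ge>N. ennreal (a n powr r) * \<phi> z t \<le> ?R z"
          by auto
      qed
    qed
    moreover have "?R z \<le> (SUP t\<in>{0<..}. ennreal (t powr r) * \<phi> z t)"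
      by (intro SUP_subset_mono) auto
    ultimately show ?thesis using True by (simp add: weighted_Lq_def)
  qed
  then have "?thesis \<longleftrightarrow> (\<lambda>z. SUP t\<in>{0<..} \<inter> \<rat>. ennreal (t powr r) * \<phi> z t) \<in> borel_measurable Z"
    by (rule measurable_cong)
  also have "\<dots>"
    by (intro borel_measurable_SUP countable_Int2 countable_rat) auto
  finally show ?thesis .
next
  case False
  then show ?thesis unfolding weighted_Lq_def by simp measurable
qed

text \<open>
  The graph of \<open>h \<mapsto> h\<^sup>q\<close> lies above its tangent at \<open>c\<close>; this is Young's inequality for the exponents
  \<open>q\<close> and \<open>q / (q - 1)\<close>.
\<close>

lemma powr_ge_tangent:
  fixes c h q :: real
  assumes "q \<ge> 1" "c \<ge> 0" "h \<ge> 0"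
  shows "q * c powr (q - 1) * h \<le> h powr q + (q - 1) * c powr q"
proof (cases "c = 0 \<or> h = 0 \<or> q = 1")
  case False
  with assms have pos: "c > 0" "h > 0" "q > 1" by auto
  have "q / (q - 1) > 1" "1 / q + 1 / (q / (q - 1)) = 1"
    using pos by (simp_all add: field_simps)
  then have "h * c powr (q - 1) \<le> h powr q / q + (c powr (q - 1)) powr (q / (q - 1)) / (q / (q - 1))"
    using pos by (intro Youngs_inequality) auto
  also have "(c powr (q - 1)) powr (q / (q - 1)) = c powr q"
    using pos by (simp add: powr_powr)
  finally have "q * (h * c powr (q - 1)) \<le> q * (h powr q / q + c powr q / (q / (q - 1)))"
    using pos by (intro mult_left_mono) auto
  also have "\<dots> = h powr q + (q - 1) * c powr q"
    using pos by (simp add: field_simps)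
  finally show ?thesis by (simp add: mult_ac)
qed (use assms in auto)

text \<open>
  Integrate the tangent inequality against \<open>\<rho>\<close>, with the tangent taken at the value \<open>c\<close> of the integral
  of \<open>H \<rho>\<close>.  If that integral is infinite, the tangent at \<open>1\<close> shows that the right side is infinite too.
\<close>

lemma jensen_powr:
  fixes q :: real
  assumes q: "q \<ge> 1" and [measurable]: "\<rho> \<in> borel_measurable Z" "H \<in> borel_measurable Z"
    and \<rho>: "(\<integral>\<^sup>+z. \<rho> z \<partial>Z) \<le> 1"
  shows "ennpowr (\<integral>\<^sup>+z. H z * \<rho> z \<partial>Z) q \<le> (\<integral>\<^sup>+z. ennpowr (H z) q * \<rho> z \<partial>Z)" (is "ennpowr ?I q \<le> ?J")
proof -
  have tangent: "ennreal (q * c powr (q - 1)) * ?I \<le> ?J + ennreal ((q - 1) * c powr q)" if c: "c \<ge> 0" for c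
  proof -
    have pt: "ennreal (q * c powr (q - 1)) * x \<le> ennpowr x q + ennreal ((q - 1) * c powr q)" for x
    proof (cases x)
      case (real h)
      then show ?thesis using powr_ge_tangent[OF q c, of h] q c
        by (simp add: ennpowr_ennreal ennreal_mult[symmetric] ennreal_plus[symmetric] del: ennreal_plus)
    qed (simp add: ennpowr_def)
    have "ennreal (q * c powr (q - 1)) * ?I = (\<integral>\<^sup>+z. (ennreal (q * c powr (q - 1)) * H z) * \<rho> z \<partial>Z)"
      by (simp add: nn_integral_cmult mult.assoc)
    also have "\<dots> \<le> (\<integral>\<^sup>+z. (ennpowr (H z) q + ennreal ((q - 1) * c powr q)) * \<rho> z \<partial>Z)"
      by (intro nn_integral_mono mult_right_mono pt) simp
    also have "\<dots> = ?J + ennreal ((q - 1) * c powr q) * (\<integral>\<^sup>+z. \<rho> z \<partial>Z)"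
      by (simp add: distrib_right nn_integral_add nn_integral_cmult)
    also have "\<dots> \<le> ?J + ennreal ((q - 1) * c powr q) * 1"
      using \<rho> by (intro add_left_mono mult_left_mono) auto
    finally show ?thesis by simp
  qed
  show ?thesis
  proof (cases ?I)
    case (real c)
    show ?thesis
    proof (cases ?J)
      case J: (real j)
      have "ennreal (q * c powr (q - 1) * c) \<le> ennreal (j + (q - 1) * c powr q)"
        using tangent[of c] real J q by (simp add: ennreal_mult)
      then have "q * c powr (q - 1) * c \<le> j + (q - 1) * c powr q"
        using J(1) q by (subst (asm) ennreal_le_iff) auto
      moreover have "c powr (q - 1) * c = c powr q"
        using real(1) by (cases "c = 0") (auto simp: powr_diff)
      ultimately have "q * c powr q \<le> j + (q - 1) * c powr q" by (simp add: mult.assoc)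
      then have "c powr q \<le> j" by (simp add: algebra_simps)
      then show ?thesis using real J by (simp add: ennpowr_ennreal ennreal_leI)
    qed simp
  next
    case top
    have "?J = top" using tangent[of 1] q top by (simp add: ennreal_mult_top top_unique)
    then show ?thesis by simp
  qed
qed

lemma ennreal_divide_mult_cancel:
  assumes "x \<noteq> 0" "x \<noteq> \<infinity>" shows "y / x * x = (y::ennreal)"
  using assms by (metis ennreal_divide_times ennreal_divide_self infinity_ennreal_def less_top mult.right_neutral)

text \<open>
  Let \<open>N(z)\<close> be the norm of \<open>G(z, \<cdot>)\<close> and \<open>S\<close> its integral.  With the density \<open>\<rho> = N / S\<close>, Jensen's
  inequality gives \<open>(\<integral> G dz)\<^sup>q = (\<integral> (G / \<rho>) \<rho> dz)\<^sup>q \<le> \<integral> (G / \<rho>)\<^sup>q \<rho> dz\<close> pointwise in \<open>t\<close>.  Integrating over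
  \<open>t\<close>, the right side becomes \<open>\<integral> (N / \<rho>)\<^sup>q \<rho> dz = S\<^sup>q\<close>.  The argument avoids dividing by the norm of
  \<open>\<integral> G dz\<close>, which might be infinite.  To avoid dividing by \<open>N = 0\<close>, \<open>N\<close> is replaced by
  \<open>N + e h\<^sub>0\<close> with a positive integrable \<open>h\<^sub>0\<close>, and \<open>e\<close> tends to \<open>0\<close> at the end.
\<close>

lemma minkowski_integral:
  fixes q :: real
  assumes "sigma_finite_measure Z" "sigma_finite_measure M" and q: "q \<ge> 1"
    and G [measurable]: "G \<in> borel_measurable (Z \<Otimes>\<^sub>M M)" and w [measurable]: "w \<in> borel_measurable M"
  shows "ennpowr (\<integral>\<^sup>+t. ennpowr (\<integral>\<^sup>+z. G (z, t) \<partial>Z) q * w t \<partial>M) (1 / q)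
    \<le> (\<integral>\<^sup>+z. ennpowr (\<integral>\<^sup>+t. ennpowr (G (z, t)) q * w t \<partial>M) (1 / q) \<partial>Z)"
    (is "?L \<le> (\<integral>\<^sup>+z. ?N z \<partial>Z)")
proof (cases "(\<integral>\<^sup>+z. ?N z \<partial>Z)")
  case (real S)
  let ?A = "\<lambda>z. \<integral>\<^sup>+t. ennpowr (G (z, t)) q * w t \<partial>M"
  interpret Z: sigma_finite_measure Z by fact
  interpret M: sigma_finite_measure M by fact
  interpret pair_sigma_finite Z M ..
  have [measurable]: "?N \<in> borel_measurable Z" by measurable
  obtain h0 where h0 [measurable]: "h0 \<in> borel_measurable Z"
    and "integral\<^sup>N Z h0 \<noteq> \<infinity>" and h0pos: "\<And>z. z \<in> space Z \<Longrightarrow> 0 < h0 z \<and> h0 z < \<infinity>"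
    using Z.Ex_finite_integrable_function by blast
  then obtain W where W: "integral\<^sup>N Z h0 = ennreal W" "W \<ge> 0" by (cases "integral\<^sup>N Z h0") auto
  have main: "?L \<le> ennreal (S + e * (1 + W))" if e: "e > 0" for e
  proof -
    \<comment> \<open>The summand \<open>e\<close> keeps \<open>S'\<close> positive even if the space is null.\<close>
    define S' where "S' = S + e * (1 + W)"
    have S': "S' > 0" unfolding S'_def using real e W by (simp add: add_nonneg_pos)
    define \<rho> where "\<rho> z = (?N z + ennreal e * h0 z) / ennreal S'" for z
    have [measurable]: "\<rho> \<in> borel_measurable Z" unfolding \<rho>_def by measurable
    have "(\<integral>\<^sup>+z. \<rho> z \<partial>Z) = (\<integral>\<^sup>+z. ?N z + ennreal e * h0 z \<partial>Z) / ennreal S'"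
      unfolding \<rho>_def by (rule nn_integral_divide) measurable
    also have "(\<integral>\<^sup>+z. ?N z + ennreal e * h0 z \<partial>Z) = ennreal (S + e * W)"
      using real W e by (simp add: nn_integral_add nn_integral_cmult ennreal_mult)
    also have "ennreal (S + e * W) / ennreal S' \<le> 1"
      using S' real W e unfolding S'_def by (subst divide_ennreal) (auto simp: field_simps)
    finally have \<rho>1: "(\<integral>\<^sup>+z. \<rho> z \<partial>Z) \<le> 1" .
    have "AE z in Z. \<rho> z \<noteq> \<infinity>"
      using \<rho>1 by (intro nn_integral_noteq_infinite) (auto simp: top_unique)
    then have ae: "AE z in Z. \<rho> z \<noteq> 0 \<and> \<rho> z \<noteq> \<infinity> \<and> ?N z \<le> ennreal S' * \<rho> z"
    proof (rule AE_mp, intro AE_I2 impI conjI)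
      fix z assume z: "z \<in> space Z" "\<rho> z \<noteq> \<infinity>"
      show "\<rho> z \<noteq> 0" unfolding \<rho>_def using h0pos[OF z(1)] e by (simp add: zero_less_iff_neq_zero)
      show "?N z \<le> ennreal S' * \<rho> z"
        unfolding \<rho>_def using S' ennreal_divide_mult_cancel[of "ennreal S'" "?N z + ennreal e * h0 z"]
        by (simp add: mult.commute[of "ennreal S'"])
      show "\<rho> z \<noteq> \<infinity>" by fact
    qed
    have "(\<integral>\<^sup>+t. ennpowr (\<integral>\<^sup>+z. G (z, t) \<partial>Z) q * w t \<partial>M)
        \<le> (\<integral>\<^sup>+t. (\<integral>\<^sup>+z. ennpowr (G (z, t) / \<rho> z) q * \<rho> z * w t \<partial>Z) \<partial>M)"
    proof (intro nn_integral_mono)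
      fix t assume t [measurable]: "t \<in> space M"
      have [measurable]: "(\<lambda>z. G (z, t)) \<in> borel_measurable Z" by measurable
      have "(\<integral>\<^sup>+z. G (z, t) \<partial>Z) = (\<integral>\<^sup>+z. G (z, t) / \<rho> z * \<rho> z \<partial>Z)"
        using ae by (intro nn_integral_cong_AE) (auto simp: ennreal_divide_mult_cancel)
      then have "ennpowr (\<integral>\<^sup>+z. G (z, t) \<partial>Z) q \<le> (\<integral>\<^sup>+z. ennpowr (G (z, t) / \<rho> z) q * \<rho> z \<partial>Z)"
        using jensen_powr[OF q, of \<rho> Z "\<lambda>z. G (z, t) / \<rho> z"] \<rho>1 by simp
      then show "ennpowr (\<integral>\<^sup>+z. G (z, t) \<partial>Z) q * w t \<le> (\<integral>\<^sup>+z. ennpowr (G (z, t) / \<rho> z) q * \<rho> z * w t \<partial>Z)"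
        by (simp add: nn_integral_multc mult_right_mono)
    qed
    also have "\<dots> = (\<integral>\<^sup>+z. (\<integral>\<^sup>+t. ennpowr (G (z, t) / \<rho> z) q * \<rho> z * w t \<partial>M) \<partial>Z)"
      by (intro Fubini') measurable
    also have "\<dots> = (\<integral>\<^sup>+z. ennpowr (inverse (\<rho> z)) q * \<rho> z * ?A z \<partial>Z)"
    proof (intro nn_integral_cong)
      fix z assume z [measurable]: "z \<in> space Z"
      have [measurable]: "(\<lambda>t. G (z, t)) \<in> borel_measurable M" by measurable
      have "(\<integral>\<^sup>+t. ennpowr (G (z, t) / \<rho> z) q * \<rho> z * w t \<partial>M)
          = (\<integral>\<^sup>+t. (ennpowr (inverse (\<rho> z)) q * \<rho> z) * (ennpowr (G (z, t)) q * w t) \<partial>M)"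
        by (simp add: divide_ennreal_def ennpowr_mult mult_ac)
      then show "(\<integral>\<^sup>+t. ennpowr (G (z, t) / \<rho> z) q * \<rho> z * w t \<partial>M)
          = ennpowr (inverse (\<rho> z)) q * \<rho> z * ?A z"
        by (simp add: nn_integral_cmult)
    qed
    also have "\<dots> \<le> (\<integral>\<^sup>+z. ennpowr (ennreal S') q * \<rho> z \<partial>Z)"
    proof (rule nn_integral_mono_AE, use ae in eventually_elim)
      fix z assume z: "\<rho> z \<noteq> 0 \<and> \<rho> z \<noteq> \<infinity> \<and> ?N z \<le> ennreal S' * \<rho> z"
      have "?A z = ennpowr (?N z) q"
        using ennpowr_inverse[of "1 / q"] q by simp
      also have "\<dots> \<le> ennpowr (ennreal S' * \<rho> z) q" using z q by (intro ennpowr_mono) auto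
      finally have "ennpowr (inverse (\<rho> z)) q * \<rho> z * ?A z
          \<le> ennpowr (inverse (\<rho> z)) q * \<rho> z * ennpowr (ennreal S' * \<rho> z) q"
        by (intro mult_left_mono) auto
      also have "\<dots> = ennpowr (ennreal S' * (inverse (\<rho> z) * \<rho> z)) q * \<rho> z"
        by (simp add: ennpowr_mult mult_ac)
      also have "inverse (\<rho> z) * \<rho> z = 1"
        using z ennreal_divide_mult_cancel[of "\<rho> z" 1] by (simp add: divide_ennreal_def)
      finally show "ennpowr (inverse (\<rho> z)) q * \<rho> z * ?A z
          \<le> ennpowr (ennreal S') q * \<rho> z" by simp
    qed
    also have "\<dots> \<le> ennpowr (ennreal S') q * 1"
      using \<rho>1 by (simp add: nn_integral_cmult mult_left_mono del: mult_1_right)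
    finally have "?L \<le> ennpowr (ennpowr (ennreal S') q) (1 / q)"
      using q by (intro ennpowr_mono) auto
    then show ?thesis using q by (simp add: ennpowr_inverse S'_def)
  qed
  have "?L \<le> ennreal S"
  proof (rule ennreal_le_epsilon)
    fix e :: real assume e: "0 < e"
    have "?L \<le> ennreal (S + e / (1 + W) * (1 + W))" using e W by (intro main) (simp add: field_simps)
    then show "?L \<le> ennreal S + ennreal e" using e W real by simp
  qed
  then show ?thesis using real by simp
qed simp

lemma weighted_Lq_minkowski:
  assumes "sigma_finite_measure Z" and q: "q \<ge> 1" and G [measurable]: "G \<in> borel_measurable (Z \<Otimes>\<^sub>M lborel)"
  shows "weighted_Lq r q (\<lambda>t. \<integral>\<^sup>+z. G (z, t) \<partial>Z) \<le> (\<integral>\<^sup>+z. weighted_Lq r q (\<lambda>t. G (z, t)) \<partial>Z)"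
proof (cases "q = \<infinity>")
  case True
  show ?thesis unfolding weighted_Lq_def using True
  proof (simp, intro SUP_least)
    fix t :: real assume t: "t \<in> {0<..}"
    have "ennreal (t powr r) * (\<integral>\<^sup>+z. G (z, t) \<partial>Z) = (\<integral>\<^sup>+z. ennreal (t powr r) * G (z, t) \<partial>Z)"
      by (intro nn_integral_cmult[symmetric]) measurable
    also have "\<dots> \<le> (\<integral>\<^sup>+z. (SUP t\<in>{0<..}. ennreal (t powr r) * G (z, t)) \<partial>Z)"
      using t by (intro nn_integral_mono SUP_upper)
    finally show "ennreal (t powr r) * (\<integral>\<^sup>+z. G (z, t) \<partial>Z) \<le> (\<integral>\<^sup>+z. (SUP t\<in>{0<..}. ennreal (t powr r) * G (z, t)) \<partial>Z)" .
  qed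
next
  case False
  then obtain q' where q': "q = ennreal q'" "q' \<ge> 1" using q by (cases q) auto
  have "ennreal (t powr r) * (\<integral>\<^sup>+z. G (z, t) \<partial>Z) = (\<integral>\<^sup>+z. ennreal (t powr r) * G (z, t) \<partial>Z)" for t
    by (intro nn_integral_cmult[symmetric]) measurable
  then show ?thesis
    using minkowski_integral[OF assms(1) sigma_finite_lborel q'(2),
        of "\<lambda>w. ennreal (snd w powr r) * G (fst w, snd w)" "\<lambda>t. ennreal (1 / t) * indicator {0<..} t"] False q'
    by (simp add: weighted_Lq_def mult.assoc)
qed

lemma nn_integral_powr_near_0:
  assumes "a > -1" "c > 0"
  shows "(\<integral>\<^sup>+x. ennreal (x powr a) * indicator {0<..<c} x \<partial>lborel) = ennreal (c powr (a + 1) / (a + 1))"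
proof -
  have "(\<integral>\<^sup>+x. ennreal (x powr a) * indicator {0<..<c} x \<partial>lborel)
      = (\<integral>\<^sup>+x. ennreal (x powr a) * indicator {0..c} x \<partial>lborel)"
    by (intro nn_integral_cong_AE, use AE_lborel_singleton[of 0] AE_lborel_singleton[of c] in eventually_elim)
      (auto simp: indicator_def)
  also have "\<dots> = ennreal (c powr (a + 1) / (a + 1))"
    using nn_integral_has_integral_lebesgue[OF _ has_integral_powr_from_0[of a c]] assms
    by (simp add: ennreal_mult'' ennreal_indicator mult.commute)
  finally show ?thesis .
qed

lemma nn_integral_powr_near_infinity:
  assumes "a < -1" "c > 0"
  shows "(\<integral>\<^sup>+x. ennreal (x powr a) * indicator {c..} x \<partial>lborel) = ennreal (- (c powr (a + 1)) / (a + 1))"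
  using nn_integral_has_integral_lebesgue[OF _ has_integral_powr_to_inf[of a c]] assms
  by (simp add: ennreal_mult'' ennreal_indicator mult.commute)

lemma lorentz_norm_mono_AE:
  assumes "AE x in M. g x \<le> h x" "h \<in> borel_measurable M"
  shows "lorentz_norm M p q g \<le> lorentz_norm M p q h"
  unfolding lorentz_norm_eq_weighted_Lq by (intro weighted_Lq_mono rearrangement_mono_AE assms)

lemma lorentz_norm_cmult:
  assumes "c > 0" "q > 0"
  shows "lorentz_norm M p q (\<lambda>x. ennreal c * g x) = ennreal c * lorentz_norm M p q g"
  unfolding lorentz_norm_eq_weighted_Lq rearrangement_cmult[OF assms(1)] using assms
  by (intro weighted_Lq_cmult measurable_rearrangement_snd) auto

lemma lorentz_norm_dilate:
  assumes "u \<noteq> 0" "q > 0" "p > 0" "h \<in> borel_measurable borel"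
  shows "lorentz_norm lborel (ennreal p) q (\<lambda>x. h (u * x)) = ennreal (\<bar>u\<bar> powr (- 1 / p)) * lorentz_norm lborel (ennreal p) q h"
  unfolding lorentz_norm_eq_weighted_Lq rearrangement_dilate[OF assms(1,4)] using assms
  by (subst weighted_Lq_dilate) (auto intro: measurable_rearrangement_snd simp: inverse_ennreal inverse_eq_divide)

lemma measurable_lorentz_norm:
  assumes "sigma_finite_measure M" "F \<in> borel_measurable (Z \<Otimes>\<^sub>M M)" "q > 0"
  shows "(\<lambda>z. lorentz_norm M p q (\<lambda>x. F (z, x))) \<in> borel_measurable Z"
  unfolding lorentz_norm_eq_weighted_Lq using assms
  by (intro measurable_weighted_Lq measurable_rearrangement rearrangement_antimono) auto

text \<open>
  The estimate for the rearrangement of an integral reduces the claim to Minkowski's inequality for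
  \<^const>\<open>weighted_Lq\<close>, applied first in \<open>u\<close> and then in \<open>s\<close>.  The dilation by \<open>s\<close> contributes
  \<open>s\<^bsup>-1/p\<^esup>\<close>, and \<open>p / (p - 1)\<close> is the integral of this factor over the unit interval.
\<close>

lemma lorentz_minkowski:
  assumes U: "sigma_finite_measure U" and M: "sigma_finite_measure M" and p: "p > 1" and q: "q \<ge> 1"
    and F [measurable]: "F \<in> borel_measurable (U \<Otimes>\<^sub>M M)"
  shows "lorentz_norm M (ennreal p) q (\<lambda>x. \<integral>\<^sup>+u. F (u, x) \<partial>U)
    \<le> ennreal (p / (p - 1)) * (\<integral>\<^sup>+u. lorentz_norm M (ennreal p) q (\<lambda>x. F (u, x)) \<partial>U)"
proof -
  interpret U: sigma_finite_measure U by fact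
  interpret M: sigma_finite_measure M by fact
  have r: "enn2real (inverse (ennreal p)) = 1 / p"
    using p by (simp add: inverse_ennreal inverse_eq_divide)
  have q0: "q > 0" using q by (auto intro: less_le_trans[of 0 1])
  define R where "R u = rearrangement M (\<lambda>x. F (u, x))" for u
  have R_borel [measurable]: "R u \<in> borel_measurable borel" for u
    unfolding R_def by (rule measurable_rearrangement_snd)
  have R [measurable]: "(\<lambda>(u, s). R u s) \<in> borel_measurable (U \<Otimes>\<^sub>M borel)"
    unfolding R_def by (rule measurable_rearrangement[OF M F])
  have Rst: "(\<lambda>w. R (fst (fst w)) (snd w * snd (fst w)) * indicator {0<..<1} (snd w))
      \<in> borel_measurable ((U \<Otimes>\<^sub>M lborel) \<Otimes>\<^sub>M lborel)"
    using measurable_compose[OF _ R, of "\<lambda>w. (fst (fst w), snd w * snd (fst w))" "(U \<Otimes>\<^sub>M lborel) \<Otimes>\<^sub>M lborel"]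
    by (intro borel_measurable_times_ennreal) simp_all
  have Rint: "(\<lambda>w. \<integral>\<^sup>+s. R (fst w) (s * snd w) * indicator {0<..<1} s \<partial>lborel) \<in> borel_measurable (U \<Otimes>\<^sub>M lborel)"
    using lborel.borel_measurable_nn_integral_fst[OF Rst] by simp
  have "lorentz_norm M (ennreal p) q (\<lambda>x. \<integral>\<^sup>+u. F (u, x) \<partial>U)
      \<le> weighted_Lq (1 / p) q (\<lambda>t. \<integral>\<^sup>+u. (\<integral>\<^sup>+s. R u (s * t) * indicator {0<..<1} s \<partial>lborel) \<partial>U)"
    unfolding lorentz_norm_eq_weighted_Lq r R_def by (intro weighted_Lq_mono rearrangement_nn_integral_le U M F)
  also have "\<dots> \<le> (\<integral>\<^sup>+u. weighted_Lq (1 / p) q (\<lambda>t. \<integral>\<^sup>+s. R u (s * t) * indicator {0<..<1} s \<partial>lborel) \<partial>U)"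
    using weighted_Lq_minkowski[OF U q Rint] by simp
  also have "\<dots> \<le> (\<integral>\<^sup>+u. ennreal (p / (p - 1)) * weighted_Lq (1 / p) q (R u) \<partial>U)"
  proof (intro nn_integral_mono)
    fix u
    have "weighted_Lq (1 / p) q (\<lambda>t. \<integral>\<^sup>+s. R u (s * t) * indicator {0<..<1} s \<partial>lborel)
        \<le> (\<integral>\<^sup>+s. weighted_Lq (1 / p) q (\<lambda>t. R u (s * t) * indicator {0<..<1} s) \<partial>lborel)"
      using weighted_Lq_minkowski[OF sigma_finite_lborel q, of "\<lambda>w. R u (fst w * snd w) * indicator {0<..<1} (fst w)"]
      by simp
    also have "\<dots> \<le> (\<integral>\<^sup>+s. ennreal (s powr (- 1 / p)) * indicator {0<..<1} s * weighted_Lq (1 / p) q (R u) \<partial>lborel)"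
    proof (intro nn_integral_mono)
      fix s :: real
      show "weighted_Lq (1 / p) q (\<lambda>t. R u (s * t) * indicator {0<..<1} s)
          \<le> ennreal (s powr (- 1 / p)) * indicator {0<..<1} s * weighted_Lq (1 / p) q (R u)"
      proof (cases "s \<in> {0<..<1}")
        case True
        then show ?thesis using weighted_Lq_dilate[of s q "R u" "1 / p"] q0 by simp
      next
        case False
        then show ?thesis using weighted_Lq_cmult[of 0 q "R u" "1 / p"] q0 by simp
      qed
    qed
    also have "\<dots> = (\<integral>\<^sup>+s. ennreal (s powr (- 1 / p)) * indicator {0<..<1} s \<partial>lborel) * weighted_Lq (1 / p) q (R u)"
      by (intro nn_integral_multc) measurable
    also have "(\<integral>\<^sup>+s. ennreal (s powr (- 1 / p)) * indicator {0<..<1} s \<partial>lborel) = ennreal (p / (p - 1))"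
      using p by (subst nn_integral_powr_near_0) (auto simp: field_simps)
    finally show "weighted_Lq (1 / p) q (\<lambda>t. \<integral>\<^sup>+s. R u (s * t) * indicator {0<..<1} s \<partial>lborel)
        \<le> ennreal (p / (p - 1)) * weighted_Lq (1 / p) q (R u)" .
  qed
  also have "\<dots> = ennreal (p / (p - 1)) * (\<integral>\<^sup>+u. lorentz_norm M (ennreal p) q (\<lambda>x. F (u, x)) \<partial>U)"
    using measurable_lorentz_norm[OF M F q0, of "ennreal p"] unfolding lorentz_norm_eq_weighted_Lq r R_def
    by (intro nn_integral_cmult) auto
  finally show ?thesis .
qed

section \<open>Iterated norms\<close>

definition dilate :: "nat set \<Rightarrow> (nat \<Rightarrow> real) \<Rightarrow> (nat \<Rightarrow> real) \<Rightarrow> nat \<Rightarrow> real" where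
  "dilate J u x = (\<lambda>i. if i \<in> J then u i * x i else x i)"

definition nonzero_on :: "nat \<Rightarrow> nat set \<Rightarrow> (nat \<Rightarrow> real) set" where
  "nonzero_on n A = {x \<in> Rn n. \<forall>i\<in>A. x i \<noteq> 0}"

text \<open>
  The properties of an iterated norm, seen as an operator on functions on \<open>\<real>\<^sup>n\<close>, that the proof uses;
  stating them for operators makes them stable under composition, hence provable one variable at a time.
  \<open>J\<close> is the set of variables in which the norm is taken, \<open>b i\<close> is the reciprocal of the first exponent
  in the variable \<open>i\<close>, and \<open>U\<close> is the measure in Minkowski's inequality.  In the monotonicity clause
  two functions are compared only where the variables in \<open>J\<close> do not vanish, and \<open>A\<close> records
  the variables that later norms will remove.  In the dilation clause \<open>J'\<close> may exceed \<open>J\<close>: the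
  dilations in the other variables are still there when the norm over \<open>J\<close> has been taken.
\<close>

definition norm_operator ::
  "nat \<Rightarrow> (nat \<Rightarrow> real) measure \<Rightarrow> (nat \<Rightarrow> real) \<Rightarrow> nat set \<Rightarrow>
   (((nat \<Rightarrow> real) \<Rightarrow> ennreal) \<Rightarrow> (nat \<Rightarrow> real) \<Rightarrow> ennreal) \<Rightarrow> bool" where
  "norm_operator n U b J \<Phi> \<longleftrightarrow> J \<subseteq> {1..n} \<and>
    (\<forall>g h. (\<forall>x\<in>Rn n. g x = h x) \<longrightarrow> (\<forall>x\<in>Rn n. \<Phi> g x = \<Phi> h x)) \<and>
    (\<forall>g h A. h \<in> borel_measurable (leb {1..n}) \<longrightarrow> (\<forall>x\<in>nonzero_on n (A \<union> J). g x \<le> h x) \<longrightarrow>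
      (\<forall>x\<in>nonzero_on n A. \<Phi> g x \<le> \<Phi> h x)) \<and>
    (\<forall>c>0. \<forall>g. \<Phi> (\<lambda>x. ennreal c * g x) = (\<lambda>x. ennreal c * \<Phi> g x)) \<and>
    (\<forall>g\<in>borel_measurable (leb {1..n}). \<Phi> g \<in> borel_measurable (leb {1..n})) \<and>
    (\<forall>F\<in>borel_measurable (U \<Otimes>\<^sub>M leb {1..n}).
      (\<lambda>w. \<Phi> (\<lambda>x. F (fst w, x)) (snd w)) \<in> borel_measurable (U \<Otimes>\<^sub>M leb {1..n})) \<and>
    (\<exists>C>0. \<forall>F\<in>borel_measurable (U \<Otimes>\<^sub>M leb {1..n}). \<forall>x\<in>Rn n.
      \<Phi> (\<lambda>x. \<integral>\<^sup>+u. F (u, x) \<partial>U) x \<le> ennreal C * (\<integral>\<^sup>+u. \<Phi> (\<lambda>x. F (u, x)) x \<partial>U)) \<and>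
    (\<forall>h\<in>borel_measurable (leb {1..n}). \<forall>u J'. J \<subseteq> J' \<longrightarrow> J' \<subseteq> {1..n} \<longrightarrow> (\<forall>i\<in>J. u i \<noteq> 0) \<longrightarrow>
      (\<forall>x\<in>Rn n. \<Phi> (\<lambda>x. h (dilate J' u x)) x
        = ennreal (\<Prod>i\<in>J. \<bar>u i\<bar> powr - b i) * \<Phi> h (dilate (J' - J) u x)))"

lemmas norm_operator_subset = norm_operator_def[THEN iffD1, THEN conjunct1, rule_format]
lemmas norm_operator_eq_on = norm_operator_def[THEN iffD1, THEN conjunct2, THEN conjunct1, rule_format]
lemmas norm_operator_mono = norm_operator_def[THEN iffD1, THEN conjunct2, THEN conjunct2, THEN conjunct1, rule_format]
lemmas norm_operator_cmult = norm_operator_def[THEN iffD1, THEN conjunct2, THEN conjunct2, THEN conjunct2, THEN conjunct1, rule_format]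
lemmas norm_operator_measurable = norm_operator_def[THEN iffD1, THEN conjunct2, THEN conjunct2, THEN conjunct2, THEN conjunct2, THEN conjunct1, rule_format]
lemmas norm_operator_measurable_pair = norm_operator_def[THEN iffD1, THEN conjunct2, THEN conjunct2, THEN conjunct2, THEN conjunct2, THEN conjunct2, THEN conjunct1, rule_format]
lemmas norm_operator_minkowski = norm_operator_def[THEN iffD1, THEN conjunct2, THEN conjunct2, THEN conjunct2, THEN conjunct2, THEN conjunct2, THEN conjunct2, THEN conjunct1, rule_format]
lemmas norm_operator_dilate = norm_operator_def[THEN iffD1, THEN conjunct2, THEN conjunct2, THEN conjunct2, THEN conjunct2, THEN conjunct2, THEN conjunct2, THEN conjunct2, rule_format]

lemma product_sigma_finite_lborel: "product_sigma_finite (\<lambda>_. lborel)"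
  by unfold_locales

lemma sigma_finite_leb: "finite I \<Longrightarrow> sigma_finite_measure (leb I)"
  by (rule product_sigma_finite.sigma_finite[OF product_sigma_finite_lborel])

lemma space_leb: "space (leb I) = PiE I (\<lambda>_. UNIV)"
  by (simp add: space_PiM)

lemma dilate_in_Rn: "x \<in> Rn n \<Longrightarrow> J \<subseteq> {1..n} \<Longrightarrow> dilate J u x \<in> Rn n"
  by (auto simp: dilate_def PiE_iff extensional_def)

lemma fun_upd_in_Rn: "x \<in> Rn n \<Longrightarrow> m \<in> {1..n} \<Longrightarrow> x(m := t) \<in> Rn n"
  by (auto simp: PiE_iff extensional_def)

lemma norm_operator_id: "norm_operator n U b {} (\<lambda>g. g)"
  unfolding norm_operator_def
  by (auto intro!: exI[of _ 1] simp: nonzero_on_def)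

lemma norm_operator_cong:
  assumes "norm_operator n U b J \<Phi>" "\<And>i. i \<in> J \<Longrightarrow> b i = b' i"
  shows "norm_operator n U b' J \<Phi>"
proof -
  have "(\<Prod>i\<in>J. \<bar>u i\<bar> powr - b i) = (\<Prod>i\<in>J. \<bar>u i\<bar> powr - b' i)" for u :: "nat \<Rightarrow> real"
    using assms(2) by (intro prod.cong) auto
  then show ?thesis using assms(1) unfolding norm_operator_def by simp
qed

text \<open>
  The hyperplane \<open>x\<^sub>m = 0\<close> meets each line in direction \<open>m\<close> in one point, which the norm does not see.
\<close>

lemma norm_operator_lorentz:
  assumes U: "sigma_finite_measure U" and m: "m \<in> {1..n}" and p: "p > 1" and q: "q \<ge> 1"
  shows "norm_operator n U (\<lambda>_. 1 / p) {m} (\<lambda>g x. lorentz_norm lborel (ennreal p) q (\<lambda>t. g (x(m := t))))"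
    (is "norm_operator _ _ _ _ ?N")
proof -
  have q0: "q > 0" using q by (auto intro: less_le_trans[of 0 1])
  have upd: "(\<lambda>w. (snd w)(m := t)) \<in> U \<Otimes>\<^sub>M leb {1..n} \<rightarrow>\<^sub>M leb {1..n}" for t
    using m by (intro measurable_fun_upd[where I="{1..n}"]) auto
  have upd1: "(\<lambda>w. (fst w)(m := snd w)) \<in> leb {1..n} \<Otimes>\<^sub>M lborel \<rightarrow>\<^sub>M leb {1..n}"
    using m by (intro measurable_fun_upd[where I="{1..n}"]) auto
  have upd2: "(\<lambda>w. (snd (fst w))(m := snd w)) \<in> (U \<Otimes>\<^sub>M leb {1..n}) \<Otimes>\<^sub>M lborel \<rightarrow>\<^sub>M leb {1..n}"
    using m by (intro measurable_fun_upd[where I="{1..n}"]) auto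
  have sec: "(\<lambda>t. x(m := t)) \<in> lborel \<rightarrow>\<^sub>M leb {1..n}" if "x \<in> Rn n" for x
    using m that by (intro measurable_fun_upd[where I="{1..n}"]) (auto simp: space_leb)
  show ?thesis unfolding norm_operator_def
  proof (intro conjI allI impI ballI)
    show "{m} \<subseteq> {1..n}" using m by simp
  next
    fix g h :: "(nat \<Rightarrow> real) \<Rightarrow> ennreal" and x assume "\<forall>x\<in>Rn n. g x = h x" "x \<in> Rn n"
    then show "?N g x = ?N h x" using fun_upd_in_Rn[OF _ m] by simp
  next
    fix g h :: "(nat \<Rightarrow> real) \<Rightarrow> ennreal" and A x
    assume h [measurable]: "h \<in> borel_measurable (leb {1..n})"
      and le: "\<forall>x\<in>nonzero_on n (A \<union> {m}). g x \<le> h x" and x: "x \<in> nonzero_on n A"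
    have "x(m := t) \<in> nonzero_on n (A \<union> {m})" if "t \<noteq> 0" for t
      using x that m fun_upd_in_Rn[OF _ m, of x t] by (auto simp: nonzero_on_def)
    then have "AE t in lborel. g (x(m := t)) \<le> h (x(m := t))"
      using AE_lborel_singleton[of 0] le by (auto elim!: eventually_mono)
    moreover have "(\<lambda>t. h (x(m := t))) \<in> borel_measurable lborel"
      using measurable_compose[OF sec h] x by (simp add: nonzero_on_def)
    ultimately show "?N g x \<le> ?N h x" by (rule lorentz_norm_mono_AE)
  next
    fix c :: real and g :: "(nat \<Rightarrow> real) \<Rightarrow> ennreal" assume "0 < c"
    then show "?N (\<lambda>x. ennreal c * g x) = (\<lambda>x. ennreal c * ?N g x)"
      using q0 by (simp add: lorentz_norm_cmult)
  next
    fix g :: "(nat \<Rightarrow> real) \<Rightarrow> ennreal" assume g: "g \<in> borel_measurable (leb {1..n})"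
    show "?N g \<in> borel_measurable (leb {1..n})"
      using measurable_lorentz_norm[OF sigma_finite_lborel measurable_compose[OF upd1 g] q0, of "ennreal p"] by simp
  next
    fix F :: "(nat \<Rightarrow> real) \<times> (nat \<Rightarrow> real) \<Rightarrow> ennreal" assume F: "F \<in> borel_measurable (U \<Otimes>\<^sub>M leb {1..n})"
    have "(\<lambda>w. F (fst (fst w), (snd (fst w))(m := snd w))) \<in> borel_measurable ((U \<Otimes>\<^sub>M leb {1..n}) \<Otimes>\<^sub>M lborel)"
      using upd2 by (intro measurable_compose[OF _ F] measurable_Pair) auto
    from measurable_lorentz_norm[OF sigma_finite_lborel this q0, of "ennreal p"]
    show "(\<lambda>w. ?N (\<lambda>x. F (fst w, x)) (snd w)) \<in> borel_measurable (U \<Otimes>\<^sub>M leb {1..n})" by simp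
  next
    have "?N (\<lambda>x. \<integral>\<^sup>+u. F (u, x) \<partial>U) x \<le> ennreal (p / (p - 1)) * (\<integral>\<^sup>+u. ?N (\<lambda>x. F (u, x)) x \<partial>U)"
      if F: "F \<in> borel_measurable (U \<Otimes>\<^sub>M leb {1..n})" and x: "x \<in> Rn n" for F x
    proof -
      have "(\<lambda>w. F (fst w, x(m := snd w))) \<in> borel_measurable (U \<Otimes>\<^sub>M lborel)"
        using measurable_compose[OF measurable_snd sec[OF x]] by (intro measurable_compose[OF _ F] measurable_Pair) auto
      from lorentz_minkowski[OF U sigma_finite_lborel p q this] show ?thesis by simp
    qed
    then show "\<exists>C>0. \<forall>F\<in>borel_measurable (U \<Otimes>\<^sub>M leb {1..n}). \<forall>x\<in>Rn n.
      ?N (\<lambda>x. \<integral>\<^sup>+u. F (u, x) \<partial>U) x \<le> ennreal C * (\<integral>\<^sup>+u. ?N (\<lambda>x. F (u, x)) x \<partial>U)"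
      using p by (intro exI[of _ "p / (p - 1)"]) auto
  next
    fix h :: "(nat \<Rightarrow> real) \<Rightarrow> ennreal" and u :: "nat \<Rightarrow> real" and J' x
    assume h: "h \<in> borel_measurable (leb {1..n})"
      and J': "{m} \<subseteq> J'" "J' \<subseteq> {1..n}" "\<forall>i\<in>{m}. u i \<noteq> 0" and x: "x \<in> Rn n"
    have eq: "dilate J' u (x(m := t)) = (dilate (J' - {m}) u x)(m := u m * t)" for t
      using J' by (auto simp: dilate_def)
    have "dilate (J' - {m}) u x \<in> Rn n"
      using dilate_in_Rn[OF x, of "J' - {m}" u] J' by auto
    then have "(\<lambda>t. h ((dilate (J' - {m}) u x)(m := t))) \<in> borel_measurable borel"
      using measurable_compose[OF sec h] by simp
    then show "?N (\<lambda>x. h (dilate J' u x)) x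
        = ennreal (\<Prod>i\<in>{m}. \<bar>u i\<bar> powr - (1 / p)) * ?N h (dilate (J' - {m}) u x)"
      unfolding eq using J' p q0
        lorentz_norm_dilate[of "u m" q p "\<lambda>t. h ((dilate (J' - {m}) u x)(m := t))"] by simp
  qed
qed

text \<open>
  The constant in Minkowski's inequality and the dilation factor multiply, and the inner operator
  is applied with the variables of the outer one as parameters.
\<close>

lemma norm_operator_comp:
  assumes \<Phi>1: "norm_operator n U b J1 \<Phi>1" and \<Phi>2: "norm_operator n U b J2 \<Phi>2"
    and disj: "J1 \<inter> J2 = {}" and U: "sigma_finite_measure U"
  shows "norm_operator n U b (J1 \<union> J2) (\<lambda>g. \<Phi>2 (\<Phi>1 g))"
  unfolding norm_operator_def
proof (intro conjI allI impI ballI)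
  interpret U: sigma_finite_measure U by fact
  note eq1 = norm_operator_eq_on[OF \<Phi>1] and eq2 = norm_operator_eq_on[OF \<Phi>2]
    and mono1 = norm_operator_mono[OF \<Phi>1] and mono2 = norm_operator_mono[OF \<Phi>2]
    and cmult1 = norm_operator_cmult[OF \<Phi>1] and cmult2 = norm_operator_cmult[OF \<Phi>2]
    and meas1 = norm_operator_measurable[OF \<Phi>1] and meas2 = norm_operator_measurable[OF \<Phi>2]
    and joint1 = norm_operator_measurable_pair[OF \<Phi>1] and joint2 = norm_operator_measurable_pair[OF \<Phi>2]
    and dilate1 = norm_operator_dilate[OF \<Phi>1] and dilate2 = norm_operator_dilate[OF \<Phi>2]
  obtain C1 where C1: "C1 > 0" "\<And>F x. F \<in> borel_measurable (U \<Otimes>\<^sub>M leb {1..n}) \<Longrightarrow> x \<in> Rn n \<Longrightarrow>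
      \<Phi>1 (\<lambda>x. \<integral>\<^sup>+u. F (u, x) \<partial>U) x \<le> ennreal C1 * (\<integral>\<^sup>+u. \<Phi>1 (\<lambda>x. F (u, x)) x \<partial>U)"
    using norm_operator_minkowski[OF \<Phi>1] by blast
  obtain C2 where C2: "C2 > 0" "\<And>F x. F \<in> borel_measurable (U \<Otimes>\<^sub>M leb {1..n}) \<Longrightarrow> x \<in> Rn n \<Longrightarrow>
      \<Phi>2 (\<lambda>x. \<integral>\<^sup>+u. F (u, x) \<partial>U) x \<le> ennreal C2 * (\<integral>\<^sup>+u. \<Phi>2 (\<lambda>x. F (u, x)) x \<partial>U)"
    using norm_operator_minkowski[OF \<Phi>2] by blast
  have sub: "J1 \<subseteq> {1..n}" "J2 \<subseteq> {1..n}"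
    using norm_operator_subset[OF \<Phi>1] norm_operator_subset[OF \<Phi>2] .
  then show "J1 \<union> J2 \<subseteq> {1..n}" by simp
  {
    fix g h :: "(nat \<Rightarrow> real) \<Rightarrow> ennreal" and x assume "\<forall>x\<in>Rn n. g x = h x" "x \<in> Rn n"
    then show "\<Phi>2 (\<Phi>1 g) x = \<Phi>2 (\<Phi>1 h) x" by (intro eq2 ballI eq1) auto
  next
    fix g h :: "(nat \<Rightarrow> real) \<Rightarrow> ennreal" and A x
    assume h: "h \<in> borel_measurable (leb {1..n})"
      and le: "\<forall>x\<in>nonzero_on n (A \<union> (J1 \<union> J2)). g x \<le> h x" and x: "x \<in> nonzero_on n A"
    show "\<Phi>2 (\<Phi>1 g) x \<le> \<Phi>2 (\<Phi>1 h) x"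
    proof (rule mono2[OF meas1[OF h] _ x])
      fix y assume "y \<in> nonzero_on n (A \<union> J2)"
      show "\<Phi>1 g y \<le> \<Phi>1 h y" using le by (intro mono1[OF h _ \<open>y \<in> _\<close>]) (auto simp: Un_ac)
    qed
  next
    fix c :: real and g :: "(nat \<Rightarrow> real) \<Rightarrow> ennreal" assume "0 < c"
    then show "\<Phi>2 (\<Phi>1 (\<lambda>x. ennreal c * g x)) = (\<lambda>x. ennreal c * \<Phi>2 (\<Phi>1 g) x)"
      by (simp add: cmult1 cmult2)
  next
    fix g :: "(nat \<Rightarrow> real) \<Rightarrow> ennreal" assume "g \<in> borel_measurable (leb {1..n})"
    then show "\<Phi>2 (\<Phi>1 g) \<in> borel_measurable (leb {1..n})" by (intro meas1 meas2)
  next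
    fix F :: "(nat \<Rightarrow> real) \<times> (nat \<Rightarrow> real) \<Rightarrow> ennreal" assume F: "F \<in> borel_measurable (U \<Otimes>\<^sub>M leb {1..n})"
    show "(\<lambda>w. \<Phi>2 (\<Phi>1 (\<lambda>x. F (fst w, x))) (snd w)) \<in> borel_measurable (U \<Otimes>\<^sub>M leb {1..n})"
      using joint2[OF joint1[OF F]] by simp
  next
    have "\<Phi>2 (\<Phi>1 (\<lambda>x. \<integral>\<^sup>+u. F (u, x) \<partial>U)) x
        \<le> ennreal (C1 * C2) * (\<integral>\<^sup>+u. \<Phi>2 (\<Phi>1 (\<lambda>x. F (u, x))) x \<partial>U)"
      if F: "F \<in> borel_measurable (U \<Otimes>\<^sub>M leb {1..n})" and x: "x \<in> Rn n" for F x
    proof -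
      have i: "(\<lambda>x. \<integral>\<^sup>+u. \<Phi>1 (\<lambda>x. F (u, x)) x \<partial>U) \<in> borel_measurable (leb {1..n})"
        using U.borel_measurable_nn_integral_fst[OF measurable_pair_swap[OF joint1[OF F]]] by simp
      have "\<Phi>2 (\<Phi>1 (\<lambda>x. \<integral>\<^sup>+u. F (u, x) \<partial>U)) x
          \<le> \<Phi>2 (\<lambda>x. ennreal C1 * (\<integral>\<^sup>+u. \<Phi>1 (\<lambda>x. F (u, x)) x \<partial>U)) x"
        using x i C1(2)[OF F] by (intro mono2[where A="{}"]) (auto simp: nonzero_on_def)
      also have "\<dots> = ennreal C1 * \<Phi>2 (\<lambda>x. \<integral>\<^sup>+u. \<Phi>1 (\<lambda>x. F (u, x)) x \<partial>U) x"
        by (simp add: cmult2 C1)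
      also have "\<dots> \<le> ennreal C1 * (ennreal C2 * (\<integral>\<^sup>+u. \<Phi>2 (\<Phi>1 (\<lambda>x. F (u, x))) x \<partial>U))"
        using C2(2)[OF joint1[OF F] x] by (intro mult_left_mono) simp_all
      finally show ?thesis using C1 C2 by (simp add: ennreal_mult mult.assoc)
    qed
    then show "\<exists>C>0. \<forall>F\<in>borel_measurable (U \<Otimes>\<^sub>M leb {1..n}). \<forall>x\<in>Rn n.
        \<Phi>2 (\<Phi>1 (\<lambda>x. \<integral>\<^sup>+u. F (u, x) \<partial>U)) x \<le> ennreal C * (\<integral>\<^sup>+u. \<Phi>2 (\<Phi>1 (\<lambda>x. F (u, x))) x \<partial>U)"
      using C1 C2 by (intro exI[of _ "C1 * C2"]) auto
  next
    fix h :: "(nat \<Rightarrow> real) \<Rightarrow> ennreal" and u :: "nat \<Rightarrow> real" and J' x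
    assume h: "h \<in> borel_measurable (leb {1..n})"
      and J': "J1 \<union> J2 \<subseteq> J'" "J' \<subseteq> {1..n}" "\<forall>i\<in>J1 \<union> J2. u i \<noteq> 0" and x: "x \<in> Rn n"
    define c1 c2 where "c1 = (\<Prod>i\<in>J1. \<bar>u i\<bar> powr - b i)" and "c2 = (\<Prod>i\<in>J2. \<bar>u i\<bar> powr - b i)"
    have fin: "finite J1" "finite J2" using sub by (auto intro: finite_subset)
    have c: "c1 > 0" "c2 > 0" unfolding c1_def c2_def using J' by (auto intro!: prod_pos)
    have "\<Phi>2 (\<Phi>1 (\<lambda>x. h (dilate J' u x))) x = \<Phi>2 (\<lambda>x. ennreal c1 * \<Phi>1 h (dilate (J' - J1) u x)) x"
      using h J' x unfolding c1_def by (intro eq2 dilate1) auto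
    also have "\<dots> = ennreal c1 * \<Phi>2 (\<lambda>x. \<Phi>1 h (dilate (J' - J1) u x)) x"
      using c by (simp add: cmult2)
    also have "\<Phi>2 (\<lambda>x. \<Phi>1 h (dilate (J' - J1) u x)) x = ennreal c2 * \<Phi>2 (\<Phi>1 h) (dilate (J' - J1 - J2) u x)"
      using meas1[OF h] J' x disj unfolding c2_def by (intro dilate2) auto
    also have "ennreal c1 * \<dots> = ennreal (c1 * c2) * \<Phi>2 (\<Phi>1 h) (dilate (J' - J1 - J2) u x)"
      using c by (simp add: ennreal_mult mult.assoc)
    also have "c1 * c2 = (\<Prod>i\<in>J1 \<union> J2. \<bar>u i\<bar> powr - b i)"
      unfolding c1_def c2_def using fin disj by (simp add: prod.union_disjoint)
    also have "J' - J1 - J2 = J' - (J1 \<union> J2)" by auto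
    finally show "\<Phi>2 (\<Phi>1 (\<lambda>x. h (dilate J' u x))) x
      = ennreal (\<Prod>i\<in>J1 \<union> J2. \<bar>u i\<bar> powr - b i) * \<Phi>2 (\<Phi>1 h) (dilate (J' - (J1 \<union> J2)) u x)" .
  }
qed

lemma norm_operator_mixed:
  assumes U: "sigma_finite_measure U" and "s + k \<le> n"
    and "\<And>l. l \<in> {1..k} \<Longrightarrow> p l > 1 \<and> q l \<ge> 1 \<and> b (s + l) = 1 / p l"
  shows "norm_operator n U b {s + 1..s + k} (mixed_lorentz_norm s k (\<lambda>l. ennreal (p l)) q)"
  using assms(2,3)
proof (induction k)
  case 0
  have "mixed_lorentz_norm s 0 (\<lambda>l. ennreal (p l)) q = (\<lambda>g. g)" by (intro ext) simp
  then show ?case using norm_operator_id by simp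
next
  case (Suc k)
  have "norm_operator n U b {s + 1..s + k} (mixed_lorentz_norm s k (\<lambda>l. ennreal (p l)) q)"
    using Suc by simp
  moreover have "norm_operator n U b {s + Suc k}
      (\<lambda>g x. lorentz_norm lborel (ennreal (p (Suc k))) (q (Suc k)) (\<lambda>t. g (x(s + Suc k := t))))"
    using Suc.prems(1) Suc.prems(2)[of "Suc k"]
    by (intro norm_operator_cong[OF norm_operator_lorentz[OF U]]) auto
  ultimately have "norm_operator n U b ({s + 1..s + k} \<union> {s + Suc k}) (\<lambda>g x.
      lorentz_norm lborel (ennreal (p (Suc k))) (q (Suc k))
        (\<lambda>t. mixed_lorentz_norm s k (\<lambda>l. ennreal (p l)) q g (x(s + Suc k := t))))"
    by (rule norm_operator_comp) (use U in auto)
  also have "{s + 1..s + k} \<union> {s + Suc k} = {s + 1..s + Suc k}" by auto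
  also have "(\<lambda>g x. lorentz_norm lborel (ennreal (p (Suc k))) (q (Suc k))
        (\<lambda>t. mixed_lorentz_norm s k (\<lambda>l. ennreal (p l)) q g (x(s + Suc k := t))))
      = mixed_lorentz_norm s (Suc k) (\<lambda>l. ennreal (p l)) q"
    by (intro ext) simp
  finally show ?case .
qed

lemma norm_operator_blocks:
  assumes U: "sigma_finite_measure U" and "block_end k N \<le> n"
    and "\<And>j l. j < N \<Longrightarrow> l \<in> {1..k (Suc j)} \<Longrightarrow>
      P (Suc j) l > 1 \<and> Q (Suc j) l \<ge> 1 \<and> b (block_end k j + l) = 1 / P (Suc j) l"
  shows "norm_operator n U b {1..block_end k N} (blocks_lorentz_norm k N (\<lambda>j l. ennreal (P j l)) Q)"
  using assms(2,3)
proof (induction N)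
  case 0
  have "blocks_lorentz_norm k 0 (\<lambda>j l. ennreal (P j l)) Q = (\<lambda>g. g)" by (intro ext) simp
  then show ?case using norm_operator_id by (simp add: block_end_def)
next
  case (Suc N)
  have e: "block_end k (Suc N) = block_end k N + k (Suc N)" by (simp add: block_end_def)
  have "norm_operator n U b {1..block_end k N} (blocks_lorentz_norm k N (\<lambda>j l. ennreal (P j l)) Q)"
    using Suc e by simp
  moreover have "norm_operator n U b {block_end k N + 1..block_end k N + k (Suc N)}
      (mixed_lorentz_norm (block_end k N) (k (Suc N)) (\<lambda>l. ennreal (P (Suc N) l)) (Q (Suc N)))"
    using Suc.prems e by (intro norm_operator_mixed[OF U]) auto
  ultimately have "norm_operator n U b ({1..block_end k N} \<union> {block_end k N + 1..block_end k N + k (Suc N)})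
      (\<lambda>g. mixed_lorentz_norm (block_end k N) (k (Suc N)) (\<lambda>l. ennreal (P (Suc N) l)) (Q (Suc N))
        (blocks_lorentz_norm k N (\<lambda>j l. ennreal (P j l)) Q g))"
    by (rule norm_operator_comp) (use U in auto)
  also have "{1..block_end k N} \<union> {block_end k N + 1..block_end k N + k (Suc N)} = {1..block_end k (Suc N)}"
    unfolding e by auto
  also have "(\<lambda>g. mixed_lorentz_norm (block_end k N) (k (Suc N)) (\<lambda>l. ennreal (P (Suc N) l)) (Q (Suc N))
        (blocks_lorentz_norm k N (\<lambda>j l. ennreal (P j l)) Q g))
      = blocks_lorentz_norm k (Suc N) (\<lambda>j l. ennreal (P j l)) Q"
    by (intro ext) simp
  finally show ?case .
qed

section \<open>Test functions and their Fourier transforms\<close>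

text \<open>
  On \<^typ>\<open>nat \<Rightarrow> real\<close> the Borel sets of the product topology are the product sigma algebra, as there are
  only countably many coordinates.
\<close>

lemma measurable_continuous_on_Rn:
  fixes f :: "(nat \<Rightarrow> real) \<Rightarrow> complex"
  assumes "continuous_on (Rn n) f" shows "f \<in> borel_measurable (leb {1..n})"
proof -
  have "(\<lambda>x. x) \<in> leb {1..n} \<rightarrow>\<^sub>M (PiM UNIV (\<lambda>_. borel) :: (nat \<Rightarrow> real) measure)"
  proof (rule measurable_PiM_single')
    fix i :: nat
    show "(\<lambda>x. x i) \<in> borel_measurable (leb {1..n})"
    proof (cases "i \<in> {1..n}")
      case False
      have "(\<lambda>x. x i) \<in> borel_measurable (leb {1..n}) \<longleftrightarrow> (\<lambda>x. undefined :: real) \<in> borel_measurable (leb {1..n})"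
        using False by (intro measurable_cong) (auto simp: space_leb PiE_iff extensional_def)
      then show ?thesis by simp
    qed (use measurable_component_singleton[of i "{1..n}" "\<lambda>_. lborel"] in simp)
  qed auto
  then have "(\<lambda>x. x) \<in> leb {1..n} \<rightarrow>\<^sub>M (borel :: (nat \<Rightarrow> real) measure)"
    by (simp add: measurable_cong_sets[OF refl sets_PiM_equal_borel])
  then have "(\<lambda>x. x) \<in> leb {1..n} \<rightarrow>\<^sub>M restrict_space borel (Rn n)"
    by (intro measurable_restrict_space2) (auto simp: space_leb)
  from measurable_compose[OF this borel_measurable_continuous_on_restrict[OF assms]] show ?thesis by simp
qed

lemma continuous_on_fun_upd: "continuous_on S (\<lambda>t. (x :: nat \<Rightarrow> real)(i := t))"
proof (rule continuous_on_coordinatewise_then_product)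
  fix j show "continuous_on S (\<lambda>t. (x(i := t)) j)" by (cases "j = i") auto
qed

lemma test_function_foldr:
  "test_function n f \<Longrightarrow> set is \<subseteq> {1..n} \<Longrightarrow> continuous_on (Rn n) (foldr partial_deriv is f)"
  unfolding test_function_def smooth_Rn_def by blast

lemma test_function_continuous: "test_function n f \<Longrightarrow> continuous_on (Rn n) f"
  using test_function_foldr[of n f "[]"] by simp

lemma test_function_measurable: "test_function n f \<Longrightarrow> f \<in> borel_measurable (leb {1..n})"
  by (intro measurable_continuous_on_Rn test_function_continuous)

lemma has_vector_derivative_partial_deriv:
  assumes f: "test_function n f" and x: "x \<in> Rn n" and i: "i \<in> {1..n}"
  shows "((\<lambda>t. f (x(i := t))) has_vector_derivative partial_deriv i f (x(i := s))) (at s)"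
proof -
  have "\<forall>is. set is \<subseteq> {1..n} \<longrightarrow> (\<forall>i\<in>{1..n}. \<forall>x\<in>Rn n.
           (\<lambda>t. foldr partial_deriv is f (x(i := t))) differentiable (at (x i)))"
    using f unfolding test_function_def smooth_Rn_def by blast
  from this[rule_format, of "[]", OF _ i fun_upd_in_Rn[OF x i, of s]]
  have "(\<lambda>t. f (x(i := t))) differentiable (at s)" by simp
  then show ?thesis unfolding partial_deriv_def by (simp add: vector_derivative_works)
qed

text \<open>
  Off the closed support of \<open>f\<close> the function vanishes near the given point along every coordinate line,
  so differentiation does not enlarge the closed support.
\<close>

lemma test_function_partial_deriv:
  assumes f: "test_function n f" and i: "i \<in> {1..n}"
  shows "test_function n (partial_deriv i f)"
proof -
  have foldr: "foldr partial_deriv is (partial_deriv i f) = foldr partial_deriv (is @ [i]) f" for "is"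
    by simp
  have smooth: "smooth_Rn n (partial_deriv i f)"
    unfolding smooth_Rn_def foldr
  proof (intro allI impI)
    fix "is" assume "set is \<subseteq> {1..n}"
    then have "set (is @ [i]) \<subseteq> {1..n}" using i by simp
    then show "continuous_on (Rn n) (foldr partial_deriv (is @ [i]) f) \<and>
        (\<forall>j\<in>{1..n}. \<forall>x\<in>Rn n. (\<lambda>t. foldr partial_deriv (is @ [i]) f (x(j := t))) differentiable (at (x j)))"
      using f unfolding test_function_def smooth_Rn_def by blast
  qed
  have "{x \<in> Rn n. partial_deriv i f x \<noteq> 0} \<subseteq> closure {x \<in> Rn n. f x \<noteq> 0}"
  proof (rule subsetI, rule ccontr)
    fix x assume x: "x \<in> {x \<in> Rn n. partial_deriv i f x \<noteq> 0}" and nx: "x \<notin> closure {x \<in> Rn n. f x \<noteq> 0}"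
    let ?O = "(\<lambda>t. x(i := t)) -` (- closure {x \<in> Rn n. f x \<noteq> 0})"
    have O: "open ?O" by (intro open_vimage continuous_on_fun_upd) auto
    have "x i \<in> ?O" using nx by simp
    have zero: "f (x(i := t)) = 0" if "t \<in> ?O" for t
      using that x fun_upd_in_Rn[of x n i t] i closure_subset[of "{x \<in> Rn n. f x \<noteq> 0}"] by auto
    have "((\<lambda>t. f (x(i := t))) has_vector_derivative 0) (at (x i))"
      by (rule has_vector_derivative_transform_within_open[OF _ O \<open>x i \<in> ?O\<close>, of "\<lambda>_. 0"]) (simp_all add: zero)
    then have "partial_deriv i f x = 0"
      unfolding partial_deriv_def by (rule vector_derivative_at)
    then show False using x by simp
  qed
  then have "closure {x \<in> Rn n. partial_deriv i f x \<noteq> 0} \<subseteq> closure {x \<in> Rn n. f x \<noteq> 0}"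
    by (simp add: closure_minimal)
  moreover have "compact (closure {x \<in> Rn n. f x \<noteq> 0})" using f by (simp add: test_function_def)
  ultimately have "compact (closure {x \<in> Rn n. partial_deriv i f x \<noteq> 0})"
    using compact_Int_closed[OF _ closed_closure, of "closure {x \<in> Rn n. f x \<noteq> 0}" "{x \<in> Rn n. partial_deriv i f x \<noteq> 0}"]
    by (simp add: Int_absorb1)
  with smooth show ?thesis by (simp add: test_function_def)
qed

lemma closed_Rn: "closed (Rn n)"
proof -
  have "Rn n = (\<Inter>i\<in>-{1..n}. {x. x i = undefined})" by (auto simp: PiE_iff extensional_def)
  also have "closed \<dots>"
    by (intro closed_INT ballI closed_Collect_eq continuous_on_product_coordinates continuous_on_const)
  finally show ?thesis .
qed

lemma test_function_bounded:
  assumes f: "test_function n f"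
  obtains B R where "\<And>x. x \<in> Rn n \<Longrightarrow> cmod (f x) \<le> B"
    "\<And>x i. x \<in> Rn n \<Longrightarrow> f x \<noteq> 0 \<Longrightarrow> i \<in> {1..n} \<Longrightarrow> \<bar>x i\<bar> \<le> R" "R > 0" "B \<ge> 0"
proof -
  let ?S = "closure {x \<in> Rn n. f x \<noteq> 0}"
  have S: "compact ?S" using f by (simp add: test_function_def)
  have "?S \<subseteq> Rn n" by (intro closure_minimal closed_Rn) auto
  then have "continuous_on ?S f" using test_function_continuous[OF f] by (rule continuous_on_subset[rotated])
  then have "bounded (f ` ?S)" using S by (intro compact_imp_bounded compact_continuous_image)
  then obtain B where B: "\<And>x. x \<in> ?S \<Longrightarrow> cmod (f x) \<le> B" by (auto simp: bounded_iff)
  have "\<forall>i. \<exists>r. \<forall>x\<in>?S. \<bar>x i\<bar> \<le> r"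
  proof
    fix i
    have "bounded ((\<lambda>x. x i) ` ?S)"
      using S by (intro compact_imp_bounded compact_continuous_image continuous_on_subset[OF continuous_on_product_coordinates]) auto
    then show "\<exists>r. \<forall>x\<in>?S. \<bar>x i\<bar> \<le> r" unfolding bounded_iff by auto
  qed
  from choice[OF this] obtain r where r: "\<And>i x. x \<in> ?S \<Longrightarrow> \<bar>x i\<bar> \<le> r i" by blast
  define R where "R = 1 + (\<Sum>i=1..n. \<bar>r i\<bar>)"
  show ?thesis
  proof (rule that[of "max B 0" R])
    fix x assume x: "x \<in> Rn n"
    show "cmod (f x) \<le> max B 0"
    proof (cases "f x = 0")
      case False
      then show ?thesis using B[of x] x closure_subset[of "{x \<in> Rn n. f x \<noteq> 0}"] by auto
    qed simp
  next
    fix x i assume x: "x \<in> Rn n" "f x \<noteq> 0" "i \<in> {1..n}"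
    then have "x \<in> ?S" using closure_subset[of "{x \<in> Rn n. f x \<noteq> 0}"] by auto
    from r[OF this, of i] have "\<bar>x i\<bar> \<le> \<bar>r i\<bar>" by simp
    also have "\<dots> \<le> (\<Sum>i=1..n. \<bar>r i\<bar>)" using x by (intro member_le_sum) auto
    finally show "\<bar>x i\<bar> \<le> R" by (simp add: R_def)
  qed (auto simp: R_def intro!: add_pos_nonneg sum_nonneg)
qed

lemma integrable_test_function:
  assumes f: "test_function n f" shows "integrable (leb {1..n}) f"
proof -
  interpret product_sigma_finite "\<lambda>_ :: nat. lborel :: real measure" by (rule product_sigma_finite_lborel)
  obtain B R where B: "\<And>x. x \<in> Rn n \<Longrightarrow> cmod (f x) \<le> B"
    and R: "\<And>x i. x \<in> Rn n \<Longrightarrow> f x \<noteq> 0 \<Longrightarrow> i \<in> {1..n} \<Longrightarrow> \<bar>x i\<bar> \<le> R" "R > 0" "B \<ge> 0"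
    using test_function_bounded[OF f] by metis
  have "integrable (leb {1..n}) (\<lambda>x. B * (\<Prod>i\<in>{1..n}. indicator {-R..R} (x i)) :: real)"
    using R by (intro integrable_mult_right product_integrable_prod) auto
  then show ?thesis
  proof (rule Bochner_Integration.integrable_bound)
    show "f \<in> borel_measurable (leb {1..n})" by (rule test_function_measurable[OF f])
    show "AE x in leb {1..n}. norm (f x) \<le> norm (B * (\<Prod>i\<in>{1..n}. indicator {-R..R} (x i)) :: real)"
    proof (rule AE_I2)
      fix x assume "x \<in> space (leb {1..n})"
      then have x: "x \<in> Rn n" by (simp add: space_leb)
      show "norm (f x) \<le> norm (B * (\<Prod>i\<in>{1..n}. indicator {-R..R} (x i)) :: real)"
      proof (cases "f x = 0")
        case False
        then have "(\<Prod>i\<in>{1..n}. indicator {-R..R} (x i) :: real) = 1"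
          using R(1)[OF x] by (intro prod.neutral) (fastforce simp: indicator_def abs_le_iff)
        then show ?thesis using B[OF x] by simp
      qed simp
    qed
  qed
qed

lemma norm_exp_ii: "cmod (exp (\<i> * complex_of_real t)) = 1" "cmod (exp (- (\<i> * complex_of_real t))) = 1"
  by (simp_all add: norm_exp_eq_Re)

lemma integral_derivative_compact_support:
  fixes \<phi> \<phi>' :: "real \<Rightarrow> complex"
  assumes d: "\<And>t. (\<phi> has_vector_derivative \<phi>' t) (at t)" and c: "continuous_on UNIV \<phi>'"
    and supp: "\<And>t. \<bar>t\<bar> > R \<Longrightarrow> \<phi> t = 0" and R: "R > 0"
  shows "(LINT t|lborel. \<phi>' t) = 0"
proof -
  have zero: "\<phi>' t = 0" if "\<bar>t\<bar> > R" for t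
  proof -
    have "open {t. \<bar>t\<bar> > R}" by (intro open_Collect_less continuous_intros)
    then have "(\<phi> has_vector_derivative 0) (at t)"
      using that supp
      by (intro has_vector_derivative_transform_within_open[where f="\<lambda>_. 0" and g=\<phi> and S="{t. \<bar>t\<bar> > R}"]) auto
    then show ?thesis using d vector_derivative_at by metis
  qed
  have "(LINT t|lborel. \<phi>' t) = (LINT t|lborel. indicat_real {-R-1..R+1} t *\<^sub>R \<phi>' t)"
    by (intro Bochner_Integration.integral_cong refl) (auto simp: indicator_def intro!: zero)
  also have "\<dots> = \<phi> (R + 1) - \<phi> (-R-1)"
    using R by (intro integral_FTC_atLeastAtMost has_vector_derivative_at_within[OF d]
        continuous_on_subset[OF c]) auto
  also have "\<dots> = 0" using supp[of "R + 1"] supp[of "-R-1"] R by simp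
  finally show ?thesis .
qed

abbreviation dot :: "nat \<Rightarrow> (nat \<Rightarrow> real) \<Rightarrow> (nat \<Rightarrow> real) \<Rightarrow> real" where
  "dot n \<xi> x \<equiv> (\<Sum>i=1..n. \<xi> i * x i)"

abbreviation sq_norm :: "nat \<Rightarrow> (nat \<Rightarrow> real) \<Rightarrow> real" where
  "sq_norm K y \<equiv> (\<Sum>i=1..K. (y i)\<^sup>2)"

lemma fourier_integrand_integrable:
  assumes "integrable (leb {1..n}) f"
  shows "integrable (leb {1..n}) (\<lambda>x. f x * exp (- (\<i> * complex_of_real (dot n \<xi> x))))"
  by (rule Bochner_Integration.integrable_bound[OF assms])
    (use assms in \<open>auto simp: norm_mult norm_exp_ii simp del: of_real_sum\<close>)

text \<open>
  Integration by parts in the variable \<open>i\<close>: on each line in direction \<open>i\<close> the product of \<open>f\<close> and the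
  exponential has compact support, so its derivative integrates to \<open>0\<close>.
\<close>

lemma fourier_partial_deriv:
  assumes f: "test_function n f" and i: "i \<in> {1..n}"
  shows "fourier n (partial_deriv i f) \<xi> = \<i> * \<xi> i * fourier n f \<xi>"
proof -
  interpret product_sigma_finite "\<lambda>_ :: nat. lborel :: real measure" by (rule product_sigma_finite_lborel)
  define I where "I = {1..n} - {i}"
  have I: "insert i I = {1..n}" "finite I" "i \<notin> I" using i by (auto simp: I_def)
  define e where "e x = exp (- (\<i> * complex_of_real (dot n \<xi> x)))" for x :: "nat \<Rightarrow> real"
  obtain B R where R: "\<And>x i. x \<in> Rn n \<Longrightarrow> f x \<noteq> 0 \<Longrightarrow> i \<in> {1..n} \<Longrightarrow> \<bar>x i\<bar> \<le> R" "R > 0"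
    using test_function_bounded[OF f] by metis
  have int: "integrable (leb {1..n}) (\<lambda>x. partial_deriv i f x * e x)" "integrable (leb {1..n}) (\<lambda>x. f x * e x)"
    unfolding e_def by (intro fourier_integrand_integrable integrable_test_function test_function_partial_deriv f i)+
  then have int': "integrable (leb {1..n}) (\<lambda>x. partial_deriv i f x * e x - \<i> * \<xi> i * (f x * e x))" by auto
  have "(LINT x|leb {1..n}. partial_deriv i f x * e x - \<i> * \<xi> i * (f x * e x))
      = (LINT x|leb I. (LINT t|lborel. partial_deriv i f (x(i := t)) * e (x(i := t)) - \<i> * \<xi> i * (f (x(i := t)) * e (x(i := t)))))"
    using product_integral_insert[OF I(2,3), unfolded I(1), OF int'] .
  also have "\<dots> = (LINT x|leb I. 0)"
  proof (intro Bochner_Integration.integral_cong refl)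
    fix x assume "x \<in> space (leb I)"
    then have x: "x(i := t) \<in> Rn n" for t using i by (auto simp: space_leb I_def PiE_iff extensional_def)
    have e: "e (x(i := t)) = exp (- (\<i> * complex_of_real (\<Sum>j\<in>I. \<xi> j * x j))) * exp (- (\<i> * \<xi> i) * complex_of_real t)" for t
    proof -
      have "(\<Sum>j=1..n. \<xi> j * (x(i := t)) j) = \<xi> i * t + (\<Sum>j\<in>I. \<xi> j * (x(i := t)) j)"
        unfolding I(1)[symmetric] using I(2,3) by (subst sum.insert) auto
      also have "(\<Sum>j\<in>I. \<xi> j * (x(i := t)) j) = (\<Sum>j\<in>I. \<xi> j * x j)"
        using I(3) by (intro sum.cong) auto
      finally show ?thesis unfolding e_def by (simp add: exp_add[symmetric] algebra_simps)
    qed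
    have df: "((\<lambda>t. f (x(i := t))) has_vector_derivative partial_deriv i f (x(i := t))) (at t)" for t
      using has_vector_derivative_partial_deriv[OF f x[of 0] i, of t] by simp
    have de: "((\<lambda>t. e (x(i := t))) has_vector_derivative (- (\<i> * \<xi> i) * e (x(i := t)))) (at t)" for t
      unfolding e by (auto intro!: derivative_eq_intros has_vector_derivative_real_field)
    have cont: "continuous_on UNIV (\<lambda>t. g (x(i := t)))" if "continuous_on (Rn n) g" for g :: "_ \<Rightarrow> complex"
      using x by (intro continuous_on_compose2[OF that continuous_on_fun_upd]) auto
    show "(LINT t|lborel. partial_deriv i f (x(i := t)) * e (x(i := t)) - \<i> * \<xi> i * (f (x(i := t)) * e (x(i := t)))) = 0"
    proof (rule integral_derivative_compact_support[where \<phi>="\<lambda>t. f (x(i := t)) * e (x(i := t))" and R=R])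
      show "((\<lambda>t. f (x(i := t)) * e (x(i := t))) has_vector_derivative
          partial_deriv i f (x(i := t)) * e (x(i := t)) - \<i> * \<xi> i * (f (x(i := t)) * e (x(i := t)))) (at t)" for t
        using has_vector_derivative_mult[OF df[of t] de[of t]] by (simp add: algebra_simps)
      show "f (x(i := t)) * e (x(i := t)) = 0" if "\<bar>t\<bar> > R" for t
        using R(1)[OF x[of t] _ i] that by fastforce
      show "continuous_on UNIV (\<lambda>t. partial_deriv i f (x(i := t)) * e (x(i := t)) - \<i> * \<xi> i * (f (x(i := t)) * e (x(i := t))))"
        unfolding e by (intro continuous_intros cont test_function_continuous test_function_partial_deriv f i)
    qed fact
  qed
  also have "\<dots> = 0" by simp
  finally have "(LINT x|leb {1..n}. partial_deriv i f x * e x) = \<i> * \<xi> i * (LINT x|leb {1..n}. f x * e x)"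
    using int by simp
  then show ?thesis unfolding fourier_def e_def by simp
qed

lemma fourier_bounded:
  "cmod (fourier n f \<xi>) \<le> (2 * pi) powr (- (real n / 2)) * (LINT x|leb {1..n}. cmod (f x))"
proof -
  have "cmod (LINT x|leb {1..n}. f x * exp (- (\<i> * complex_of_real (dot n \<xi> x))))
      \<le> (LINT x|leb {1..n}. cmod (f x * exp (- (\<i> * complex_of_real (dot n \<xi> x)))))"
    by (rule integral_norm_bound)
  then show ?thesis
    unfolding fourier_def by (simp add: norm_mult norm_exp_ii mult_left_mono del: of_real_sum)
qed

text \<open>
  The product \<open>\<xi>\<^sub>i\<^sup>2 \<bar>fourier f\<bar>\<close> is the modulus of the Fourier transform of the second derivative of \<open>f\<close>,
  which is again a test function.  So each factor \<open>1 + \<xi>\<^sub>i\<^sup>2\<close> splits one bound into two of the same kind.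
\<close>

lemma fourier_decay:
  assumes "test_function n f" "set is \<subseteq> {1..n}"
  shows "\<exists>C. \<forall>\<xi>. cmod (fourier n f \<xi>) * (\<Prod>i\<leftarrow>is. 1 + (\<xi> i)\<^sup>2) \<le> C"
  using assms
proof (induction "is" arbitrary: f)
  case Nil
  then show ?case using fourier_bounded by auto
next
  case (Cons i "is")
  let ?g = "partial_deriv i (partial_deriv i f)"
  have i: "i \<in> {1..n}" using Cons by simp
  have g: "test_function n ?g" using Cons.prems(1) i by (intro test_function_partial_deriv)
  obtain C1 C2 where C: "\<And>\<xi>. cmod (fourier n f \<xi>) * (\<Prod>i\<leftarrow>is. 1 + (\<xi> i)\<^sup>2) \<le> C1"
    "\<And>\<xi>. cmod (fourier n ?g \<xi>) * (\<Prod>i\<leftarrow>is. 1 + (\<xi> i)\<^sup>2) \<le> C2"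
    using Cons.IH[OF Cons.prems(1)] Cons.IH[OF g] Cons.prems(2) by auto
  have "cmod (fourier n ?g \<xi>) = (\<xi> i)\<^sup>2 * cmod (fourier n f \<xi>)" for \<xi>
    using Cons.prems(1) i
    by (simp add: fourier_partial_deriv test_function_partial_deriv norm_mult power2_eq_square abs_mult[symmetric])
  then have "cmod (fourier n f \<xi>) * (\<Prod>i\<leftarrow>i # is. 1 + (\<xi> i)\<^sup>2) \<le> C1 + C2" for \<xi>
    using add_mono[OF C(1)[of \<xi>] C(2)[of \<xi>]] by (simp add: algebra_simps)
  then show ?case by blast
qed

lemma fourier_measurable:
  assumes [measurable]: "f \<in> borel_measurable (leb {1..n})"
  shows "fourier n f \<in> borel_measurable (leb {1..n})" "inv_fourier n f \<in> borel_measurable (leb {1..n})"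
proof -
  interpret sigma_finite_measure "leb {1..n}" by (rule sigma_finite_leb) simp
  have [measurable]: "(\<lambda>w. \<Sum>i=1..n. fst w i * snd w i) \<in> borel_measurable (leb {1..n} \<Otimes>\<^sub>M leb {1..n})"
    by (intro borel_measurable_sum borel_measurable_times) measurable
  have [measurable]: "(\<lambda>w. \<Sum>i=1..n. snd w i * fst w i) \<in> borel_measurable (leb {1..n} \<Otimes>\<^sub>M leb {1..n})"
    by (intro borel_measurable_sum borel_measurable_times) measurable
  have "(\<lambda>(\<xi>, x). f x * exp (- (\<i> * complex_of_real (dot n \<xi> x)))) \<in> borel_measurable (leb {1..n} \<Otimes>\<^sub>M leb {1..n})"
    "(\<lambda>(x, \<xi>). f \<xi> * exp (\<i> * complex_of_real (dot n \<xi> x))) \<in> borel_measurable (leb {1..n} \<Otimes>\<^sub>M leb {1..n})"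
    unfolding case_prod_beta' by measurable
  note * = this[THEN borel_measurable_lebesgue_integral]
  show "fourier n f \<in> borel_measurable (leb {1..n})"
    unfolding fourier_def[abs_def] by (intro borel_measurable_times borel_measurable_const *)
  show "inv_fourier n f \<in> borel_measurable (leb {1..n})"
    unfolding inv_fourier_def[abs_def] by (intro borel_measurable_times borel_measurable_const *)
qed

lemma integrable_inverse_one_plus_square: "integrable lborel (\<lambda>x::real. inverse (1 + x\<^sup>2))"
proof (rule integrableI_bounded)
  show "(\<lambda>x::real. inverse (1 + x\<^sup>2)) \<in> borel_measurable lborel" by simp
  have le: "ennreal (norm (inverse (1 + x\<^sup>2))) \<le> indicator {-1..1} x + ennreal (x powr (-2)) * indicator {1..} x
      + ennreal ((-x) powr (-2)) * indicator {1..} (-x)" for x :: real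
  proof -
    consider "x \<in> {-1..1}" | "x > 1" | "x < -1" by fastforce
    then show ?thesis
    proof cases
      case 1
      have "inverse (1 + x\<^sup>2) \<le> 1" by (simp add: field_simps add_pos_nonneg)
      then have "ennreal (norm (inverse (1 + x\<^sup>2))) \<le> 1" by (simp add: ennreal_le_1)
      then show ?thesis using 1 by (simp add: add.assoc add_increasing2)
    next
      case 2
      then have "inverse (1 + x\<^sup>2) \<le> x powr (-2)" by (simp add: powr_minus powr_numeral le_imp_inverse_le)
      then show ?thesis using 2 by (simp add: ennreal_leI)
    next
      case 3
      then have "inverse (1 + x\<^sup>2) \<le> (-x) powr (-2)" by (simp add: powr_minus powr_numeral le_imp_inverse_le)
      then show ?thesis using 3 by (simp add: ennreal_leI)
    qed
  qed
  have tail: "(\<integral>\<^sup>+x. ennreal (x powr (-2)) * indicator {1..} x \<partial>lborel) = 1"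
    using nn_integral_powr_near_infinity[of "-2" 1] by simp
  have "(\<integral>\<^sup>+x. ennreal ((-x) powr (-2)) * indicator {1..} (-x) \<partial>lborel) = 1"
    using nn_integral_real_affine[of "\<lambda>x. ennreal (x powr (-2)) * indicator {1..} x" "-1" 0] tail by simp
  then have "(\<integral>\<^sup>+x. indicator {-1..1} x + ennreal (x powr (-2)) * indicator {1..} x
      + ennreal ((-x) powr (-2)) * indicator {1..} (-x) \<partial>lborel) < \<infinity>"
    using tail by (simp add: nn_integral_add)
  then show "(\<integral>\<^sup>+x. ennreal (norm (inverse (1 + x\<^sup>2 :: real))) \<partial>lborel) < \<infinity>"
    by (rule le_less_trans[OF nn_integral_mono[OF le]])
qed

text \<open>
  One factor \<open>\<Prod>\<^sub>i (1 + \<xi>\<^sub>i\<^sup>2)\<close> more than needed for boundedness leaves an integrable majorant.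
\<close>

lemma integrable_weighted_fourier:
  assumes f: "test_function n f" and [measurable]: "m \<in> borel_measurable (leb {1..n})"
    and m: "\<And>\<xi>. cmod (m \<xi>) \<le> (\<Prod>i\<in>{1..n}. 1 + (\<xi> i)\<^sup>2) ^ L"
  shows "integrable (leb {1..n}) (\<lambda>\<xi>. m \<xi> * fourier n f \<xi>)"
proof -
  interpret product_sigma_finite "\<lambda>_ :: nat. lborel :: real measure" by (rule product_sigma_finite_lborel)
  note fourier_measurable(1)[OF test_function_measurable[OF f], measurable]
  let ?w = "\<lambda>\<xi> :: nat \<Rightarrow> real. \<Prod>i\<in>{1..n}. 1 + (\<xi> i)\<^sup>2"
  let ?is = "concat (replicate (Suc L) [1..<Suc n])"
  have eq: "(\<Prod>i\<leftarrow>concat (replicate M [1..<Suc n]). 1 + (\<xi> i)\<^sup>2) = ?w \<xi> ^ M" for \<xi> :: "nat \<Rightarrow> real" and M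
    by (induction M) (simp_all add: prod.distinct_set_conv_list[symmetric] atLeastLessThanSuc_atLeastAtMost del: upt_Suc)
  have "set ?is \<subseteq> {1..n}" by auto
  from fourier_decay[OF f this] obtain C
    where "\<And>\<xi>. cmod (fourier n f \<xi>) * (\<Prod>i\<leftarrow>?is. 1 + (\<xi> i)\<^sup>2) \<le> C" by blast
  then have C: "\<And>\<xi>. cmod (fourier n f \<xi>) * ?w \<xi> ^ Suc L \<le> C" unfolding eq .
  have w: "?w \<xi> > 0" for \<xi> by (intro prod_pos) (auto intro: add_pos_nonneg)
  have "integrable (leb {1..n}) (\<lambda>\<xi>. C * (\<Prod>i\<in>{1..n}. inverse (1 + (\<xi> i)\<^sup>2)))"
    by (intro integrable_mult_right product_integrable_prod integrable_inverse_one_plus_square) auto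
  then show ?thesis
  proof (rule Bochner_Integration.integrable_bound)
    show "AE \<xi> in leb {1..n}. norm (m \<xi> * fourier n f \<xi>) \<le> norm (C * (\<Prod>i\<in>{1..n}. inverse (1 + (\<xi> i)\<^sup>2)))"
    proof (rule AE_I2)
      fix \<xi>
      have "norm (m \<xi> * fourier n f \<xi>) \<le> ?w \<xi> ^ L * cmod (fourier n f \<xi>)"
        unfolding norm_mult by (intro mult_right_mono m) simp
      also have "\<dots> = (cmod (fourier n f \<xi>) * ?w \<xi> ^ Suc L) * inverse (?w \<xi>)"
      proof -
        have "W ^ L * c = (c * W ^ Suc L) * inverse W" if "W > 0" for W c :: real
          using that by (simp add: field_simps)
        from this[OF w] show ?thesis .
      qed
      also have "\<dots> \<le> C * inverse (?w \<xi>)"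
        using w[of \<xi>] by (intro mult_right_mono C) simp
      also have "\<dots> \<le> norm (C * (\<Prod>i\<in>{1..n}. inverse (1 + (\<xi> i)\<^sup>2)))"
        using prod_inversef[of "\<lambda>i. 1 + (\<xi> i)\<^sup>2" "{1..n}"] by (simp add: comp_def)
      finally show "norm (m \<xi> * fourier n f \<xi>) \<le> norm (C * (\<Prod>i\<in>{1..n}. inverse (1 + (\<xi> i)\<^sup>2)))" .
    qed
  qed measurable
qed

section \<open>Gaussians and Fourier inversion\<close>

lemma integrable_pair_bound:
  fixes F :: "'a \<times> 'b \<Rightarrow> complex" and f :: "'a \<Rightarrow> complex" and h :: "'b \<Rightarrow> complex"
  assumes "sigma_finite_measure M1" "sigma_finite_measure M2"
    and f: "integrable M1 f" and h: "integrable M2 h"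
    and F [measurable]: "F \<in> borel_measurable (M1 \<Otimes>\<^sub>M M2)"
    and le: "\<And>x y. x \<in> space M1 \<Longrightarrow> y \<in> space M2 \<Longrightarrow> cmod (F (x, y)) \<le> cmod (f x) * cmod (h y)"
  shows "integrable (M1 \<Otimes>\<^sub>M M2) F"
proof (rule integrableI_bounded[OF F])
  interpret M2: sigma_finite_measure M2 by fact
  note [measurable] = borel_measurable_integrable[OF f] borel_measurable_integrable[OF h]
  have "(\<integral>\<^sup>+w. ennreal (norm (F w)) \<partial>(M1 \<Otimes>\<^sub>M M2)) = (\<integral>\<^sup>+x. (\<integral>\<^sup>+y. ennreal (norm (F (x, y))) \<partial>M2) \<partial>M1)"
    by (rule M2.nn_integral_fst[symmetric]) measurable
  also have "\<dots> \<le> (\<integral>\<^sup>+x. (\<integral>\<^sup>+y. ennreal (norm (f x)) * ennreal (norm (h y)) \<partial>M2) \<partial>M1)"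
    by (intro nn_integral_mono) (simp add: ennreal_mult[symmetric] le)
  also have "\<dots> = (\<integral>\<^sup>+x. ennreal (norm (f x)) \<partial>M1) * (\<integral>\<^sup>+y. ennreal (norm (h y)) \<partial>M2)"
    by (simp add: nn_integral_cmult nn_integral_multc)
  also have "\<dots> < \<infinity>"
    using f h by (simp add: integrable_iff_bounded ennreal_mult_less_top)
  finally show "(\<integral>\<^sup>+w. ennreal (norm (F w)) \<partial>(M1 \<Otimes>\<^sub>M M2)) < \<infinity>" .
qed

text \<open>
  This is the characteristic function of the standard normal distribution, rescaled by \<open>sqrt (2 s)\<close>.
\<close>

lemma gaussian_fourier:
  fixes s \<eta> :: real
  assumes s: "s > 0"
  shows "integrable lborel (\<lambda>y. complex_of_real (exp (- s * y\<^sup>2)) * iexp (\<eta> * y))"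
    "(LINT y|lborel. complex_of_real (exp (- s * y\<^sup>2)) * iexp (\<eta> * y)) = sqrt (pi / s) * exp (- \<eta>\<^sup>2 / (4 * s))"
proof -
  let ?L = "LINT y|lborel. complex_of_real (exp (- s * y\<^sup>2)) * iexp (\<eta> * y)"
  define c where "c = sqrt (2 * s)"
  have c: "c > 0" "c\<^sup>2 = 2 * s" using s by (auto simp: c_def)
  let ?d = "\<lambda>x. complex_of_real (std_normal_density x) * iexp (\<eta> / c * x)"
  have char: "(LINT x|lborel. ?d x) = complex_of_real (exp (- (\<eta> / c)\<^sup>2 / 2))"
    using fun_cong[OF char_std_normal_distribution, of "\<eta> / c"]
    unfolding char_def by (subst (asm) integral_density) (auto simp: scaleR_conv_of_real)
  have "integrable lborel std_normal_density"
    using integrable_normal_moment[of 0 1 0] by simp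
  then have int: "integrable lborel ?d"
    by (rule Bochner_Integration.integrable_bound) (auto simp: norm_mult norm_exp_ii)
  have eq: "?d (0 + c * y) = complex_of_real (1 / sqrt (2 * pi)) * (complex_of_real (exp (- s * y\<^sup>2)) * iexp (\<eta> * y))" for y
    using c by (simp add: std_normal_density_def power_mult_distrib)
  have cancel: "complex_of_real (sqrt (2 * pi)) * (complex_of_real (1 / sqrt (2 * pi)) * z) = z" for z
    by simp
  have "integrable lborel (\<lambda>y. ?d (0 + c * y))"
    using c int by (subst lborel_integrable_real_affine_iff) auto
  then have "integrable lborel (\<lambda>y. complex_of_real (sqrt (2 * pi)) * ?d (0 + c * y))"
    by (rule integrable_mult_right)
  then show "integrable lborel (\<lambda>y. complex_of_real (exp (- s * y\<^sup>2)) * iexp (\<eta> * y))"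
    unfolding eq cancel .
  have "complex_of_real (exp (- (\<eta> / c)\<^sup>2 / 2)) = c *\<^sub>R (LINT y|lborel. ?d (0 + c * y))"
    using lborel_integral_real_affine[of c ?d 0] c char by simp
  also have "\<dots> = complex_of_real (c / sqrt (2 * pi)) * ?L"
    unfolding eq by (simp add: scaleR_conv_of_real)
  finally have "?L
      = complex_of_real (sqrt (2 * pi) / c * exp (- (\<eta> / c)\<^sup>2 / 2))"
    using c by (simp add: field_simps)
  also have "sqrt (2 * pi) / c = sqrt (pi / s)"
    unfolding c_def using s by (simp add: real_sqrt_divide[symmetric])
  also have "- (\<eta> / c)\<^sup>2 / 2 = - \<eta>\<^sup>2 / (4 * s)"
    using c by (simp add: power_divide)
  finally show "?L = sqrt (pi / s) * exp (- \<eta>\<^sup>2 / (4 * s))"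
    by simp
qed

lemma gaussian_fourier_prod:
  fixes s :: real
  assumes s: "s > 0" and I: "finite I"
  shows "integrable (leb I) (\<lambda>y. complex_of_real (\<Prod>i\<in>I. exp (- s * (y i)\<^sup>2)) * iexp (\<Sum>i\<in>I. \<eta> i * y i))"
    "(LINT y|leb I. complex_of_real (\<Prod>i\<in>I. exp (- s * (y i)\<^sup>2)) * iexp (\<Sum>i\<in>I. \<eta> i * y i))
      = (\<Prod>i\<in>I. sqrt (pi / s) * exp (- (\<eta> i)\<^sup>2 / (4 * s)))"
proof -
  interpret product_sigma_finite "\<lambda>_ :: nat. lborel :: real measure" by (rule product_sigma_finite_lborel)
  have eq: "complex_of_real (\<Prod>i\<in>I. exp (- s * (y i)\<^sup>2)) * iexp (\<Sum>i\<in>I. \<eta> i * y i)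
      = (\<Prod>i\<in>I. complex_of_real (exp (- s * (y i)\<^sup>2)) * iexp (\<eta> i * y i))" for y
    using I by (simp add: prod.distrib sum_distrib_left exp_sum)
  show "integrable (leb I) (\<lambda>y. complex_of_real (\<Prod>i\<in>I. exp (- s * (y i)\<^sup>2)) * iexp (\<Sum>i\<in>I. \<eta> i * y i))"
    unfolding eq using s by (intro product_integrable_prod I gaussian_fourier)
  show "(LINT y|leb I. complex_of_real (\<Prod>i\<in>I. exp (- s * (y i)\<^sup>2)) * iexp (\<Sum>i\<in>I. \<eta> i * y i))
      = (\<Prod>i\<in>I. sqrt (pi / s) * exp (- (\<eta> i)\<^sup>2 / (4 * s)))"
    unfolding eq
    by (subst product_integral_prod[OF I gaussian_fourier(1)[OF s]]) (simp only: gaussian_fourier(2)[OF s], simp)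
qed

definition affine_map :: "nat set \<Rightarrow> (nat \<Rightarrow> real) \<Rightarrow> (nat \<Rightarrow> real) \<Rightarrow> (nat \<Rightarrow> real) \<Rightarrow> nat \<Rightarrow> real" where
  "affine_map I c d x = (\<lambda>i\<in>I. c i + d i * x i)"

lemma measurable_affine_map [measurable]: "affine_map I c d \<in> leb I \<rightarrow>\<^sub>M leb I"
  unfolding affine_map_def[abs_def] by (intro measurable_restrict) measurable

text \<open>
  Both measures have the same values on boxes, by the one-dimensional change of variables.
\<close>

lemma leb_affine:
  assumes I: "finite I" and d: "\<And>i. i \<in> I \<Longrightarrow> d i \<noteq> 0"
  shows "leb I = density (distr (leb I) (leb I) (affine_map I c d)) (\<lambda>_. ennreal (\<Prod>i\<in>I. \<bar>d i\<bar>))"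
proof -
  interpret product_sigma_finite "\<lambda>_ :: nat. lborel :: real measure" by (rule product_sigma_finite_lborel)
  show ?thesis
  proof (rule PiM_eqI[OF I, symmetric])
    fix A :: "nat \<Rightarrow> real set" assume A: "\<And>i. i \<in> I \<Longrightarrow> A i \<in> sets lborel"
    have AI [measurable]: "PiE I A \<in> sets (leb I)" using I A by (intro sets_PiM_I_finite)
    have B: "(\<lambda>t. c i + d i * t) -` A i \<in> sets lborel" if "i \<in> I" for i
    proof -
      have "(\<lambda>t. c i + d i * t) \<in> borel \<rightarrow>\<^sub>M borel" by measurable
      then show ?thesis using measurable_sets[of "\<lambda>t. c i + d i * t" borel borel "A i"] A[OF that] by simp
    qed
    have "affine_map I c d -` PiE I A \<inter> space (leb I) = PiE I (\<lambda>i. (\<lambda>t. c i + d i * t) -` A i)"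
      by (auto simp: affine_map_def space_leb PiE_iff)
    then have "emeasure (density (distr (leb I) (leb I) (affine_map I c d)) (\<lambda>_. ennreal (\<Prod>i\<in>I. \<bar>d i\<bar>))) (PiE I A)
        = ennreal (\<Prod>i\<in>I. \<bar>d i\<bar>) * emeasure (leb I) (PiE I (\<lambda>i. (\<lambda>t. c i + d i * t) -` A i))"
      by (simp add: emeasure_density_const emeasure_distr)
    also have "\<dots> = ennreal (\<Prod>i\<in>I. \<bar>d i\<bar>) * (\<Prod>i\<in>I. emeasure lborel ((\<lambda>t. c i + d i * t) -` A i))"
      using I B by (simp add: emeasure_PiM)
    also have "\<dots> = (\<Prod>i\<in>I. ennreal \<bar>d i\<bar> * emeasure lborel ((\<lambda>t. c i + d i * t) -` A i))"
      by (simp add: prod.distrib prod_ennreal)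
    also have "\<dots> = (\<Prod>i\<in>I. emeasure lborel (A i))"
    proof (intro prod.cong refl)
      fix i assume i: "i \<in> I"
      have "emeasure lborel (A i) = emeasure (density (distr lborel borel (\<lambda>x. c i + d i * x)) (\<lambda>_. ennreal \<bar>d i\<bar>)) (A i)"
        using lborel_real_affine[OF d[OF i], of "c i"] by simp
      also have "\<dots> = ennreal \<bar>d i\<bar> * emeasure lborel ((\<lambda>t. c i + d i * t) -` A i)"
        using A[OF i] by (simp add: emeasure_density_const emeasure_distr)
      finally show "ennreal \<bar>d i\<bar> * emeasure lborel ((\<lambda>t. c i + d i * t) -` A i) = emeasure lborel (A i)" ..
    qed
    finally show "emeasure (density (distr (leb I) (leb I) (affine_map I c d)) (\<lambda>_. ennreal (\<Prod>i\<in>I. \<bar>d i\<bar>))) (PiE I A)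
      = (\<Prod>i\<in>I. emeasure lborel (A i))" .
  qed simp
qed

lemma nn_integral_leb_affine:
  assumes I: "finite I" and d: "\<And>i. i \<in> I \<Longrightarrow> d i \<noteq> 0" and [measurable]: "F \<in> borel_measurable (leb I)"
  shows "(\<integral>\<^sup>+x. F x \<partial>leb I) = ennreal (\<Prod>i\<in>I. \<bar>d i\<bar>) * (\<integral>\<^sup>+x. F (affine_map I c d x) \<partial>leb I)"
  by (subst leb_affine[where c=c, OF I d]) (simp_all add: nn_integral_density nn_integral_distr nn_integral_cmult)

lemma integral_leb_affine:
  fixes F :: "(nat \<Rightarrow> real) \<Rightarrow> complex"
  assumes I: "finite I" and d: "\<And>i. i \<in> I \<Longrightarrow> d i \<noteq> 0" and [measurable]: "F \<in> borel_measurable (leb I)"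
  shows "(LINT x|leb I. F x) = complex_of_real (\<Prod>i\<in>I. \<bar>d i\<bar>) * (LINT x|leb I. F (affine_map I c d x))"
  by (subst leb_affine[where c=c, OF I d])
    (simp_all add: integral_density integral_distr prod_nonneg scaleR_conv_of_real)

lemma AE_leb_neq:
  assumes I: "finite I" and i: "i \<in> I"
  shows "AE x in leb I. x i \<noteq> c"
proof -
  interpret product_sigma_finite "\<lambda>_ :: nat. lborel :: real measure" by (rule product_sigma_finite_lborel)
  have "emeasure (leb I) (PiE I (\<lambda>j. if j = i then {c} else UNIV)) = 0"
    using I i by (subst emeasure_PiM) (auto intro!: prod_zero bexI[of _ i])
  then have "PiE I (\<lambda>j. if j = i then {c} else UNIV) \<in> null_sets (leb I)"
    using I by (auto intro!: null_setsI sets_PiM_I_finite)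
  moreover have "{x \<in> space (leb I). \<not> x i \<noteq> c} \<subseteq> PiE I (\<lambda>j. if j = i then {c} else UNIV)"
    by (auto simp: space_leb PiE_iff extensional_def)
  ultimately show ?thesis by (rule AE_I')
qed

text \<open>
  Insert a Gaussian factor of width \<open>1 / \<epsilon>\<close> into the inversion integral.  Fubini's theorem then turns it
  into the mean of \<open>f(x + \<epsilon> z)\<close> against a fixed Gaussian in \<open>z\<close>.  As \<open>\<epsilon>\<close> tends to \<open>0\<close> both expressions
  converge by dominated convergence, the first since the Fourier transform of \<open>f\<close> is integrable, the
  second since \<open>f\<close> is bounded and continuous.
\<close>

lemma fourier_inversion:
  assumes f: "test_function n f" and x: "x \<in> Rn n"
  shows "inv_fourier n (fourier n f) x = f x"
proof -
  interpret product_sigma_finite "\<lambda>_ :: nat. lborel :: real measure" by (rule product_sigma_finite_lborel)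
  let ?I = "{1..n}"
  interpret L: sigma_finite_measure "leb ?I" by (rule sigma_finite_leb) simp
  interpret LL: pair_sigma_finite "leb ?I" "leb ?I" ..
  note f_meas [measurable] = test_function_measurable[OF f]
  define c0 where "c0 = complex_of_real ((2 * pi) powr (- (real n / 2)))"
  \<comment> \<open>The Gaussian \<open>G k\<close> has exponent \<open>\<epsilon>\<^sup>2 / 4\<close>, so that its transform is a Gaussian in \<open>(x - y) / \<epsilon>\<close>.\<close>
  define \<epsilon> where "\<epsilon> k = 1 / real (Suc k)" for k
  have \<epsilon>: "\<epsilon> k > 0" for k by (simp add: \<epsilon>_def)
  let ?s = "\<lambda>k. (\<epsilon> k)\<^sup>2 / 4"
  have \<epsilon>0: "\<epsilon> \<longlonglongrightarrow> 0"
    unfolding \<epsilon>_def using LIMSEQ_inverse_real_of_nat by (simp add: inverse_eq_divide)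
  define G where "G k \<xi> = (\<Prod>i\<in>?I. exp (- ?s k * (\<xi> i)\<^sup>2))" for k and \<xi> :: "nat \<Rightarrow> real"
  let ?E = "\<lambda>k \<xi> y. complex_of_real (G k \<xi>) * iexp (\<Sum>i\<in>?I. \<xi> i * (x i - y i))"
  let ?L = "\<lambda>k \<xi>. LINT y|leb ?I. f y * ?E k \<xi> y"
  define A where "A k = (LINT \<xi>|leb ?I. fourier n f \<xi> * iexp (dot n \<xi> x) * G k \<xi>)" for k
  have phase [measurable]: "(\<lambda>\<xi>. dot n \<xi> x) \<in> borel_measurable (leb ?I)"
    by (intro borel_measurable_sum) measurable
  have G_meas [measurable]: "G k \<in> borel_measurable (leb ?I)" for k unfolding G_def by measurable
  note fourier_measurable(1)[OF f_meas, measurable]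
  have int_fourier: "integrable (leb ?I) (fourier n f)"
    using integrable_weighted_fourier[OF f, of "\<lambda>_. 1" 0] by simp
  have lim1: "A \<longlonglongrightarrow> (LINT \<xi>|leb ?I. fourier n f \<xi> * iexp (dot n \<xi> x))"
    unfolding A_def
  proof (rule integral_dominated_convergence[where w="\<lambda>\<xi>. norm (fourier n f \<xi>)"])
    show "integrable (leb ?I) (\<lambda>\<xi>. norm (fourier n f \<xi>))" using int_fourier by simp
    show "AE \<xi> in leb ?I. (\<lambda>k. fourier n f \<xi> * iexp (dot n \<xi> x) * G k \<xi>) \<longlonglongrightarrow> fourier n f \<xi> * iexp (dot n \<xi> x)"
    proof (rule AE_I2)
      fix \<xi> :: "nat \<Rightarrow> real"
      have "(\<lambda>k. G k \<xi>) \<longlonglongrightarrow> (\<Prod>i\<in>?I. exp (- (0\<^sup>2 / 4) * (\<xi> i)\<^sup>2))"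
        unfolding G_def by (intro tendsto_intros \<epsilon>0) auto
      then have "(\<lambda>k. complex_of_real (G k \<xi>)) \<longlonglongrightarrow> complex_of_real 1"
        by (intro tendsto_of_real) simp
      from tendsto_mult[OF tendsto_const this]
      show "(\<lambda>k. fourier n f \<xi> * iexp (dot n \<xi> x) * G k \<xi>) \<longlonglongrightarrow> fourier n f \<xi> * iexp (dot n \<xi> x)"
        by simp
    qed
    fix k
    have "0 \<le> G k \<xi> \<and> G k \<xi> \<le> 1" for \<xi>
      unfolding G_def by (auto intro!: prod_nonneg prod_le_1)
    then show "AE \<xi> in leb ?I. norm (fourier n f \<xi> * iexp (dot n \<xi> x) * G k \<xi>) \<le> norm (fourier n f \<xi>)"
      by (intro AE_I2) (simp add: norm_mult norm_exp_ii mult_left_le del: of_real_sum)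
  qed measurable
  define D where "D k z = f (affine_map ?I x (\<lambda>_. \<epsilon> k) z) * (\<Prod>i\<in>?I. exp (- (z i)\<^sup>2))" for k and z :: "nat \<Rightarrow> real"
  have gauss1: "integrable (leb ?I) (\<lambda>z. complex_of_real (\<Prod>i\<in>?I. exp (- (z i)\<^sup>2)))"
    "(LINT z|leb ?I. complex_of_real (\<Prod>i\<in>?I. exp (- (z i)\<^sup>2))) = complex_of_real (sqrt pi ^ n)"
    using gaussian_fourier_prod[of 1 ?I "\<lambda>_. 0"] by (simp_all del: of_real_prod)
  have A_eq: "A k = c0 * complex_of_real ((2 * sqrt pi) ^ n) * (LINT z|leb ?I. D k z)" for k
  proof -
    have s: "?s k > 0" using \<epsilon>[of k] by simp
    have Gint: "integrable (leb ?I) (\<lambda>\<xi>. complex_of_real (G k \<xi>))"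
      using gaussian_fourier_prod(1)[OF s, of ?I "\<lambda>_. 0"] by (simp add: G_def del: of_real_prod)
    have [measurable]: "(\<lambda>w. \<Sum>i\<in>?I. fst w i * (x i - snd w i)) \<in> borel_measurable (leb ?I \<Otimes>\<^sub>M leb ?I)"
      by (intro borel_measurable_sum) measurable
    have pair_meas: "(\<lambda>(\<xi>, y). f y * ?E k \<xi> y)
        \<in> borel_measurable (leb ?I \<Otimes>\<^sub>M leb ?I)"
      unfolding case_prod_beta' by measurable
    have pair_int: "integrable (leb ?I \<Otimes>\<^sub>M leb ?I) (\<lambda>(\<xi>, y). f y * ?E k \<xi> y)"
      by (rule integrable_pair_bound[OF sigma_finite_leb sigma_finite_leb Gint integrable_test_function[OF f] pair_meas])
        (auto simp: norm_mult norm_exp_ii simp del: of_real_sum)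
    have "A k = (LINT \<xi>|leb ?I. c0 * ?L k \<xi>)"
      unfolding A_def
    proof (intro Bochner_Integration.integral_cong refl)
      fix \<xi> :: "nat \<Rightarrow> real"
      have E: "exp (- (\<i> * complex_of_real (dot n \<xi> y))) * iexp (dot n \<xi> x) = iexp (\<Sum>i\<in>?I. \<xi> i * (x i - y i))" for y
        by (simp add: exp_add[symmetric] algebra_simps sum_subtractf)
      have alg: "a * (g * e) = a * e1 * (e2 * g)" if "e1 * e2 = e" for a g e e1 e2 :: complex
        using that by (auto simp: mult_ac)
      have "f y * ?E k \<xi> y
        = f y * exp (- (\<i> * complex_of_real (dot n \<xi> y))) * (iexp (dot n \<xi> x) * G k \<xi>)" for y
        by (rule alg[OF E])
      then have "?L k \<xi>
          = (LINT y|leb ?I. f y * exp (- (\<i> * complex_of_real (dot n \<xi> y)))) * (iexp (dot n \<xi> x) * G k \<xi>)"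
        by (simp only: integral_mult_left_zero)
      then show "fourier n f \<xi> * iexp (dot n \<xi> x) * G k \<xi>
          = c0 * ?L k \<xi>"
        unfolding fourier_def c0_def by (simp only: mult.assoc)
    qed
    also have "\<dots> = c0 * (LINT \<xi>|leb ?I. ?L k \<xi>)"
      by simp
    also have "(LINT \<xi>|leb ?I. ?L k \<xi>)
        = (LINT y|leb ?I. (LINT \<xi>|leb ?I. f y * ?E k \<xi> y))"
      using LL.Fubini_integral[OF pair_int] by simp
    also have "\<dots> = (LINT y|leb ?I. f y * (\<Prod>i\<in>?I. sqrt (pi / ?s k) * exp (- (x i - y i)\<^sup>2 / (4 * ?s k))))"
    proof (intro Bochner_Integration.integral_cong refl)
      fix y
      show "(LINT \<xi>|leb ?I. f y * ?E k \<xi> y)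
          = f y * (\<Prod>i\<in>?I. sqrt (pi / ?s k) * exp (- (x i - y i)\<^sup>2 / (4 * ?s k)))"
        using gaussian_fourier_prod(2)[OF s, of ?I "\<lambda>i. x i - y i"]
        by (simp add: G_def mult.commute[of "x _ - y _"] del: of_real_prod of_real_sum)
    qed
    also have "\<dots> = complex_of_real (\<Prod>i\<in>?I. \<bar>\<epsilon> k\<bar>) * (LINT z|leb ?I. f (affine_map ?I x (\<lambda>_. \<epsilon> k) z) *
        (\<Prod>i\<in>?I. sqrt (pi / ?s k) * exp (- (x i - affine_map ?I x (\<lambda>_. \<epsilon> k) z i)\<^sup>2 / (4 * ?s k))))"
      using \<epsilon>[of k] by (intro integral_leb_affine) (simp, simp, measurable)
    also have "\<dots> = complex_of_real (\<Prod>i\<in>?I. \<bar>\<epsilon> k\<bar>) * (LINT z|leb ?I. complex_of_real (\<Prod>i\<in>?I. sqrt (pi / ?s k)) * D k z)"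
    proof -
      have P: "(\<Prod>i\<in>?I. sqrt (pi / ?s k) * exp (- (x i - affine_map ?I x (\<lambda>_. \<epsilon> k) z i)\<^sup>2 / (4 * ?s k)))
          = (\<Prod>i\<in>?I. sqrt (pi / ?s k) * exp (- (z i)\<^sup>2))" for z
        using \<epsilon>[of k] by (intro prod.cong refl) (simp add: affine_map_def power_mult_distrib)
      have "f (affine_map ?I x (\<lambda>_. \<epsilon> k) z) *
        (\<Prod>i\<in>?I. sqrt (pi / ?s k) * exp (- (x i - affine_map ?I x (\<lambda>_. \<epsilon> k) z i)\<^sup>2 / (4 * ?s k)))
        = complex_of_real (\<Prod>i\<in>?I. sqrt (pi / ?s k)) * D k z" for z
        unfolding P D_def by (simp add: prod.distrib mult_ac)
      then show ?thesis by (simp only:)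
    qed
    also have "\<dots> = complex_of_real (\<Prod>i\<in>?I. \<bar>\<epsilon> k\<bar> * sqrt (pi / ?s k)) * (LINT z|leb ?I. D k z)"
      by (simp add: prod.distrib power_mult_distrib)
    also have "\<bar>\<epsilon> k\<bar> * sqrt (pi / ?s k) = 2 * sqrt pi"
      using \<epsilon>[of k] by (simp add: real_sqrt_divide real_sqrt_mult field_simps)
    finally show ?thesis by (simp add: mult.assoc)
  qed
  obtain B where B: "\<And>x. x \<in> Rn n \<Longrightarrow> cmod (f x) \<le> B" "B \<ge> 0"
    using test_function_bounded[OF f] by metis
  have aff: "affine_map ?I x (\<lambda>_. e) z \<in> Rn n" for e z by (auto simp: affine_map_def)
  have "(\<lambda>k. LINT z|leb ?I. D k z) \<longlonglongrightarrow> (LINT z|leb ?I. f x * complex_of_real (\<Prod>i\<in>?I. exp (- (z i)\<^sup>2)))"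
  proof (rule integral_dominated_convergence[where w="\<lambda>z. B * norm (complex_of_real (\<Prod>i\<in>?I. exp (- (z i)\<^sup>2)))"])
    show "integrable (leb ?I) (\<lambda>z. B * norm (complex_of_real (\<Prod>i\<in>?I. exp (- (z i)\<^sup>2))))"
      using gauss1 by (intro integrable_mult_right integrable_norm)
    show "AE z in leb ?I. (\<lambda>k. D k z) \<longlonglongrightarrow> f x * complex_of_real (\<Prod>i\<in>?I. exp (- (z i)\<^sup>2))"
    proof (rule AE_I2)
      fix z :: "nat \<Rightarrow> real"
      have cont: "continuous_on UNIV (\<lambda>e. f (affine_map ?I x (\<lambda>_. e) z))"
      proof (rule continuous_on_compose2[OF test_function_continuous[OF f]])
        show "continuous_on UNIV (\<lambda>e. affine_map ?I x (\<lambda>_. e) z)"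
        proof (rule continuous_on_coordinatewise_then_product)
          fix i show "continuous_on UNIV (\<lambda>e. affine_map ?I x (\<lambda>_. e) z i)"
            by (cases "i \<in> ?I") (auto simp: affine_map_def restrict_def intro!: continuous_intros)
        qed
      qed (use aff in auto)
      have "affine_map ?I x (\<lambda>_. 0) z = x" using x by (auto simp: affine_map_def PiE_iff extensional_def restrict_def)
      then have "(\<lambda>k. f (affine_map ?I x (\<lambda>_. \<epsilon> k) z)) \<longlonglongrightarrow> f x"
        using continuous_on_tendsto_compose[OF cont \<epsilon>0] by simp
      then show "(\<lambda>k. D k z) \<longlonglongrightarrow> f x * complex_of_real (\<Prod>i\<in>?I. exp (- (z i)\<^sup>2))"
        unfolding D_def by (intro tendsto_mult tendsto_const)
    qed
    show "AE z in leb ?I. norm (D k z) \<le> B * norm (complex_of_real (\<Prod>i\<in>?I. exp (- (z i)\<^sup>2)))" for k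
      unfolding D_def norm_mult using B aff by (intro AE_I2 mult_right_mono) auto
    show "D k \<in> borel_measurable (leb ?I)" for k
      unfolding D_def using measurable_compose[OF measurable_affine_map f_meas] by (simp del: of_real_prod)
  qed measurable
  then have "A \<longlonglongrightarrow> c0 * complex_of_real ((2 * sqrt pi) ^ n) * (LINT z|leb ?I. f x * complex_of_real (\<Prod>i\<in>?I. exp (- (z i)\<^sup>2)))"
    unfolding A_eq by (intro tendsto_mult tendsto_const)
  from LIMSEQ_unique[OF lim1 this]
  have L: "(LINT \<xi>|leb ?I. fourier n f \<xi> * iexp (dot n \<xi> x))
      = c0 * complex_of_real ((2 * sqrt pi) ^ n) * (f x * complex_of_real (sqrt pi ^ n))"
    by (simp only: integral_mult_right_zero gauss1(2))
  have "inv_fourier n (fourier n f) x = c0 * (c0 * complex_of_real ((2 * sqrt pi) ^ n) * (f x * complex_of_real (sqrt pi ^ n)))"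
    unfolding inv_fourier_def c0_def[symmetric] L ..
  also have "\<dots> = (c0 * c0 * complex_of_real ((2 * pi) ^ n)) * f x"
  proof -
    have "(2 * sqrt pi) ^ n * sqrt pi ^ n = (2 * pi) ^ n"
      unfolding power_mult_distrib[symmetric] by (simp only: mult.assoc real_sqrt_mult_self abs_of_pos pi_gt_zero)
    then have E: "complex_of_real ((2 * pi) ^ n) = complex_of_real ((2 * sqrt pi) ^ n) * complex_of_real (sqrt pi ^ n)"
      by (simp only: of_real_mult[symmetric])
    show ?thesis unfolding E by (simp only: mult_ac)
  qed
  also have "c0 * c0 * complex_of_real ((2 * pi) ^ n) = 1"
  proof -
    have "(2 * pi) powr (- (real n / 2)) * (2 * pi) powr (- (real n / 2)) * (2 * pi) ^ n = (1::real)"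
    proof -
      have "(2 * pi) ^ n = (2 * pi) powr real n" by (rule powr_realpow[symmetric]) simp
      then show ?thesis by (simp only: powr_add[symmetric]) simp
    qed
    then show ?thesis unfolding c0_def by (metis of_real_1 of_real_mult)
  qed
  finally show ?thesis by simp
qed

section \<open>The Riesz potential\<close>

lemma nn_integral_Gamma_scaled:
  fixes a r :: real
  assumes a: "a > 0" and r: "r > 0"
  shows "(\<integral>\<^sup>+t. ennreal (indicator {0<..} t * t powr (a - 1) * exp (- t * r)) \<partial>lborel) = ennreal (Gamma a * r powr (- a))"
proof -
  let ?I = "\<integral>\<^sup>+t. ennreal (indicator {0<..} t * t powr (a - 1) * exp (- t * r)) \<partial>lborel"
  have "ennreal (Gamma a) = (\<integral>\<^sup>+t. ennreal (indicator {0..} t * t powr (a - 1) / exp t) \<partial>lborel)"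
    using Gamma_conv_nn_integral_real[OF a] .
  also have "\<dots> = ennreal \<bar>r\<bar> * (\<integral>\<^sup>+t. ennreal (indicator {0..} (0 + r * t) * (0 + r * t) powr (a - 1) / exp (0 + r * t)) \<partial>lborel)"
    using r by (intro nn_integral_real_affine) auto
  also have "\<dots> = ennreal r * (\<integral>\<^sup>+t. ennreal (r powr (a - 1)) * ennreal (indicator {0<..} t * t powr (a - 1) * exp (- t * r)) \<partial>lborel)"
    using r by (intro arg_cong2[where f="(*)"] nn_integral_cong)
      (auto simp: indicator_def zero_le_mult_iff powr_mult exp_minus field_simps ennreal_mult[symmetric])
  also have "\<dots> = ennreal (r powr a) * ?I"
  proof -
    have "ennreal r * ennreal (r powr (a - 1)) = ennreal (r powr a)"
      using r by (simp add: ennreal_mult[symmetric] powr_diff)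
    then show ?thesis by (subst nn_integral_cmult) (simp_all only: mult.assoc[symmetric], measurable)
  qed
  finally have "ennreal (Gamma a) = ennreal (r powr a) * ?I" .
  then have "ennreal (r powr (- a)) * ennreal (Gamma a)
      = (ennreal (r powr (- a)) * ennreal (r powr a)) * ?I"
    by (simp only: mult.assoc)
  then show ?thesis
    using r a by (simp add: ennreal_mult[symmetric] powr_add[symmetric] mult.commute Gamma_real_nonneg)
qed

lemma powr_le_exp:
  fixes b u :: real
  assumes "b > 0" "u > 0" shows "u powr b \<le> b powr b * exp u"
proof -
  have "ln (u / b) \<le> u / b - 1" using assms by (intro ln_le_minus_one) simp
  then have "b * ln (u / b) \<le> b * (u / b)" using assms by (intro mult_left_mono) auto
  then have "b * ln u \<le> b * ln b + u" using assms by (simp add: ln_div algebra_simps)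
  then have "exp (b * ln u) \<le> exp (b * ln b + u)" by simp
  then show ?thesis using assms by (simp add: powr_def exp_add)
qed

text \<open>
  The substitution \<open>t = \<rho> s\<close> extracts the power of \<open>\<rho>\<close>.  The remaining integral converges at infinity since
  \<open>b > 0\<close>, and near \<open>0\<close> because the exponential beats any power.
\<close>

lemma nn_integral_heat_kernel_time:
  fixes b :: real
  assumes b: "b > 0"
  shows "\<exists>C\<ge>0. \<forall>\<rho>>0. (\<integral>\<^sup>+t. ennreal (indicator {0<..} t * t powr (- b - 1) * exp (- \<rho> / (4 * t))) \<partial>lborel)
    = ennreal (C * \<rho> powr (- b))"
proof -
  define I where "I = (\<integral>\<^sup>+t. ennreal (indicator {0<..} t * t powr (- b - 1) * exp (- 1 / (4 * t))) \<partial>lborel)"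
  \<comment> \<open>\<open>c\<close> bounds the integrand on the unit interval, by \<open>powr_le_exp\<close> with \<open>u = 1 / (4 t)\<close>.\<close>
  define c where "c = 4 powr (b + 1) * (b + 1) powr (b + 1)"
  have "ennreal (indicator {0<..} t * t powr (- b - 1) * exp (- 1 / (4 * t)))
      \<le> ennreal c * indicator {0..1} t + ennreal (t powr (- b - 1)) * indicator {1..} t" for t :: real
  proof -
    consider "t \<le> 0" | "0 < t" "t < 1" | "1 \<le> t" by linarith
    then show ?thesis
    proof cases
      case 2
      define u where "u = 1 / (4 * t)"
      have u: "u > 0" "t = 1 / (4 * u)" using 2 by (auto simp: u_def)
      have "t powr (- b - 1) = (4 * u) powr (b + 1)"
        using u powr_minus_divide[of "1 / (4 * u)" "b + 1"] by (simp add: powr_divide)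
      also have "\<dots> \<le> 4 powr (b + 1) * ((b + 1) powr (b + 1) * exp u)"
        using u b powr_le_exp[of "b + 1" u] by (simp add: powr_mult)
      finally have "t powr (- b - 1) * exp (- u) \<le> 4 powr (b + 1) * ((b + 1) powr (b + 1) * exp u) * exp (- u)"
        by (rule mult_right_mono) simp
      also have "\<dots> = c" by (simp add: c_def exp_minus field_simps)
      finally show ?thesis using 2 by (simp add: u_def ennreal_leI)
    next
      case 3
      have "t powr (- b - 1) * exp (- 1 / (4 * t)) \<le> t powr (- b - 1) * 1"
        using 3 by (intro mult_left_mono) auto
      then show ?thesis using 3 by (simp add: ennreal_leI add_increasing)
    qed simp
  qed
  then have "I \<le> (\<integral>\<^sup>+t. ennreal c * indicator {0..1} t + ennreal (t powr (- b - 1)) * indicator {1..} t \<partial>lborel)"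
    unfolding I_def by (intro nn_integral_mono)
  also have "\<dots> < \<infinity>"
    using b nn_integral_powr_near_infinity[of "- b - 1" 1]
    by (simp add: nn_integral_add nn_integral_cmult_indicator ennreal_mult_less_top)
  finally obtain C where C: "I = ennreal C" "C \<ge> 0" by (cases I) auto
  show ?thesis
  proof (intro exI[of _ C] conjI allI impI)
    fix \<rho> :: real assume \<rho>: "\<rho> > 0"
    have "(\<integral>\<^sup>+t. ennreal (indicator {0<..} t * t powr (- b - 1) * exp (- \<rho> / (4 * t))) \<partial>lborel)
      = ennreal \<bar>\<rho>\<bar> * (\<integral>\<^sup>+t. ennreal (indicator {0<..} (0 + \<rho> * t) * (0 + \<rho> * t) powr (- b - 1) * exp (- \<rho> / (4 * (0 + \<rho> * t)))) \<partial>lborel)"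
      using \<rho> by (intro nn_integral_real_affine) auto
    also have "\<dots> = ennreal \<rho> * (\<integral>\<^sup>+t. ennreal (\<rho> powr (- b - 1)) * ennreal (indicator {0<..} t * t powr (- b - 1) * exp (- 1 / (4 * t))) \<partial>lborel)"
      using \<rho> by (intro arg_cong2[where f="(*)"] nn_integral_cong)
        (auto simp: indicator_def zero_less_mult_iff powr_mult ennreal_mult[symmetric])
    also have "\<dots> = ennreal (\<rho> * \<rho> powr (- b - 1)) * I"
    proof -
      have "ennreal \<rho> * ennreal (\<rho> powr (- b - 1)) = ennreal (\<rho> * \<rho> powr (- b - 1))"
        using \<rho> by (simp add: ennreal_mult)
      then show ?thesis unfolding I_def by (subst nn_integral_cmult) (simp_all only: mult.assoc[symmetric], measurable)
    qed
    also have "\<rho> * \<rho> powr (- b - 1) = \<rho> powr (- b)" using \<rho> by (simp add: powr_diff)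
    finally show "(\<integral>\<^sup>+t. ennreal (indicator {0<..} t * t powr (- b - 1) * exp (- \<rho> / (4 * t))) \<partial>lborel)
        = ennreal (C * \<rho> powr (- b))"
      using C by (simp add: ennreal_mult mult.commute)
  qed (use C in auto)
qed

definition translate :: "nat \<Rightarrow> (nat \<Rightarrow> real) \<Rightarrow> (nat \<Rightarrow> real) \<Rightarrow> nat \<Rightarrow> real" where
  "translate K x y = (\<lambda>i. if i \<in> {1..K} then x i - y i else x i)"

lemma measurable_translate:
  assumes "K \<le> n" "x \<in> Rn n" shows "translate K x \<in> leb {1..K} \<rightarrow>\<^sub>M leb {1..n}"
  unfolding translate_def[abs_def]
proof (rule measurable_PiM_single')
  fix i assume "i \<in> {1..n}"
  show "(\<lambda>y. if i \<in> {1..K} then x i - y i else x i) \<in> leb {1..K} \<rightarrow>\<^sub>M lborel"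
  proof (cases "i \<in> {1..K}")
    case True
    then have "(\<lambda>y. x i - y i) \<in> leb {1..K} \<rightarrow>\<^sub>M lborel" by measurable
    then show ?thesis using True by (simp only: if_True)
  next
    case False
    have "(\<lambda>y :: nat \<Rightarrow> real. x i) \<in> leb {1..K} \<rightarrow>\<^sub>M lborel" by simp
    then show ?thesis using False by (simp only: if_False)
  qed
qed (use assms in \<open>auto simp: PiE_iff extensional_def\<close>)

lemma sum_translate:
  assumes "K \<le> n"
  shows "(dot n \<xi> (translate K x y)) = (dot n \<xi> x) + (\<Sum>i=1..K. - \<xi> i * y i)"
proof -
  have "(dot n \<xi> (translate K x y)) = (\<Sum>i=1..n. \<xi> i * x i + (if i \<in> {1..K} then - \<xi> i * y i else 0))"
    by (intro sum.cong refl) (auto simp: translate_def algebra_simps)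
  also have "\<dots> = (dot n \<xi> x) + (\<Sum>i\<in>{1..n} \<inter> {1..K}. - \<xi> i * y i)"
    by (simp only: sum.distrib sum.inter_restrict[OF finite_atLeastAtMost])
  also have "{1..n} \<inter> {1..K} = {1..K}" using assms by auto
  finally show ?thesis .
qed

text \<open>
  The Gaussian \<open>exp (- t \<bar>\<xi>\<bar>\<^sup>2)\<close> in the first \<open>K\<close> variables is the Fourier transform of the heat kernel, so
  multiplying \<open>\<psi>\<close> by it convolves the inverse transform of \<open>\<psi>\<close> with that kernel in these variables.
\<close>

lemma heat_kernel_bound:
  fixes \<psi> :: "(nat \<Rightarrow> real) \<Rightarrow> complex"
  assumes \<psi>: "integrable (leb {1..n}) \<psi>" and K: "K \<le> n" and x: "x \<in> Rn n" and t: "t > 0"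
  shows "ennreal ((2 * pi) powr (- (real n / 2)) *
      cmod (LINT \<xi>|leb {1..n}. \<psi> \<xi> * iexp (dot n \<xi> x) * complex_of_real (exp (- t * (sq_norm K \<xi>)))))
    \<le> (\<integral>\<^sup>+y. ennreal ((4 * pi * t) powr (- (real K / 2)) * exp (- (sq_norm K y) / (4 * t)))
          * ennreal (cmod (inv_fourier n \<psi> (translate K x y))) \<partial>leb {1..K})"
proof -
  let ?X = "\<lambda>\<xi>. exp (- t * (sq_norm K \<xi>))"
  let ?I = "{1..n}" and ?J = "{1..K}"
  interpret I: sigma_finite_measure "leb ?I" by (rule sigma_finite_leb) simp
  interpret J: sigma_finite_measure "leb ?J" by (rule sigma_finite_leb) simp
  interpret IJ: pair_sigma_finite "leb ?I" "leb ?J" ..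
  note \<psi>_meas [measurable] = borel_measurable_integrable[OF \<psi>]
  define c0 where "c0 = (2 * pi) powr (- (real n / 2))"
  have c0: "c0 > 0" by (simp add: c0_def)
  define G where "G y = (\<Prod>i\<in>?J. exp (- (1 / (4 * t)) * (y i)\<^sup>2))" for y :: "nat \<Rightarrow> real"
  define S where "S = (4 * pi * t) powr (real K / 2)"
  have s: "1 / (4 * t) > 0" using t by simp
  have S: "S > 0" using t by (simp add: S_def)
  have G_nonneg: "G y \<ge> 0" for y unfolding G_def by (intro prod_nonneg) simp
  have G_exp: "G y = exp (- (sq_norm K y) / (4 * t))" for y
    unfolding G_def by (simp add: exp_sum[symmetric] sum_negf sum_divide_distrib)
  have [measurable]: "G \<in> borel_measurable (leb ?J)" unfolding G_def by measurable
  have G_int: "integrable (leb ?J) (\<lambda>y. complex_of_real (G y))"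
    using gaussian_fourier_prod(1)[OF s, of ?J "\<lambda>_. 0"] by (simp add: G_def del: of_real_prod)
  have G_fourier: "(LINT y|leb ?J. complex_of_real (G y) * iexp (\<Sum>i=1..K. - \<xi> i * y i))
      = complex_of_real (S * exp (- t * (sq_norm K \<xi>)))" for \<xi>
  proof -
    have "(\<Prod>i\<in>?J. sqrt (pi / (1 / (4 * t))) * exp (- (- \<xi> i)\<^sup>2 / (4 * (1 / (4 * t)))))
        = sqrt (4 * pi * t) ^ K * (\<Prod>i\<in>?J. exp (- t * (\<xi> i)\<^sup>2))"
      by (simp add: prod.distrib mult_ac)
    also have "sqrt (4 * pi * t) ^ K = S"
      using t by (simp add: S_def powr_half_sqrt[symmetric] powr_powr powr_realpow[symmetric])
    also have "(\<Prod>i\<in>?J. exp (- t * (\<xi> i)\<^sup>2)) = exp (- t * (sq_norm K \<xi>))"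
      by (simp add: exp_sum[symmetric] sum_distrib_left sum_negf)
    finally show ?thesis
      using gaussian_fourier_prod(2)[OF s finite_atLeastAtMost, of 1 K "\<lambda>i. - \<xi> i"]
      unfolding G_def by (simp only:)
  qed
  have [measurable]: "(\<lambda>\<xi>. dot n \<xi> x) \<in> borel_measurable (leb ?I)"
    by (intro borel_measurable_sum) measurable
  have [measurable]: "(\<lambda>w. \<Sum>i=1..K. - fst w i * snd w i) \<in> borel_measurable (leb ?I \<Otimes>\<^sub>M leb ?J)"
    using K by (intro borel_measurable_sum borel_measurable_times borel_measurable_uminus) measurable
  define F where "F \<xi> y = complex_of_real (G y) * (\<psi> \<xi> * iexp (dot n \<xi> (translate K x y)))" for \<xi> y
  have F: "F \<xi> y = \<psi> \<xi> * iexp (dot n \<xi> x) * (complex_of_real (G y) * iexp (\<Sum>i=1..K. - \<xi> i * y i))" for \<xi> y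
  proof -
    have "iexp (dot n \<xi> (translate K x y)) = iexp (dot n \<xi> x) * iexp (\<Sum>i=1..K. - \<xi> i * y i)"
      unfolding sum_translate[OF K] of_real_add distrib_left exp_add ..
    then show ?thesis unfolding F_def by (simp only: mult_ac)
  qed
  have F_meas: "(\<lambda>(\<xi>, y). F \<xi> y) \<in> borel_measurable (leb ?I \<Otimes>\<^sub>M leb ?J)"
    unfolding F case_prod_beta' by measurable
  have F_int: "integrable (leb ?I \<Otimes>\<^sub>M leb ?J) (\<lambda>(\<xi>, y). F \<xi> y)"
    by (rule integrable_pair_bound[OF sigma_finite_leb sigma_finite_leb \<psi> G_int F_meas])
      (auto simp: F_def norm_mult norm_exp_ii simp del: of_real_sum)
  have inner: "complex_of_real c0 * (LINT \<xi>|leb ?I. F \<xi> y) = complex_of_real (G y) * inv_fourier n \<psi> (translate K x y)" for y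
    unfolding F_def inv_fourier_def c0_def integral_mult_right_zero by (rule mult.left_commute)
  have "(LINT \<xi>|leb ?I. (LINT y|leb ?J. F \<xi> y))
      = (LINT \<xi>|leb ?I. complex_of_real S * (\<psi> \<xi> * iexp (dot n \<xi> x) * complex_of_real (?X \<xi>)))"
  proof (intro Bochner_Integration.integral_cong refl)
    fix \<xi>
    show "(LINT y|leb ?J. F \<xi> y)
        = complex_of_real S * (\<psi> \<xi> * iexp (dot n \<xi> x) * complex_of_real (?X \<xi>))"
      unfolding F integral_mult_right_zero G_fourier by (simp only: of_real_mult mult_ac)
  qed
  then have "complex_of_real S * (LINT \<xi>|leb ?I. \<psi> \<xi> * iexp (dot n \<xi> x) * complex_of_real (?X \<xi>))
      = (LINT y|leb ?J. (LINT \<xi>|leb ?I. F \<xi> y))"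
    using IJ.Fubini_integral[OF F_int] by (simp only: integral_mult_right_zero)
  then have "complex_of_real S * (complex_of_real c0 * (LINT \<xi>|leb ?I. \<psi> \<xi> * iexp (dot n \<xi> x) * complex_of_real (?X \<xi>)))
      = (LINT y|leb ?J. complex_of_real (G y) * inv_fourier n \<psi> (translate K x y))" (is "_ * (_ * ?H) = _")
    unfolding inner[symmetric] integral_mult_right_zero by (subst mult.left_commute) (simp only:)
  from arg_cong[OF this, of cmod]
  have eq: "S * (c0 * cmod ?H) = cmod (LINT y|leb ?J. complex_of_real (G y) * inv_fourier n \<psi> (translate K x y))"
    using S c0 by (simp only: norm_mult norm_of_real abs_of_pos)
  have "integrable (leb ?J) (\<lambda>y. complex_of_real c0 * (LINT \<xi>|leb ?I. F \<xi> y))"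
    using IJ.integrable_snd[OF F_int] by simp
  then have int: "integrable (leb ?J) (\<lambda>y. complex_of_real (G y) * inv_fourier n \<psi> (translate K x y))"
    unfolding inner .
  have [measurable]: "(\<lambda>y. inv_fourier n \<psi> (translate K x y)) \<in> borel_measurable (leb ?J)"
    by (rule measurable_compose[OF measurable_translate[OF K x] fourier_measurable(2)[OF \<psi>_meas]])
  have "ennreal (c0 * cmod ?H) = ennreal (inverse S) * ennreal (S * (c0 * cmod ?H))"
    using S by (simp add: ennreal_mult[symmetric] c0_def)
  also have "\<dots> \<le> ennreal (inverse S) * (\<integral>\<^sup>+y. ennreal (cmod (complex_of_real (G y) * inv_fourier n \<psi> (translate K x y))) \<partial>leb ?J)"
    unfolding eq by (intro mult_left_mono integral_norm_bound_ennreal int) simp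
  also have "\<dots> = (\<integral>\<^sup>+y. ennreal (inverse S) * ennreal (cmod (complex_of_real (G y) * inv_fourier n \<psi> (translate K x y))) \<partial>leb ?J)"
    by (rule nn_integral_cmult[symmetric]) measurable
  also have "\<dots> = (\<integral>\<^sup>+y. ennreal ((4 * pi * t) powr (- (real K / 2)) * exp (- (sq_norm K y) / (4 * t)))
          * ennreal (cmod (inv_fourier n \<psi> (translate K x y))) \<partial>leb {1..K})"
  proof (intro nn_integral_cong)
    fix y
    have "inverse S = (4 * pi * t) powr (- (real K / 2))" by (simp add: S_def powr_minus)
    then show "ennreal (inverse S) * ennreal (cmod (complex_of_real (G y) * inv_fourier n \<psi> (translate K x y)))
        = ennreal ((4 * pi * t) powr (- (real K / 2)) * exp (- (sq_norm K y) / (4 * t)))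
          * ennreal (cmod (inv_fourier n \<psi> (translate K x y)))"
      using G_nonneg[of y] unfolding norm_mult G_exp[symmetric] by (simp add: ennreal_mult mult.assoc)
  qed
  finally show ?thesis unfolding c0_def .
qed

lemma sum_le_prod_one_plus:
  fixes c :: "'i \<Rightarrow> real"
  assumes "finite A" "\<And>i. i \<in> A \<Longrightarrow> c i \<ge> 0"
  shows "(\<Sum>i\<in>A. c i) \<le> (\<Prod>i\<in>A. 1 + c i)"
  using assms
proof (induction A)
  case (insert i A)
  have "1 \<le> (\<Prod>i\<in>A. 1 + c i)" using insert.prems by (intro prod_ge_1) auto
  then have "c i * 1 \<le> c i * (\<Prod>i\<in>A. 1 + c i)" using insert.prems by (intro mult_left_mono) auto
  then show ?case using insert by (simp add: algebra_simps)
qed simp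

text \<open>
  The symbol grows at most polynomially: \<open>\<bar>\<xi>\<bar>\<^sup>2\<close> is bounded by \<open>\<Prod>\<^sub>i (1 + \<xi>\<^sub>i\<^sup>2)\<close>.
\<close>

lemma integrable_Lambda_symbol:
  assumes f: "test_function n f" and K: "K \<le> n" and a: "0 < a" "a \<le> real K"
  shows "integrable (leb {1..n}) (\<lambda>\<xi>. complex_of_real ((sq_norm K \<xi>) powr a) * fourier n f \<xi>)"
proof (rule integrable_weighted_fourier[OF f, where L=K])
  have "(\<lambda>\<xi> :: nat \<Rightarrow> real. sq_norm K \<xi>) \<in> borel_measurable (leb {1..n})"
    using K by (intro borel_measurable_sum borel_measurable_power) measurable
  then show "(\<lambda>\<xi>. complex_of_real ((sq_norm K \<xi>) powr a)) \<in> borel_measurable (leb {1..n})"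
    by measurable
  fix \<xi> :: "nat \<Rightarrow> real"
  let ?W = "\<Prod>i\<in>{1..n}. 1 + (\<xi> i)\<^sup>2"
  have W: "1 \<le> ?W" by (intro prod_ge_1) auto
  have "(sq_norm K \<xi>) \<le> (\<Sum>i=1..n. (\<xi> i)\<^sup>2)" using K by (intro sum_mono2) auto
  also have "\<dots> \<le> ?W" by (intro sum_le_prod_one_plus) auto
  finally have "(sq_norm K \<xi>) powr a \<le> ?W powr a" using a by (intro powr_mono2) (auto intro: sum_nonneg)
  also have "\<dots> \<le> ?W powr (real K)" using W a by (intro powr_mono) auto
  also have "\<dots> = ?W ^ K" using W by (intro powr_realpow) linarith
  finally show "cmod (complex_of_real ((sq_norm K \<xi>) powr a)) \<le> ?W ^ K" by simp
qed

text \<open>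
  The formula \<open>Gamma(\<sigma>/2) r\<^bsup>-\<sigma>/2\<^esup> = \<integral> t\<^bsup>\<sigma>/2-1\<^esup> exp (- t r) dt\<close> with \<open>r = \<bar>\<xi>\<bar>\<^sup>2\<close> recovers the Fourier transform of
  \<open>f\<close> from \<open>\<psi>\<close>, except on the null set where the first \<open>K\<close> variables vanish.  Fourier inversion and
  Fubini's theorem then express \<open>f(x)\<close> as an integral over \<open>t\<close>.
\<close>

lemma fourier_subordination:
  fixes \<sigma> :: real
  assumes f: "test_function n f" and x: "x \<in> Rn n" and K: "1 \<le> K" "K \<le> n" and \<sigma>: "0 < \<sigma>" "\<sigma> < real K"
  defines "\<psi> \<equiv> \<lambda>\<xi>. complex_of_real ((sq_norm K \<xi>) powr (\<sigma> / 2)) * fourier n f \<xi>"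
  shows "ennreal (Gamma (\<sigma> / 2) * cmod (f x))
    \<le> (\<integral>\<^sup>+t. ennreal (indicator {0<..} t * t powr (\<sigma> / 2 - 1)) * ennreal ((2 * pi) powr (- (real n / 2)) *
        cmod (LINT \<xi>|leb {1..n}. \<psi> \<xi> * iexp (dot n \<xi> x) * complex_of_real (exp (- t * (sq_norm K \<xi>))))) \<partial>lborel)"
proof -
  let ?I = "{1..n}"
  interpret I: sigma_finite_measure "leb ?I" by (rule sigma_finite_leb) simp
  interpret IL: pair_sigma_finite "leb ?I" "lborel :: real measure" ..
  define a where "a = \<sigma> / 2"
  have a: "a > 0" "a \<le> real K" using \<sigma> by (auto simp: a_def)
  define c0 where "c0 = (2 * pi) powr (- (real n / 2))"
  have c0: "c0 > 0" by (simp add: c0_def)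
  define r where "r \<xi> = (sq_norm K \<xi>)" for \<xi> :: "nat \<Rightarrow> real"
  have r_nonneg: "r \<xi> \<ge> 0" for \<xi> unfolding r_def by (intro sum_nonneg) simp
  have [measurable]: "r \<in> borel_measurable (leb ?I)"
    unfolding r_def using K by (intro borel_measurable_sum borel_measurable_power) measurable
  have \<psi>: "integrable (leb ?I) \<psi>"
    using integrable_Lambda_symbol[OF f K(2) a] unfolding \<psi>_def a_def .
  note [measurable] = borel_measurable_integrable[OF \<psi>]
  have f_int: "integrable (leb ?I) (fourier n f)"
    using integrable_weighted_fourier[OF f, of "\<lambda>_. 1" 0] by simp
  have [measurable]: "(\<lambda>\<xi>. dot n \<xi> x) \<in> borel_measurable (leb ?I)"
    by (intro borel_measurable_sum) measurable
  define e where "e \<xi> = iexp (dot n \<xi> x)" for \<xi>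
  have [measurable]: "e \<in> borel_measurable (leb ?I)" unfolding e_def by measurable
  have e: "cmod (e \<xi>) = 1" for \<xi> unfolding e_def by (rule norm_exp_ii)
  let ?H = "\<lambda>t. LINT \<xi>|leb ?I. \<psi> \<xi> * e \<xi> * complex_of_real (exp (- t * r \<xi>))"
  define k where "k \<xi> t = indicator {0<..} t * t powr (a - 1) * exp (- t * r \<xi>)" for \<xi> and t :: real
  have k_nonneg: "k \<xi> t \<ge> 0" for \<xi> t by (simp add: k_def)
  have k_meas [measurable]: "(\<lambda>w. k (fst w) (snd w)) \<in> borel_measurable (leb ?I \<Otimes>\<^sub>M lborel)"
    unfolding k_def by measurable
  have k_meas' [measurable]: "k \<xi> \<in> borel_measurable lborel" for \<xi> unfolding k_def by measurable
  have r_pos: "AE \<xi> in leb ?I. r \<xi> > 0"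
  proof -
    have "AE \<xi> in leb ?I. \<xi> 1 \<noteq> 0" using K by (intro AE_leb_neq) auto
    then show ?thesis
    proof eventually_elim
      case (elim \<xi>)
      have "(\<xi> 1)\<^sup>2 \<le> r \<xi>" unfolding r_def using K by (intro member_le_sum) auto
      then show ?case using elim less_le_trans[of 0 "(\<xi> 1)\<^sup>2" "r \<xi>"] by simp
    qed
  qed
  have k_int: "(\<integral>\<^sup>+t. ennreal (k \<xi> t) \<partial>lborel) = ennreal (Gamma a * r \<xi> powr (- a))" if "r \<xi> > 0" for \<xi>
    using nn_integral_Gamma_scaled[OF a(1) that] unfolding k_def .
  define F where "F \<xi> t = \<psi> \<xi> * e \<xi> * complex_of_real (k \<xi> t)" for \<xi> t
  let ?T = "LINT t|lborel. (LINT \<xi>|leb ?I. F \<xi> t)"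
  have F_norm: "ennreal (norm (F \<xi> t)) = ennreal (norm (\<psi> \<xi>)) * ennreal (k \<xi> t)" for \<xi> t
    using k_nonneg[of \<xi> t] by (simp add: F_def norm_mult e ennreal_mult)
  have F_meas [measurable]: "(\<lambda>(\<xi>, t). F \<xi> t) \<in> borel_measurable (leb ?I \<Otimes>\<^sub>M lborel)"
    unfolding F_def case_prod_beta' by measurable
  have F_int: "integrable (leb ?I \<Otimes>\<^sub>M lborel) (\<lambda>(\<xi>, t). F \<xi> t)"
  proof (rule integrableI_bounded[OF F_meas])
    have "(\<integral>\<^sup>+w. ennreal (norm (case w of (\<xi>, t) \<Rightarrow> F \<xi> t)) \<partial>(leb ?I \<Otimes>\<^sub>M lborel))
        = (\<integral>\<^sup>+\<xi>. (\<integral>\<^sup>+t. ennreal (norm (F \<xi> t)) \<partial>lborel) \<partial>leb ?I)"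
    proof -
      have "(\<lambda>w. ennreal (norm (case w of (\<xi>, t) \<Rightarrow> F \<xi> t))) \<in> borel_measurable (leb ?I \<Otimes>\<^sub>M lborel)"
        using F_meas by measurable
      from lborel.nn_integral_fst[OF this] show ?thesis by simp
    qed
    also have "\<dots> = (\<integral>\<^sup>+\<xi>. ennreal (Gamma a) * ennreal (norm (fourier n f \<xi>)) \<partial>leb ?I)"
    proof (rule nn_integral_cong_AE, use r_pos in eventually_elim)
      fix \<xi> assume r: "r \<xi> > 0"
      have "(\<integral>\<^sup>+t. ennreal (norm (F \<xi> t)) \<partial>lborel) = ennreal (norm (\<psi> \<xi>)) * ennreal (Gamma a * r \<xi> powr (- a))"
        unfolding F_norm k_int[OF r, symmetric] by (rule nn_integral_cmult) measurable
      also have "\<dots> = ennreal (Gamma a) * ennreal (norm (fourier n f \<xi>))"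
        using r a unfolding \<psi>_def r_def[symmetric] a_def[symmetric]
        by (simp add: ennreal_mult[symmetric] Gamma_real_nonneg norm_mult powr_minus field_simps)
      finally show "(\<integral>\<^sup>+t. ennreal (norm (F \<xi> t)) \<partial>lborel) = ennreal (Gamma a) * ennreal (norm (fourier n f \<xi>))" .
    qed
    also have "\<dots> < \<infinity>"
    proof -
      have "(\<lambda>\<xi>. ennreal (norm (fourier n f \<xi>))) \<in> borel_measurable (leb ?I)"
        using borel_measurable_integrable[OF f_int] by measurable
      then show ?thesis
        using f_int by (subst nn_integral_cmult) (simp_all add: integrable_iff_bounded ennreal_mult_less_top)
    qed
    finally show "(\<integral>\<^sup>+w. ennreal (norm (case w of (\<xi>, t) \<Rightarrow> F \<xi> t)) \<partial>(leb ?I \<Otimes>\<^sub>M lborel)) < \<infinity>" .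
  qed
  have F_t: "(LINT t|lborel. F \<xi> t) = complex_of_real (Gamma a) * (fourier n f \<xi> * e \<xi>)" if r: "r \<xi> > 0" for \<xi>
  proof -
    have "has_bochner_integral lborel (k \<xi>) (Gamma a * r \<xi> powr (- a))"
      using k_int[OF r] k_nonneg a by (intro has_bochner_integral_nn_integral) (auto simp: Gamma_real_nonneg)
    then have "(LINT t|lborel. k \<xi> t) = Gamma a * r \<xi> powr (- a)" by (rule has_bochner_integral_integral_eq)
    then have "(LINT t|lborel. F \<xi> t) = \<psi> \<xi> * e \<xi> * complex_of_real (Gamma a * r \<xi> powr (- a))"
      unfolding F_def integral_mult_right_zero integral_complex_of_real by simp
    also have "\<dots> = complex_of_real (Gamma a) * (fourier n f \<xi> * e \<xi>) * complex_of_real (r \<xi> powr a * r \<xi> powr (- a))"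
      unfolding \<psi>_def r_def[symmetric] a_def[symmetric] by simp
    also have "r \<xi> powr a * r \<xi> powr (- a) = 1" using r by (simp add: powr_minus)
    finally show ?thesis by simp
  qed
  have "complex_of_real (Gamma a) * (LINT \<xi>|leb ?I. fourier n f \<xi> * e \<xi>) = (LINT \<xi>|leb ?I. (LINT t|lborel. F \<xi> t))"
  proof -
    have "(\<lambda>\<xi>. LINT t|lborel. F \<xi> t) \<in> borel_measurable (leb ?I)"
      using lborel.borel_measurable_lebesgue_integral[OF F_meas] by simp
    moreover have "(\<lambda>\<xi>. complex_of_real (Gamma a) * (fourier n f \<xi> * e \<xi>)) \<in> borel_measurable (leb ?I)"
      using borel_measurable_integrable[OF f_int] by measurable
    ultimately have "(LINT \<xi>|leb ?I. (LINT t|lborel. F \<xi> t)) = (LINT \<xi>|leb ?I. complex_of_real (Gamma a) * (fourier n f \<xi> * e \<xi>))"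
      using r_pos by (intro integral_cong_AE) (auto simp: F_t)
    then show ?thesis by simp
  qed
  also have "\<dots> = ?T"
    using IL.Fubini_integral[OF F_int] by simp
  finally have A: "complex_of_real (Gamma a) * (LINT \<xi>|leb ?I. fourier n f \<xi> * e \<xi>) = ?T" .
  have B: "f x = complex_of_real c0 * (LINT \<xi>|leb ?I. fourier n f \<xi> * e \<xi>)"
    using fourier_inversion[OF f x, symmetric] unfolding inv_fourier_def c0_def[symmetric] e_def[symmetric] .
  have "complex_of_real (Gamma a) * f x = complex_of_real c0 * ?T"
    unfolding B by (subst mult.left_commute) (simp only: A)
  from arg_cong[OF this, of cmod] have "Gamma a * cmod (f x) = c0 * cmod ?T"
    using c0 Gamma_real_pos[OF a(1)] by (simp only: norm_mult norm_of_real abs_of_pos)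
  then have "ennreal (Gamma a * cmod (f x)) = ennreal c0 * ennreal (cmod ?T)"
    using c0 by (simp add: ennreal_mult)
  also have "\<dots> \<le> ennreal c0 * (\<integral>\<^sup>+t. ennreal (cmod (LINT \<xi>|leb ?I. F \<xi> t)) \<partial>lborel)"
    using IL.integrable_snd[OF F_int] by (intro mult_left_mono integral_norm_bound_ennreal) auto
  also have "\<dots> = (\<integral>\<^sup>+t. ennreal c0 * ennreal (cmod (LINT \<xi>|leb ?I. F \<xi> t)) \<partial>lborel)"
    using borel_measurable_integrable[OF IL.integrable_snd[OF F_int]] by (intro nn_integral_cmult[symmetric]) simp
  also have "\<dots> = (\<integral>\<^sup>+t. ennreal (indicator {0<..} t * t powr (a - 1)) * ennreal (c0 *
        cmod (?H t)) \<partial>lborel)"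
  proof (intro nn_integral_cong)
    fix t :: real
    have "(LINT \<xi>|leb ?I. F \<xi> t) = (LINT \<xi>|leb ?I. complex_of_real (indicator {0<..} t * t powr (a - 1)) * (\<psi> \<xi> * e \<xi> * complex_of_real (exp (- t * r \<xi>))))"
      unfolding F_def k_def by (intro Bochner_Integration.integral_cong refl) (simp add: mult_ac)
    also have "\<dots> = complex_of_real (indicator {0<..} t * t powr (a - 1)) * (?H t)"
      by (rule integral_mult_right_zero)
    finally have "cmod (LINT \<xi>|leb ?I. F \<xi> t) = (indicator {0<..} t * t powr (a - 1)) * cmod (?H t)"
      by (simp add: norm_mult)
    then show "ennreal c0 * ennreal (cmod (LINT \<xi>|leb ?I. F \<xi> t)) = ennreal (indicator {0<..} t * t powr (a - 1)) * ennreal (c0 *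
        cmod (?H t))"
      using c0 by (simp add: ennreal_mult[symmetric] mult_ac)
  qed
  finally show ?thesis unfolding a_def c0_def e_def r_def .
qed

text \<open>
  Bound the integrand in the subordination formula by the heat kernel and integrate over \<open>t\<close> first: the
  heat kernels, weighted by \<open>t\<^bsup>\<sigma>/2-1\<^esup>\<close>, add up to a multiple of \<open>\<bar>y\<bar>\<^bsup>\<sigma>-K\<^esup>\<close>.
\<close>

lemma riesz_potential_bound:
  fixes \<sigma> :: real
  assumes K: "1 \<le> K" "K \<le> n" and \<sigma>: "0 < \<sigma>" "\<sigma> < real K"
  shows "\<exists>C\<ge>0. \<forall>f. test_function n f \<longrightarrow> (\<forall>x\<in>Rn n. ennreal (cmod (f x)) \<le>
    ennreal C * (\<integral>\<^sup>+y. ennreal ((sq_norm K y) powr ((\<sigma> - real K) / 2))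
      * ennreal (cmod (Lambda_op n K \<sigma> f (translate K x y))) \<partial>leb {1..K}))"
proof -
  let ?J = "{1..K}"
  interpret J: sigma_finite_measure "leb ?J" by (rule sigma_finite_leb) simp
  interpret JL: pair_sigma_finite "leb ?J" "lborel :: real measure" ..
  define b where "b = (real K - \<sigma>) / 2"
  have b: "b > 0" using \<sigma> by (simp add: b_def)
  obtain C0 where C0: "C0 \<ge> 0" "\<And>\<rho>. \<rho> > 0 \<Longrightarrow>
      (\<integral>\<^sup>+t. ennreal (indicator {0<..} t * t powr (- b - 1) * exp (- \<rho> / (4 * t))) \<partial>lborel) = ennreal (C0 * \<rho> powr (- b))"
    using nn_integral_heat_kernel_time[OF b] by blast
  define \<gamma> where "\<gamma> = Gamma (\<sigma> / 2)"
  have \<gamma>: "\<gamma> > 0" unfolding \<gamma>_def using \<sigma> by (intro Gamma_real_pos) simp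
  define D where "D = (4 * pi) powr (- (real K / 2)) * C0"
  have D: "D \<ge> 0" using C0 by (simp add: D_def)
  show ?thesis
  proof (intro exI[of _ "D / \<gamma>"] conjI allI impI ballI)
    show "D / \<gamma> \<ge> 0" using D \<gamma> by simp
    fix f x assume f: "test_function n f" and x: "x \<in> Rn n"
    define \<psi> where "\<psi> = (\<lambda>\<xi>. complex_of_real ((sq_norm K \<xi>) powr (\<sigma> / 2)) * fourier n f \<xi>)"
    define g where "g y = ennreal (cmod (Lambda_op n K \<sigma> f (translate K x y)))" for y
    define R where "R y = (sq_norm K y)" for y :: "nat \<Rightarrow> real"
    have \<psi>: "integrable (leb {1..n}) \<psi>"
      using integrable_Lambda_symbol[OF f K(2), of "\<sigma> / 2"] \<sigma> unfolding \<psi>_def by simp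
    have \<Lambda>: "Lambda_op n K \<sigma> f = inv_fourier n \<psi>" unfolding Lambda_op_def \<psi>_def ..
    have g_meas [measurable]: "g \<in> borel_measurable (leb ?J)"
      using measurable_compose[OF measurable_translate[OF K(2) x] fourier_measurable(2)[OF borel_measurable_integrable[OF \<psi>]]]
      unfolding g_def \<Lambda> by measurable
    have R_meas [measurable]: "R \<in> borel_measurable (leb ?J)"
      unfolding R_def by (intro borel_measurable_sum borel_measurable_power) measurable
    have R_pos: "AE y in leb ?J. R y > 0"
    proof -
      have "AE y in leb ?J. y 1 \<noteq> 0" using K by (intro AE_leb_neq) auto
      then show ?thesis
      proof eventually_elim
        case (elim y)
        have "(y 1)\<^sup>2 \<le> R y" unfolding R_def using K by (intro member_le_sum) auto
        then show ?case using elim less_le_trans[of 0 "(y 1)\<^sup>2" "R y"] by simp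
      qed
    qed
    define H where "H y t = ennreal ((4 * pi) powr (- (real K / 2))) *
        ennreal (indicator {0<..} t * t powr (- b - 1) * exp (- R y / (4 * t))) * g y" for y and t :: real
    have H_meas: "(\<lambda>(y, t). H y t) \<in> borel_measurable (leb ?J \<Otimes>\<^sub>M lborel)"
      unfolding H_def case_prod_beta' by measurable
    let ?h = "\<lambda>t. ennreal ((2 * pi) powr (- (real n / 2)) *
        cmod (LINT \<xi>|leb {1..n}. \<psi> \<xi> * iexp (dot n \<xi> x) * complex_of_real (exp (- t * (sq_norm K \<xi>)))))"
    have "ennreal (\<gamma> * cmod (f x)) \<le> (\<integral>\<^sup>+t. ennreal (indicator {0<..} t * t powr (\<sigma> / 2 - 1)) * ?h t \<partial>lborel)"
      using fourier_subordination[OF f x K \<sigma>] unfolding \<gamma>_def \<psi>_def .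
    also have "\<dots> \<le> (\<integral>\<^sup>+t. (\<integral>\<^sup>+y. H y t \<partial>leb ?J) \<partial>lborel)"
    proof (intro nn_integral_mono)
      fix t :: real
      show "ennreal (indicator {0<..} t * t powr (\<sigma> / 2 - 1)) * ?h t \<le> (\<integral>\<^sup>+y. H y t \<partial>leb ?J)"
      proof (cases "t > 0")
        case True
        have "ennreal (t powr (\<sigma> / 2 - 1)) * ?h t \<le> ennreal (t powr (\<sigma> / 2 - 1)) *
            (\<integral>\<^sup>+y. ennreal ((4 * pi * t) powr (- (real K / 2)) * exp (- R y / (4 * t))) * g y \<partial>leb ?J)"
          using heat_kernel_bound[OF \<psi> K(2) x True] unfolding R_def g_def \<Lambda> by (intro mult_left_mono) auto
        also have "\<dots> = (\<integral>\<^sup>+y. ennreal (t powr (\<sigma> / 2 - 1)) * (ennreal ((4 * pi * t) powr (- (real K / 2)) * exp (- R y / (4 * t))) * g y) \<partial>leb ?J)"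
          by (rule nn_integral_cmult[symmetric]) measurable
        also have "\<dots> = (\<integral>\<^sup>+y. H y t \<partial>leb ?J)"
        proof (intro nn_integral_cong)
          fix y
          have "t powr (\<sigma> / 2 - 1) * (4 * pi * t) powr (- (real K / 2)) = (4 * pi) powr (- (real K / 2)) * t powr (- b - 1)"
            using True by (simp add: powr_mult powr_add[symmetric] b_def diff_divide_distrib algebra_simps)
          then have "ennreal (t powr (\<sigma> / 2 - 1)) * ennreal ((4 * pi * t) powr (- (real K / 2)) * exp (- R y / (4 * t)))
              = ennreal ((4 * pi) powr (- (real K / 2))) * ennreal (indicator {0<..} t * t powr (- b - 1) * exp (- R y / (4 * t)))"
            using True by (simp add: ennreal_mult[symmetric] mult.assoc[symmetric])
          then show "ennreal (t powr (\<sigma> / 2 - 1)) * (ennreal ((4 * pi * t) powr (- (real K / 2)) * exp (- R y / (4 * t))) * g y) = H y t"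
            unfolding H_def mult.assoc[symmetric] by simp
        qed
        finally show ?thesis using True by simp
      qed simp
    qed
    also have "\<dots> = (\<integral>\<^sup>+y. (\<integral>\<^sup>+t. H y t \<partial>lborel) \<partial>leb ?J)"
      using JL.Fubini'[OF H_meas] by simp
    also have "\<dots> = (\<integral>\<^sup>+y. ennreal D * (ennreal (R y powr ((\<sigma> - real K) / 2)) * g y) \<partial>leb ?J)"
    proof (rule nn_integral_cong_AE, use R_pos in eventually_elim)
      fix y assume R: "R y > 0"
      have "(\<integral>\<^sup>+t. H y t \<partial>lborel) = ennreal ((4 * pi) powr (- (real K / 2))) *
          (\<integral>\<^sup>+t. ennreal (indicator {0<..} t * t powr (- b - 1) * exp (- R y / (4 * t))) \<partial>lborel) * g y"
        unfolding H_def by (simp add: nn_integral_cmult nn_integral_multc)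
      also have "\<dots> = ennreal D * (ennreal (R y powr (- b)) * g y)"
        unfolding C0(2)[OF R] D_def using C0(1) by (simp add: ennreal_mult mult.assoc)
      also have "- b = (\<sigma> - real K) / 2" by (simp add: b_def field_simps)
      finally show "(\<integral>\<^sup>+t. H y t \<partial>lborel) = ennreal D * (ennreal (R y powr ((\<sigma> - real K) / 2)) * g y)" .
    qed
    also have "\<dots> = ennreal D * (\<integral>\<^sup>+y. ennreal (R y powr ((\<sigma> - real K) / 2)) * g y \<partial>leb ?J)"
      by (rule nn_integral_cmult) measurable
    finally have "ennreal (1 / \<gamma>) * ennreal (\<gamma> * cmod (f x)) \<le> ennreal (1 / \<gamma>) * (ennreal D * (\<integral>\<^sup>+y. ennreal (R y powr ((\<sigma> - real K) / 2)) * g y \<partial>leb ?J))"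
      by (rule mult_left_mono) simp
    then show "ennreal (cmod (f x)) \<le> ennreal (D / \<gamma>) * (\<integral>\<^sup>+y. ennreal ((sq_norm K y) powr ((\<sigma> - real K) / 2))
      * ennreal (cmod (Lambda_op n K \<sigma> f (translate K x y))) \<partial>leb {1..K})"
      using \<gamma> D unfolding R_def g_def by (simp add: ennreal_mult[symmetric] mult.assoc[symmetric])
  qed
qed

section \<open>Weights of product type and dilations\<close>

text \<open>
  Each coordinate is at most the radius in modulus, and the exponents \<open>c\<^sub>i\<close> are not positive.
\<close>

lemma powr_radius_le_prod:
  fixes y c :: "nat \<Rightarrow> real"
  assumes A: "finite A" and y: "\<And>i. i \<in> A \<Longrightarrow> y i \<noteq> 0" and c: "\<And>i. i \<in> A \<Longrightarrow> c i \<le> 0"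
  shows "(\<Sum>i\<in>A. (y i)\<^sup>2) powr ((\<Sum>i\<in>A. c i) / 2) \<le> (\<Prod>i\<in>A. \<bar>y i\<bar> powr c i)"
proof (cases "A = {}")
  case False
  define R where "R = (\<Sum>i\<in>A. (y i)\<^sup>2)"
  have le: "(y i)\<^sup>2 \<le> R" if "i \<in> A" for i unfolding R_def using A that by (intro member_le_sum) auto
  have R: "R > 0" unfolding R_def using A y False by (intro sum_pos) auto
  have "R powr ((\<Sum>i\<in>A. c i) / 2) = R powr (\<Sum>i\<in>A. c i / 2)" by (simp add: sum_divide_distrib)
  also have "\<dots> = (\<Prod>i\<in>A. R powr (c i / 2))" using R A by (intro powr_sum) auto
  also have "\<dots> \<le> (\<Prod>i\<in>A. \<bar>y i\<bar> powr c i)"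
  proof (intro prod_mono conjI)
    fix i assume i: "i \<in> A"
    have "R powr (c i / 2) \<le> ((y i)\<^sup>2) powr (c i / 2)"
      using le[OF i] y[OF i] c[OF i] by (intro powr_mono2') auto
    also have "((y i)\<^sup>2) powr (c i / 2) = \<bar>y i\<bar> powr c i"
    proof -
      have "(y i)\<^sup>2 = \<bar>y i\<bar> powr 2" using y[OF i] by (simp add: powr_numeral)
      then show ?thesis by (simp only: powr_powr) simp
    qed
    finally show "R powr (c i / 2) \<le> \<bar>y i\<bar> powr c i" .
  qed simp
  finally show ?thesis unfolding R_def .
qed simp

lemma nn_integral_even_finite:
  assumes [measurable]: "h \<in> borel_measurable borel" and "(\<integral>\<^sup>+u. h u \<partial>lborel) < \<infinity>"
  shows "(\<integral>\<^sup>+u. h u + h (- u) \<partial>(lborel :: real measure)) < \<infinity>"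
  using assms(2) nn_integral_real_affine[of h "-1" 0] by (simp add: nn_integral_add)

text \<open>
  The singularity at \<open>1\<close> is integrable since \<open>a > 0\<close>, the one at \<open>0\<close> since \<open>b < 1\<close>, and the tail behaves
  like \<open>\<bar>u\<bar>\<^bsup>a-1-b\<^esup>\<close> with \<open>a < b\<close>.  The three terms of the majorant account for these three regions.
\<close>

lemma nn_integral_dilation_weight_finite:
  fixes a b :: real
  assumes a: "0 < a" "a < b" and b: "b < 1"
  shows "(\<integral>\<^sup>+u. ennreal (\<bar>1 - u\<bar> powr (a - 1) * \<bar>u\<bar> powr (- b)) \<partial>lborel) < \<infinity>"
proof -
  let ?w = "\<lambda>u. \<bar>1 - u\<bar> powr (a - 1) * \<bar>u\<bar> powr (- b)"
  define h where "h c u = ennreal (u powr c) * indicator {0<..<1} u" for c u :: real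
  define t where "t u = ennreal (u powr (a - 1 - b)) * indicator {1/2..} u" for u :: real
  have [measurable]: "h c \<in> borel_measurable borel" "t \<in> borel_measurable borel" for c
    unfolding h_def t_def by measurable
  have near: "(\<integral>\<^sup>+u. h c u + h c (- u) \<partial>lborel) < \<infinity>" if "c > -1" for c
    using nn_integral_powr_near_0[OF that, of 1] by (intro nn_integral_even_finite) (auto simp: h_def)
  have far: "(\<integral>\<^sup>+u. t u + t (- u) \<partial>lborel) < \<infinity>"
    using nn_integral_powr_near_infinity[of "a - 1 - b" "1/2"] a
    by (intro nn_integral_even_finite) (auto simp: t_def)
  have shift: "(\<integral>\<^sup>+u. h (a - 1) (u - 1) + h (a - 1) (- (u - 1)) \<partial>lborel) < \<infinity>"
    using near[of "a - 1"] a nn_integral_real_affine[of "\<lambda>u. h (a - 1) u + h (a - 1) (- u)" 1 "-1"] by simp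
  have le: "ennreal (?w u)
      \<le> 3 * ((h (- b) u + h (- b) (- u)) + (h (a - 1) (u - 1) + h (a - 1) (- (u - 1))) + (t u + t (- u)))" for u
  proof -
    have bound: "ennreal (?w u) \<le> 3 * X"
      if "?w u \<le> 3 * r" "ennreal r \<le> X" "r \<ge> 0" for r X
    proof -
      have "ennreal (?w u) \<le> ennreal (3 * r)" using that by (intro ennreal_leI)
      also have "\<dots> = 3 * ennreal r" using that by (simp add: ennreal_mult)
      also have "\<dots> \<le> 3 * X" using that by (intro mult_left_mono) auto
      finally show ?thesis .
    qed
    have sum_ge: "r \<le> p + q + s" if "r \<le> p \<or> r \<le> q \<or> r \<le> s" for p q r s :: ennreal
    proof -
      have "p + 0 + 0 \<le> p + q + s" "0 + q + 0 \<le> p + q + s" "0 + 0 + s \<le> p + q + s"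
        by (intro add_mono; simp)+
      then show ?thesis using that by (auto intro: order_trans)
    qed
    consider "u = 0 \<or> u = 1" | "u \<noteq> 1" "\<bar>u - 1\<bar> < 1/2" | "u \<noteq> 0" "\<bar>u\<bar> \<le> 1/2" | "\<bar>u\<bar> > 1/2" "\<bar>u - 1\<bar> \<ge> 1/2"
      by linarith
    then show ?thesis
    proof cases
      case 1 then show ?thesis by auto
    next
      case 2
      have "1/2 \<le> \<bar>u\<bar>" using 2 by linarith
      then have "\<bar>u\<bar> powr (- b) \<le> (1/2) powr (- b)" using a by (intro powr_mono2') auto
      also have "\<dots> = 2 powr b" by (simp add: powr_minus_divide powr_divide)
      also have "\<dots> \<le> 2 powr 1" using b by (intro powr_mono) auto
      finally have "?w u \<le> \<bar>1 - u\<bar> powr (a - 1) * 3"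
        by (intro mult_left_mono) auto
      moreover have "ennreal (\<bar>1 - u\<bar> powr (a - 1)) \<le> h (a - 1) (u - 1) + h (a - 1) (- (u - 1))"
        using 2 by (cases "u > 1") (auto simp: h_def indicator_def)
      ultimately show ?thesis
        by (intro bound[of "\<bar>1 - u\<bar> powr (a - 1)"] sum_ge) auto
    next
      case 3
      have "\<bar>1 - u\<bar> powr (a - 1) \<le> (1/2) powr (a - 1)" using 3 a b by (intro powr_mono2') auto
      also have "\<dots> = 2 powr (1 - a)" using powr_minus_divide[of "1/2 :: real" "1 - a"] by (simp add: powr_divide)
      also have "\<dots> \<le> 2 powr 1" using a by (intro powr_mono) auto
      finally have "?w u \<le> 3 * \<bar>u\<bar> powr (- b)"
        by (intro mult_right_mono) auto
      moreover have "ennreal (\<bar>u\<bar> powr (- b)) \<le> h (- b) u + h (- b) (- u)"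
        using 3 by (cases "u > 0") (auto simp: h_def indicator_def)
      ultimately show ?thesis
        by (intro bound[of "\<bar>u\<bar> powr (- b)"] sum_ge) auto
    next
      case 4
      have "\<bar>u\<bar> / 3 \<le> \<bar>1 - u\<bar>" using 4 by (auto simp: abs_if split: if_splits)
      then have "\<bar>1 - u\<bar> powr (a - 1) \<le> (\<bar>u\<bar> / 3) powr (a - 1)" using 4 a b by (intro powr_mono2') auto
      also have "\<dots> = \<bar>u\<bar> powr (a - 1) * 3 powr (1 - a)"
        using powr_minus_divide[of 3 "1 - a"] by (simp add: powr_divide)
      also have "\<dots> \<le> \<bar>u\<bar> powr (a - 1) * 3 powr 1"
        using a by (intro mult_left_mono powr_mono) auto
      finally have "?w u \<le> (\<bar>u\<bar> powr (a - 1) * 3) * \<bar>u\<bar> powr (- b)"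
        by (intro mult_right_mono) auto
      also have "\<dots> = 3 * \<bar>u\<bar> powr (a - 1 - b)" by (simp add: powr_add[symmetric])
      finally have "?w u \<le> 3 * \<bar>u\<bar> powr (a - 1 - b)" .
      moreover have "ennreal (\<bar>u\<bar> powr (a - 1 - b)) \<le> t u + t (- u)"
        using 4 by (cases "u > 0") (auto simp: t_def indicator_def)
      ultimately show ?thesis
        by (intro bound[of "\<bar>u\<bar> powr (a - 1 - b)"] sum_ge) auto
    qed
  qed
  have "(\<integral>\<^sup>+u. ennreal (?w u) \<partial>lborel)
      \<le> (\<integral>\<^sup>+u. 3 * ((h (- b) u + h (- b) (- u)) + (h (a - 1) (u - 1) + h (a - 1) (- (u - 1))) + (t u + t (- u))) \<partial>lborel)"
    by (intro nn_integral_mono le)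
  also have "\<dots> = 3 * ((\<integral>\<^sup>+u. h (- b) u + h (- b) (- u) \<partial>lborel)
      + (\<integral>\<^sup>+u. h (a - 1) (u - 1) + h (a - 1) (- (u - 1)) \<partial>lborel) + (\<integral>\<^sup>+u. t u + t (- u) \<partial>lborel))"
    by (subst nn_integral_cmult, measurable, subst nn_integral_add, measurable, subst nn_integral_add, measurable)
  also have "\<dots> < \<infinity>"
    using near[of "- b"] b shift far by (simp add: ennreal_mult_less_top)
  finally show ?thesis .
qed

lemma measurable_Lambda_op:
  assumes "test_function n f" "K \<le> n" "0 < \<sigma>" "\<sigma> < real K"
  shows "Lambda_op n K \<sigma> f \<in> borel_measurable (leb {1..n})"
  unfolding Lambda_op_def using integrable_Lambda_symbol[OF assms(1,2), of "\<sigma> / 2"] assms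
  by (intro fourier_measurable(2)) auto

text \<open>
  The substitution \<open>y\<^sub>i = x\<^sub>i (1 - u\<^sub>i)\<close> turns the translate \<open>x - y\<close> into the dilate \<open>u x\<close>.  In the variable \<open>i\<close>
  the weight, the Jacobian and the kernel contribute \<open>\<bar>x\<^sub>i\<bar>\<close> to the powers \<open>-a\<^sub>i\<close>, \<open>1\<close> and \<open>a\<^sub>i - 1\<close>, which
  cancel.
\<close>

lemma dilation_integral_bound:
  fixes a :: "nat \<Rightarrow> real"
  assumes K: "1 \<le> K" "K \<le> n" and a: "\<And>i. i \<in> {1..K} \<Longrightarrow> 0 < a i \<and> a i < 1"
  shows "\<exists>C\<ge>0. \<forall>f. test_function n f \<longrightarrow> (\<forall>x\<in>nonzero_on n {1..K}.
    ennreal ((\<Prod>i=1..K. \<bar>x i\<bar> powr - a i) * cmod (f x)) \<le>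
    ennreal C * (\<integral>\<^sup>+u. ennreal (\<Prod>i=1..K. \<bar>1 - u i\<bar> powr (a i - 1))
      * ennreal (cmod (Lambda_op n K (\<Sum>i=1..K. a i) f (dilate {1..K} u x))) \<partial>leb {1..K}))"
proof -
  let ?J = "{1..K}"
  define \<sigma> where "\<sigma> = (\<Sum>i\<in>?J. a i)"
  have \<sigma>: "0 < \<sigma>" unfolding \<sigma>_def using K a by (intro sum_pos) auto
  have "\<sigma> < (\<Sum>i\<in>?J. 1)" unfolding \<sigma>_def using K a by (intro sum_strict_mono) auto
  then have \<sigma>K: "\<sigma> < real K" by simp
  obtain C where C: "C \<ge> 0" and riesz: "\<And>f x. test_function n f \<Longrightarrow> x \<in> Rn n \<Longrightarrow> ennreal (cmod (f x)) \<le>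
    ennreal C * (\<integral>\<^sup>+y. ennreal ((sq_norm K y) powr ((\<sigma> - real K) / 2))
      * ennreal (cmod (Lambda_op n K \<sigma> f (translate K x y))) \<partial>leb ?J)"
    using riesz_potential_bound[OF K \<sigma> \<sigma>K] by blast
  have exponent: "(\<sigma> - real K) / 2 = (\<Sum>i\<in>?J. a i - 1) / 2"
    by (simp add: \<sigma>_def sum_subtractf)
  show ?thesis unfolding \<sigma>_def[symmetric]
  proof (intro exI[of _ C] conjI allI impI ballI C)
    fix f x assume f: "test_function n f" and "x \<in> nonzero_on n ?J"
    then have x: "x \<in> Rn n" "\<And>i. i \<in> ?J \<Longrightarrow> x i \<noteq> 0" by (auto simp: nonzero_on_def)
    let ?g = "Lambda_op n K \<sigma> f"
    let ?P = "\<Prod>i\<in>?J. \<bar>- x i\<bar>"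
    let ?W = "\<lambda>u. \<Prod>i\<in>?J. \<bar>1 - u i\<bar> powr (a i - 1)"
    let ?R = "\<integral>\<^sup>+u. ennreal (?W u) * ennreal (cmod (?g (dilate ?J u x))) \<partial>leb ?J"
    have g_meas: "?g \<in> borel_measurable (leb {1..n})" by (rule measurable_Lambda_op[OF f K(2) \<sigma> \<sigma>K])
    have [measurable]: "(\<lambda>y. ?g (translate K x y)) \<in> borel_measurable (leb ?J)"
      by (rule measurable_compose[OF measurable_translate[OF K(2) x(1)] g_meas])
    have [measurable]: "(\<lambda>y. sq_norm K y) \<in> borel_measurable (leb ?J)"
      by (intro borel_measurable_sum borel_measurable_power) measurable
    define X where "X = (\<Prod>i\<in>?J. \<bar>x i\<bar> powr - a i)"
    have X: "X > 0" unfolding X_def using x by (intro prod_pos) auto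
    define k where "k y = ennreal ((sq_norm K y) powr ((\<sigma> - real K) / 2)) * ennreal (cmod (?g (translate K x y)))" for y
    have [measurable]: "k \<in> borel_measurable (leb ?J)" unfolding k_def by measurable
    let ?T = "affine_map ?J x (\<lambda>i. - x i)"
    have translate: "translate K x (?T u) = dilate ?J u x" for u
      by (auto simp: translate_def affine_map_def dilate_def)
    have dil_meas [measurable]: "(\<lambda>u. ?g (dilate ?J u x)) \<in> borel_measurable (leb ?J)"
      unfolding translate[symmetric] by measurable
    \<comment> \<open>Where some \<open>u\<^sub>i = 1\<close>, the convention \<open>0 powr c = 0\<close> makes the product of powers vanish.\<close>
    have neq: "AE u in leb ?J. \<forall>i\<in>?J. u i \<noteq> 1"
      by (intro AE_finite_allI AE_leb_neq) auto
    have "ennreal ?P * ennreal X * (\<integral>\<^sup>+u. k (?T u) \<partial>leb ?J)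
        = (\<integral>\<^sup>+u. ennreal ?P * ennreal X * k (?T u) \<partial>leb ?J)"
      by (rule nn_integral_cmult[symmetric]) measurable
    also have "\<dots> \<le> ?R"
    proof (rule nn_integral_mono_AE, use neq in eventually_elim)
      fix u :: "nat \<Rightarrow> real" assume u: "\<forall>i\<in>?J. u i \<noteq> 1"
      have T: "?T u i = x i * (1 - u i)" if "i \<in> ?J" for i
        using that by (simp add: affine_map_def algebra_simps)
      have "(\<Sum>i\<in>?J. (?T u i)\<^sup>2) powr ((\<sigma> - real K) / 2) \<le> (\<Prod>i\<in>?J. \<bar>?T u i\<bar> powr (a i - 1))"
        unfolding exponent
      proof (intro powr_radius_le_prod)
        fix i assume i: "i \<in> ?J"
        show "?T u i \<noteq> 0" unfolding T[OF i] using u x(2) i by auto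
        show "a i - 1 \<le> 0" using a[OF i] by simp
      qed simp
      then have "?P * X * (\<Sum>i\<in>?J. (?T u i)\<^sup>2) powr ((\<sigma> - real K) / 2)
          \<le> ?P * X * (\<Prod>i\<in>?J. \<bar>?T u i\<bar> powr (a i - 1))"
        using X by (intro mult_left_mono) (auto intro!: mult_nonneg_nonneg prod_nonneg)
      also have "\<dots> = (\<Prod>i\<in>?J. \<bar>- x i\<bar> * \<bar>x i\<bar> powr - a i * \<bar>?T u i\<bar> powr (a i - 1))"
        unfolding X_def by (simp add: prod.distrib)
      also have "\<dots> = ?W u"
      proof (intro prod.cong refl)
        fix i assume i: "i \<in> ?J"
        have "\<bar>- x i\<bar> * \<bar>x i\<bar> powr - a i * (\<bar>x i\<bar> powr (a i - 1)) = 1"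
          using x(2)[OF i] by (simp add: powr_diff powr_minus)
        then show "\<bar>- x i\<bar> * \<bar>x i\<bar> powr - a i * \<bar>?T u i\<bar> powr (a i - 1) = \<bar>1 - u i\<bar> powr (a i - 1)"
          unfolding T[OF i] abs_mult powr_mult by (simp only: mult.assoc[symmetric] mult_1_left)
      qed
      finally have "ennreal (?P * X * (\<Sum>i\<in>?J. (?T u i)\<^sup>2) powr ((\<sigma> - real K) / 2))
          \<le> ennreal (?W u)" by (rule ennreal_leI)
      then show "ennreal ?P * ennreal X * k (?T u)
          \<le> ennreal (?W u) * ennreal (cmod (?g (dilate ?J u x)))"
        unfolding k_def translate mult.assoc[symmetric] using X
        by (intro mult_right_mono) (simp_all add: ennreal_mult[symmetric] prod_nonneg)
    qed
    finally have *: "ennreal ?P * ennreal X * (\<integral>\<^sup>+u. k (?T u) \<partial>leb ?J)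
        \<le> ?R" .
    have "ennreal (X * cmod (f x)) = ennreal X * ennreal (cmod (f x))" using X by (simp add: ennreal_mult)
    also have "\<dots> \<le> ennreal X * (ennreal C * (\<integral>\<^sup>+y. k y \<partial>leb ?J))"
      using riesz[OF f x(1)] unfolding k_def by (intro mult_left_mono) auto
    also have "(\<integral>\<^sup>+y. k y \<partial>leb ?J) = ennreal ?P * (\<integral>\<^sup>+u. k (?T u) \<partial>leb ?J)"
    proof (rule nn_integral_leb_affine[OF finite_atLeastAtMost])
      show "- x i \<noteq> 0" if "i \<in> ?J" for i using x(2)[OF that] by simp
    qed measurable
    also have "ennreal X * (ennreal C * \<dots>) = ennreal C * (ennreal ?P * ennreal X * (\<integral>\<^sup>+u. k (?T u) \<partial>leb ?J))"
      by (simp only: mult_ac)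
    also have "\<dots> \<le> ennreal C * ?R"
      by (intro mult_left_mono *) simp
    finally show "ennreal ((\<Prod>i=1..K. \<bar>x i\<bar> powr - a i) * cmod (f x)) \<le>
      ennreal C * (\<integral>\<^sup>+u. ennreal (\<Prod>i=1..K. \<bar>1 - u i\<bar> powr (a i - 1))
      * ennreal (cmod (?g (dilate {1..K} u x))) \<partial>leb {1..K})" unfolding X_def .
  qed
qed

lemma measurable_dilate:
  assumes "J \<subseteq> {1..n}"
  shows "(\<lambda>w. dilate J (fst w) (snd w)) \<in> leb J \<Otimes>\<^sub>M leb {1..n} \<rightarrow>\<^sub>M leb {1..n}"
  unfolding dilate_def
proof (rule measurable_PiM_single')
  fix i assume i: "i \<in> {1..n}"
  show "(\<lambda>w. if i \<in> J then fst w i * snd w i else snd w i) \<in> leb J \<Otimes>\<^sub>M leb {1..n} \<rightarrow>\<^sub>M lborel"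
  proof (cases "i \<in> J")
    case True
    then have "(\<lambda>w. fst w i * snd w i) \<in> leb J \<Otimes>\<^sub>M leb {1..n} \<rightarrow>\<^sub>M lborel" using i by measurable
    then show ?thesis using True by (simp only: if_True)
  next
    case False
    have "(\<lambda>w. snd w i) \<in> leb J \<Otimes>\<^sub>M leb {1..n} \<rightarrow>\<^sub>M lborel" using i by measurable
    then show ?thesis using False by (simp only: if_False)
  qed
qed (use assms in \<open>auto simp: space_pair_measure space_leb PiE_iff extensional_def\<close>)

lemma prod_ennreal_finite:
  fixes f :: "'i \<Rightarrow> ennreal"
  assumes "finite A" "\<And>i. i \<in> A \<Longrightarrow> f i < \<infinity>" shows "(\<Prod>i\<in>A. f i) < \<infinity>"
  using assms by (induction A) (auto simp: ennreal_mult_less_top)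

text \<open>
  Apply \<open>\<Phi>\<close> to the bound by an average of dilates.  Minkowski's inequality moves \<open>\<Phi>\<close> inside the integral
  over \<open>u\<close>, where the dilation by \<open>u\<close> only produces the factor \<open>\<Prod>\<^sub>i \<bar>u\<^sub>i\<bar>\<^bsup>-b\<^sub>i\<^esup>\<close>.  What remains is the same
  norm of \<open>\<Lambda>\<^sup>\<sigma> f\<close> for every \<open>u\<close>, times a product of one-dimensional integrals.
\<close>

lemma norm_operator_hardy:
  fixes a b :: "nat \<Rightarrow> real"
  assumes \<Phi>: "norm_operator n (leb {1..K}) b {1..K} \<Phi>" and K: "1 \<le> K" "K \<le> n"
    and ab: "\<And>i. i \<in> {1..K} \<Longrightarrow> 0 < a i \<and> a i < b i \<and> b i < 1"
  shows "\<exists>C>0. \<forall>f w. test_function n f \<longrightarrow>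
      (\<forall>x\<in>nonzero_on n {1..K}. w x \<le> ennreal ((\<Prod>i=1..K. \<bar>x i\<bar> powr - a i) * cmod (f x))) \<longrightarrow>
      (\<forall>x\<in>Rn n. \<Phi> w x \<le> ennreal C * \<Phi> (\<lambda>x. ennreal (cmod (Lambda_op n K (\<Sum>i=1..K. a i) f x))) x)"
proof -
  let ?J = "{1..K}"
  let ?v = "\<lambda>i u. \<bar>1 - u\<bar> powr (a i - 1) * \<bar>u\<bar> powr (- b i)"
  interpret product_sigma_finite "\<lambda>_ :: nat. lborel :: real measure" by (rule product_sigma_finite_lborel)
  interpret J: sigma_finite_measure "leb ?J" by (rule sigma_finite_leb) simp
  define \<sigma> where "\<sigma> = (\<Sum>i\<in>?J. a i)"
  have \<sigma>: "0 < \<sigma>" unfolding \<sigma>_def using K ab by (intro sum_pos) auto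
  have a1: "a i < 1" if "i \<in> ?J" for i using ab[OF that] by simp
  have "\<sigma> < (\<Sum>i\<in>?J. 1)" unfolding \<sigma>_def using K a1 by (intro sum_strict_mono) auto
  then have \<sigma>K: "\<sigma> < real K" by simp
  obtain C1 where C1: "C1 \<ge> 0" "\<And>f x. test_function n f \<Longrightarrow> x \<in> nonzero_on n ?J \<Longrightarrow>
      ennreal ((\<Prod>i\<in>?J. \<bar>x i\<bar> powr - a i) * cmod (f x)) \<le>
      ennreal C1 * (\<integral>\<^sup>+u. ennreal (\<Prod>i\<in>?J. \<bar>1 - u i\<bar> powr (a i - 1)) * ennreal (cmod (Lambda_op n K \<sigma> f (dilate ?J u x))) \<partial>leb ?J)"
    using dilation_integral_bound[OF K, of a] ab a1 unfolding \<sigma>_def by blast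
  obtain C2 where C2: "C2 > 0" "\<And>F x. F \<in> borel_measurable (leb ?J \<Otimes>\<^sub>M leb {1..n}) \<Longrightarrow> x \<in> Rn n \<Longrightarrow>
      \<Phi> (\<lambda>x. \<integral>\<^sup>+u. F (u, x) \<partial>leb ?J) x \<le> ennreal C2 * (\<integral>\<^sup>+u. \<Phi> (\<lambda>x. F (u, x)) x \<partial>leb ?J)"
    using norm_operator_minkowski[OF \<Phi>] by blast
  have "(\<Prod>i\<in>?J. \<integral>\<^sup>+u. ennreal (?v i u) \<partial>lborel) < \<infinity>"
    using nn_integral_dilation_weight_finite ab by (intro prod_ennreal_finite) auto
  then obtain C3 where C3: "C3 \<ge> 0"
      "(\<Prod>i\<in>?J. \<integral>\<^sup>+u. ennreal (?v i u) \<partial>lborel) = ennreal C3"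
    by (cases "(\<Prod>i\<in>?J. \<integral>\<^sup>+u. ennreal (?v i u) \<partial>lborel)") auto
  \<comment> \<open>The summands \<open>1\<close> make the constant positive, as homogeneity is available for positive factors only.\<close>
  define C where "C = (C1 + 1) * C2 * (C3 + 1)"
  have C: "C > 0" "(C1 + 1) * (C2 * C3) \<le> C"
    unfolding C_def using C1 C2 C3 by (auto simp: algebra_simps intro!: add_pos_nonneg)
  show ?thesis unfolding \<sigma>_def[symmetric]
  proof (intro exI[of _ C] conjI allI impI ballI C(1))
    fix f :: "(nat \<Rightarrow> real) \<Rightarrow> complex" and w :: "(nat \<Rightarrow> real) \<Rightarrow> ennreal" and x
    assume f: "test_function n f" and x: "x \<in> Rn n"
      and w: "\<forall>x\<in>nonzero_on n ?J. w x \<le> ennreal ((\<Prod>i=1..K. \<bar>x i\<bar> powr - a i) * cmod (f x))"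
    define G where "G x = ennreal (cmod (Lambda_op n K \<sigma> f x))" for x
    have G [measurable]: "G \<in> borel_measurable (leb {1..n})"
      using measurable_Lambda_op[OF f K(2) \<sigma> \<sigma>K] unfolding G_def by measurable
    define W where "W u = (\<Prod>i\<in>?J. \<bar>1 - u i\<bar> powr (a i - 1))" for u :: "nat \<Rightarrow> real"
    have [measurable]: "W \<in> borel_measurable (leb ?J)" unfolding W_def by measurable
    define F where "F p = ennreal (W (fst p)) * G (dilate ?J (fst p) (snd p))" for p
    have "(\<lambda>p. G (dilate ?J (fst p) (snd p))) \<in> borel_measurable (leb ?J \<Otimes>\<^sub>M leb {1..n})"
      using K by (intro measurable_compose[OF measurable_dilate G]) auto
    then have F: "F \<in> borel_measurable (leb ?J \<Otimes>\<^sub>M leb {1..n})"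
      unfolding F_def by measurable
    have I: "(\<lambda>x. \<integral>\<^sup>+u. F (u, x) \<partial>leb ?J) \<in> borel_measurable (leb {1..n})"
      using J.borel_measurable_nn_integral_fst[OF measurable_pair_swap[OF F]] by simp
    have "\<Phi> w x \<le> \<Phi> (\<lambda>x. ennreal (C1 + 1) * (\<integral>\<^sup>+u. F (u, x) \<partial>leb ?J)) x"
    proof (rule norm_operator_mono[OF \<Phi>, where A="{}"])
      show "(\<lambda>x. ennreal (C1 + 1) * (\<integral>\<^sup>+u. F (u, x) \<partial>leb ?J)) \<in> borel_measurable (leb {1..n})"
        using I by measurable
      show "x \<in> nonzero_on n {}" using x by (simp add: nonzero_on_def)
      fix y assume y: "y \<in> nonzero_on n ({} \<union> ?J)"
      then have "w y \<le> ennreal ((\<Prod>i=1..K. \<bar>y i\<bar> powr - a i) * cmod (f y))" using w by simp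
      also have "\<dots> \<le> ennreal C1 * (\<integral>\<^sup>+u. F (u, y) \<partial>leb ?J)"
        using C1(2)[OF f, of y] y unfolding F_def W_def G_def by simp
      also have "\<dots> \<le> ennreal (C1 + 1) * (\<integral>\<^sup>+u. F (u, y) \<partial>leb ?J)"
        by (intro mult_right_mono ennreal_leI) auto
      finally show "w y \<le> ennreal (C1 + 1) * (\<integral>\<^sup>+u. F (u, y) \<partial>leb ?J)" .
    qed
    also have "\<dots> = ennreal (C1 + 1) * \<Phi> (\<lambda>x. \<integral>\<^sup>+u. F (u, x) \<partial>leb ?J) x"
      using norm_operator_cmult[OF \<Phi>, of "C1 + 1"] C1(1) by simp
    also have "\<dots> \<le> ennreal (C1 + 1) * (ennreal C2 * (\<integral>\<^sup>+u. \<Phi> (\<lambda>x. F (u, x)) x \<partial>leb ?J))"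
      by (intro mult_left_mono C2(2) F x) simp
    also have "(\<integral>\<^sup>+u. \<Phi> (\<lambda>x. F (u, x)) x \<partial>leb ?J)
        = (\<integral>\<^sup>+u. (\<Prod>i\<in>?J. ennreal (?v i (u i))) * \<Phi> G x \<partial>leb ?J)"
    proof (rule nn_integral_cong_AE)
      have "AE u in leb ?J. \<forall>i\<in>?J. u i \<noteq> 0" "AE u in leb ?J. \<forall>i\<in>?J. u i \<noteq> 1"
        by (intro AE_finite_allI AE_leb_neq; simp)+
      then show "AE u in leb ?J. \<Phi> (\<lambda>x. F (u, x)) x
          = (\<Prod>i\<in>?J. ennreal (?v i (u i))) * \<Phi> G x"
      proof eventually_elim
        case (elim u)
        have W: "W u > 0" unfolding W_def using elim by (intro prod_pos) auto
        have "\<Phi> (\<lambda>x. F (u, x)) x = ennreal (W u) * \<Phi> (\<lambda>x. G (dilate ?J u x)) x"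
          unfolding F_def using norm_operator_cmult[OF \<Phi> W] by simp
        also have "\<Phi> (\<lambda>x. G (dilate ?J u x)) x = ennreal (\<Prod>i\<in>?J. \<bar>u i\<bar> powr - b i) * \<Phi> G (dilate (?J - ?J) u x)"
          using elim x K by (intro norm_operator_dilate[OF \<Phi> G]) auto
        also have "dilate (?J - ?J) u x = x" by (simp add: dilate_def)
        also have "ennreal (W u) * (ennreal (\<Prod>i\<in>?J. \<bar>u i\<bar> powr - b i) * \<Phi> G x)
            = ennreal (\<Prod>i\<in>?J. ?v i (u i)) * \<Phi> G x"
          using W by (simp add: W_def prod.distrib ennreal_mult prod_nonneg mult.assoc)
        finally show ?case by (simp add: prod_ennreal)
      qed
    qed
    also have "\<dots> = (\<integral>\<^sup>+u. (\<Prod>i\<in>?J. ennreal (?v i (u i))) \<partial>leb ?J) * \<Phi> G x"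
      by (rule nn_integral_multc) measurable
    also have "(\<integral>\<^sup>+u. (\<Prod>i\<in>?J. ennreal (?v i (u i))) \<partial>leb ?J) = ennreal C3"
      unfolding C3(2)[symmetric] by (intro product_nn_integral_prod) auto
    also have "ennreal (C1 + 1) * (ennreal C2 * (ennreal C3 * \<Phi> G x)) = ennreal ((C1 + 1) * (C2 * C3)) * \<Phi> G x"
      using C1 C2 C3 by (simp add: ennreal_mult mult.assoc del: ennreal_plus)
    also have "\<dots> \<le> ennreal C * \<Phi> G x" using C by (intro mult_right_mono ennreal_leI) auto
    finally show "\<Phi> w x \<le> ennreal C * \<Phi> (\<lambda>x. ennreal (cmod (Lambda_op n K \<sigma> f x))) x" unfolding G_def .
  qed
qed

section \<open>Blocks of variables\<close>

lemma block_end_Suc: "block_end k (Suc j) = block_end k j + k (Suc j)"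
  by (simp add: block_end_def)

lemma block_end_mono: "i \<le> j \<Longrightarrow> block_end k i \<le> block_end k j"
  unfolding block_end_def by (intro sum_mono2) auto

text \<open>
  The ends of the blocks do not decrease, so the first block ending at or after \<open>i\<close> contains \<open>i\<close>.
\<close>

definition block_of :: "(nat \<Rightarrow> nat) \<Rightarrow> nat \<Rightarrow> nat" where
  "block_of k i = (LEAST j. i \<le> block_end k j)"

lemma block_of_eq:
  assumes "l \<in> {1..k (Suc j)}" shows "block_of k (block_end k j + l) = Suc j"
  unfolding block_of_def
proof (rule Least_equality)
  show "block_end k j + l \<le> block_end k (Suc j)" using assms by (simp add: block_end_Suc)
next
  fix i assume "block_end k j + l \<le> block_end k i"
  then have "\<not> block_end k i \<le> block_end k j" using assms by simp
  then show "Suc j \<le> i" using block_end_mono[of i j k] by linarith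
qed

lemma index_in_block:
  assumes "i \<in> {1..block_end k N}"
  obtains j l where "j < N" "l \<in> {1..k (Suc j)}" "i = block_end k j + l"
  using assms
proof (induction N arbitrary: thesis)
  case 0
  then show ?case by (simp add: block_end_def)
next
  case (Suc N)
  show ?case
  proof (cases "i \<le> block_end k N")
    case True
    then show ?thesis using Suc.IH Suc.prems by (metis atLeastAtMost_iff less_Suc_eq)
  next
    case False
    then show ?thesis using Suc.prems by (intro Suc.prems(1)[of N "i - block_end k N"]) (auto simp: block_end_Suc)
  qed
qed

lemma block_split:
  "{1..block_end k (Suc N)} = {1..block_end k N} \<union> {block_end k N + 1..block_end k (Suc N)}"
  "{1..block_end k N} \<inter> {block_end k N + 1..block_end k (Suc N)} = {}"
  by (auto simp: block_end_Suc)

lemma prod_blocks: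
  "(\<Prod>i\<in>{1..block_end k N}. F i) = (\<Prod>j=1..N. \<Prod>i\<in>{block_end k (j - 1) + 1..block_end k j}. F i)"
  for F :: "nat \<Rightarrow> real"
proof (induction N)
  case (Suc N)
  show ?case
    unfolding block_split(1) using Suc block_split(2)[of k N] by (subst prod.union_disjoint) (auto simp: block_end_Suc)
qed (simp add: block_end_def)

lemma sum_blocks:
  "(\<Sum>i\<in>{1..block_end k N}. F i) = (\<Sum>j=1..N. \<Sum>i\<in>{block_end k (j - 1) + 1..block_end k j}. F i)"
  for F :: "nat \<Rightarrow> real"
proof (induction N)
  case (Suc N)
  show ?case
    unfolding block_split(1) using Suc block_split(2)[of k N] by (subst sum.union_disjoint) (auto simp: block_end_Suc)
qed (simp add: block_end_def)

lemma block_of_in_block: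
  assumes "j \<in> {1..N}" "i \<in> {block_end k (j - 1) + 1..block_end k j}"
  shows "block_of k i = j"
proof -
  obtain m where m: "j = Suc m" using assms(1) by (cases j) auto
  then have "i - block_end k m \<in> {1..k (Suc m)}" "i = block_end k m + (i - block_end k m)"
    using assms(2) by (auto simp: block_end_Suc)
  then show ?thesis using block_of_eq[of "i - block_end k m" k m] m by metis
qed

theorem corollary1p3:
  fixes n N :: nat and k :: "nat \<Rightarrow> nat"
    and P :: "nat \<Rightarrow> nat \<Rightarrow> real" and Q :: "nat \<Rightarrow> nat \<Rightarrow> ennreal"
    and p q :: ennreal and \<alpha> :: "nat \<Rightarrow> real"
  assumes "n \<ge> 1" and "N \<ge> 1"
    and "\<And>j. j \<in> {1..N} \<Longrightarrow> k j \<ge> 1"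
    and "(\<Sum>j=1..N. k j) \<le> n"
    and "0 < p" and "0 < q"
    and "\<And>j l. j \<in> {1..N} \<Longrightarrow> l \<in> {1..k j} \<Longrightarrow> 1 < P j l"
    and "\<And>j l. j \<in> {1..N} \<Longrightarrow> l \<in> {1..k j} \<Longrightarrow> 1 \<le> Q j l"
    and "\<And>j l. j \<in> {1..N} \<Longrightarrow> l \<in> {1..k j} \<Longrightarrow> 0 < \<alpha> j \<and> \<alpha> j < real (k j) / P j l"
  shows "\<exists>C::real. C \<ge> 0 \<and>
    (\<forall>f :: (nat \<Rightarrow> real) \<Rightarrow> complex. test_function n f \<longrightarrow>
      iterated_lorentz_norm n N k (\<lambda>j l. ennreal (P j l)) Q p q
        (\<lambda>x. f x / complex_of_real (\<Prod>j=1..N. \<bar>block_radius k j x\<bar> powr \<alpha> j))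
      \<le> ennreal C *
        iterated_lorentz_norm n N k (\<lambda>j l. ennreal (P j l)) Q p q
          (Lambda_op n (block_end k N) (\<Sum>j=1..N. \<alpha> j) f))"
proof -
  define K where "K = block_end k N"
  have K: "1 \<le> K" "K \<le> n"
  proof -
    show "K \<le> n" using assms(4) by (simp add: K_def block_end_def)
    have "k 1 \<le> K" unfolding K_def block_end_def using assms(2) by (intro member_le_sum) auto
    then show "1 \<le> K" using assms(3)[of 1] assms(2) by simp
  qed
  \<comment> \<open>\<open>a i\<close> is the share of \<open>\<alpha>\<^sub>j\<close> carried by the variable \<open>i\<close>, and \<open>b i\<close> the reciprocal of its first exponent.\<close>
  define a where "a i = \<alpha> (block_of k i) / real (k (block_of k i))" for i
  define b where "b i = 1 / P (block_of k i) (i - block_end k (block_of k i - 1))" for i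
  have ab: "0 < a i \<and> a i < b i \<and> b i < 1" if "i \<in> {1..K}" for i
  proof -
    obtain j l where jl: "j < N" "l \<in> {1..k (Suc j)}" "i = block_end k j + l"
      using index_in_block \<open>i \<in> {1..K}\<close> unfolding K_def by blast
    have "block_of k i = Suc j" using block_of_eq[of l k j] jl by simp
    then have i: "a i = \<alpha> (Suc j) / real (k (Suc j))" "b i = 1 / P (Suc j) l"
      using jl by (simp_all add: a_def b_def)
    have j: "Suc j \<in> {1..N}" using jl by simp
    have "k (Suc j) > 0" using jl by simp
    moreover have "1 < P (Suc j) l" "0 < \<alpha> (Suc j)" "\<alpha> (Suc j) < real (k (Suc j)) / P (Suc j) l"
      using assms(7,9)[OF j jl(2)] by auto
    ultimately show ?thesis unfolding i by (simp add: field_simps)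
  qed
  have block_sum: "(\<Sum>i\<in>{block_end k (j - 1) + 1..block_end k j}. a i) = \<alpha> j" if j: "j \<in> {1..N}" for j
  proof -
    obtain m where m: "j = Suc m" using j by (cases j) auto
    have "(\<Sum>i\<in>{block_end k (j - 1) + 1..block_end k j}. a i)
        = (\<Sum>i\<in>{block_end k (j - 1) + 1..block_end k j}. \<alpha> j / real (k j))"
      by (intro sum.cong refl) (simp only: a_def block_of_in_block[OF j])
    also have "\<dots> = \<alpha> j" using assms(3)[OF j] m by (simp add: block_end_Suc)
    finally show ?thesis .
  qed
  then have sum_a: "(\<Sum>i=1..K. a i) = (\<Sum>j=1..N. \<alpha> j)"
    unfolding K_def sum_blocks by (intro sum.cong refl) auto
  define \<Phi> where "\<Phi> = blocks_lorentz_norm k N (\<lambda>j l. ennreal (P j l)) Q"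
  have \<Phi>: "norm_operator n (leb {1..K}) b {1..K} \<Phi>"
    unfolding \<Phi>_def K_def
  proof (rule norm_operator_blocks)
    show "sigma_finite_measure (leb {1..block_end k N})" by (rule sigma_finite_leb) simp
    show "block_end k N \<le> n" using K by (simp add: K_def)
    fix j l assume jl: "j < N" "l \<in> {1..k (Suc j)}"
    then show "P (Suc j) l > 1 \<and> Q (Suc j) l \<ge> 1 \<and> b (block_end k j + l) = 1 / P (Suc j) l"
      using assms(7,8)[of "Suc j" l] block_of_eq[of l k j] by (simp add: b_def)
  qed
  from norm_operator_hardy[OF \<Phi> K ab] obtain C where C: "C > 0" and "\<forall>f w. test_function n f \<longrightarrow>
      (\<forall>x\<in>nonzero_on n {1..K}. w x \<le> ennreal ((\<Prod>i=1..K. \<bar>x i\<bar> powr - a i) * cmod (f x))) \<longrightarrow>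
      (\<forall>x\<in>Rn n. \<Phi> w x \<le> ennreal C * \<Phi> (\<lambda>x. ennreal (cmod (Lambda_op n K (\<Sum>i=1..K. a i) f x))) x)" by auto
  note bound = this(2)[rule_format]
  show ?thesis
  proof (intro exI[of _ C] conjI allI impI)
    show "C \<ge> 0" using C by simp
    fix f :: "(nat \<Rightarrow> real) \<Rightarrow> complex" assume f: "test_function n f"
    define w where "w x = ennreal (cmod (f x / complex_of_real (\<Prod>j=1..N. \<bar>block_radius k j x\<bar> powr \<alpha> j)))" for x
    define G where "G = \<Phi> (\<lambda>x. ennreal (cmod (Lambda_op n K (\<Sum>j=1..N. \<alpha> j) f x)))"
    have w_le: "w x \<le> ennreal ((\<Prod>i=1..K. \<bar>x i\<bar> powr - a i) * cmod (f x))" if x: "x \<in> nonzero_on n {1..K}" for x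
    proof -
      have "inverse (\<Prod>j=1..N. \<bar>block_radius k j x\<bar> powr \<alpha> j) = (\<Prod>j=1..N. \<bar>block_radius k j x\<bar> powr - \<alpha> j)"
        using prod_inversef[of "\<lambda>j. \<bar>block_radius k j x\<bar> powr \<alpha> j" "{1..N}"] by (simp add: comp_def powr_minus)
      also have "\<dots> \<le> (\<Prod>j=1..N. \<Prod>i\<in>{block_end k (j - 1) + 1..block_end k j}. \<bar>x i\<bar> powr - a i)"
      proof (intro prod_mono conjI)
        fix j assume j: "j \<in> {1..N}"
        let ?B = "{block_end k (j - 1) + 1..block_end k j}"
        have B: "?B \<subseteq> {1..K}" using block_end_mono[of j N k] j by (auto simp: K_def)
        have "\<bar>block_radius k j x\<bar> powr - \<alpha> j = (\<Sum>i\<in>?B. (x i)\<^sup>2) powr ((\<Sum>i\<in>?B. - a i) / 2)"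
          unfolding block_radius_def sum_negf block_sum[OF j]
          by (simp add: powr_half_sqrt[symmetric] powr_powr sum_nonneg)
        also have "\<dots> \<le> (\<Prod>i\<in>?B. \<bar>x i\<bar> powr - a i)"
        proof (intro powr_radius_le_prod)
          fix i assume "i \<in> ?B"
          then have i: "i \<in> {1..K}" using B by blast
          show "x i \<noteq> 0" using x i by (auto simp: nonzero_on_def)
          show "- a i \<le> 0" using ab[OF i] by simp
        qed simp
        finally show "\<bar>block_radius k j x\<bar> powr - \<alpha> j \<le> (\<Prod>i\<in>?B. \<bar>x i\<bar> powr - a i)" .
      qed simp
      also have "\<dots> = (\<Prod>i=1..K. \<bar>x i\<bar> powr - a i)" unfolding K_def by (rule prod_blocks[symmetric])
      finally have "inverse (\<Prod>j=1..N. \<bar>block_radius k j x\<bar> powr \<alpha> j) * cmod (f x)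
          \<le> (\<Prod>i=1..K. \<bar>x i\<bar> powr - a i) * cmod (f x)"
        by (rule mult_right_mono) simp
      moreover have "cmod (f x / complex_of_real r) = inverse r * cmod (f x)" if "r \<ge> 0" for r
        using that by (simp add: norm_divide field_simps)
      ultimately show ?thesis
        unfolding w_def by (subst \<open>\<And>r. r \<ge> 0 \<Longrightarrow> _\<close>) (auto intro!: ennreal_leI prod_nonneg)
    qed
    have le: "\<Phi> w x \<le> ennreal C * G x" if "x \<in> Rn n" for x
      using bound[OF f w_le that] unfolding sum_a G_def .
    have G: "G \<in> borel_measurable (leb {1..n})"
    proof -
      have "0 < (\<Sum>i=1..K. a i)" using K ab by (intro sum_pos) auto
      moreover have "(\<Sum>i=1..K. a i) < (\<Sum>i=1..K. 1)" using K ab by (intro sum_strict_mono) (auto intro: less_trans)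
      ultimately have "Lambda_op n K (\<Sum>j=1..N. \<alpha> j) f \<in> borel_measurable (leb {1..n})"
        unfolding sum_a by (intro measurable_Lambda_op[OF f K(2)]) auto
      then have "(\<lambda>x. ennreal (cmod (Lambda_op n K (\<Sum>j=1..N. \<alpha> j) f x))) \<in> borel_measurable (leb {1..n})"
        by measurable
      then show ?thesis unfolding G_def by (rule norm_operator_measurable[OF \<Phi>])
    qed
    have "(if K = n then \<Phi> w (\<lambda>_. undefined) else lorentz_norm (leb {K + 1..n}) p q (\<Phi> w))
        \<le> ennreal C * (if K = n then G (\<lambda>_. undefined) else lorentz_norm (leb {K + 1..n}) p q G)"
    proof (cases "K = n")
      case True
      then show ?thesis using le[of "\<lambda>_. undefined"] by (simp add: PiE_iff extensional_def)
    next
      case False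
      have sub: "x \<in> Rn n" if "x \<in> space (leb {K + 1..n})" for x
        using that by (auto simp: space_leb PiE_iff extensional_def)
      have "(\<lambda>x. x) \<in> leb {K + 1..n} \<rightarrow>\<^sub>M leb {1..n}"
      proof (rule measurable_PiM_single')
        fix i assume "i \<in> {1..n}"
        show "(\<lambda>x. x i) \<in> leb {K + 1..n} \<rightarrow>\<^sub>M lborel"
        proof (cases "i \<in> {K + 1..n}")
          case False
          have "(\<lambda>x. x i) \<in> leb {K + 1..n} \<rightarrow>\<^sub>M lborel \<longleftrightarrow> (\<lambda>x. undefined :: real) \<in> leb {K + 1..n} \<rightarrow>\<^sub>M lborel"
            using False by (intro measurable_cong) (auto simp: space_leb PiE_iff extensional_def)
          then show ?thesis by simp
        qed (rule measurable_component_singleton)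
      qed (use sub in auto)
      from measurable_compose[OF this G] have [measurable]: "G \<in> borel_measurable (leb {K + 1..n})" .
      have "lorentz_norm (leb {K + 1..n}) p q (\<Phi> w) \<le> lorentz_norm (leb {K + 1..n}) p q (\<lambda>x. ennreal C * G x)"
        by (intro lorentz_norm_mono_AE AE_I2 le sub) measurable
      then show ?thesis using False unfolding lorentz_norm_cmult[OF C assms(6)] by (simp only: if_False)
    qed
    then show "iterated_lorentz_norm n N k (\<lambda>j l. ennreal (P j l)) Q p q
        (\<lambda>x. f x / complex_of_real (\<Prod>j=1..N. \<bar>block_radius k j x\<bar> powr \<alpha> j))
      \<le> ennreal C * iterated_lorentz_norm n N k (\<lambda>j l. ennreal (P j l)) Q p q
          (Lambda_op n (block_end k N) (\<Sum>j=1..N. \<alpha> j) f)"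
      unfolding iterated_lorentz_norm_def Let_def \<Phi>_def[symmetric] K_def[symmetric] w_def[symmetric] G_def[symmetric]
      by simp
  qed
qed

end
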